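(* Let $d \ge 1$ and $\alpha \in (-1,\infty)^d$. Then the classical Laguerre semigroup maximal operator $T_*^{\alpha}f=\sup_{t>0}|T_t^{\alpha}f|$ is bounded from $L^1(d\mu_{\alpha})$ to weak $L^1(d\mu_{\alpha})$, that is, the estimate $$ \mu_{\alpha}\big\{ x \in \mathbb{R}^d_+ : T_*^{\alpha}f(x) > \lambda \big\} \le \frac{C}{\lambda}\int_{\mathbb{R}^d_+} |f(x)|\, d\mu_{\alpha}(x), \qquad \lambda > 0, \quad f \in L^1(d\mu_{\alpha}), $$ holds with a constant $C$ independent of $\lambda$ and $f$.
   Context: $\mathbb{R}^d_+=(0,\infty)^d$. For $\alpha\in\mathbb{R}^d$, $\mu_\alpha$ is the measure on $\mathbb{R}^d_+$ given by $d\mu_{\alpha}(x) = \big(\prod_{i=1}^d x_i^{\alpha_i}\big) e^{-(x_1+\ldots+x_d)}\,dx$. For $\alpha \in (-1,\infty)^d$ the classical Laguerre semigroup $\{T_t^\alpha\}_{t>0}$ is given, for $f\in L^1(d\mu_\alpha)$, by the absolutely convergent integral $$T_t^{\alpha}f(x) = \int_{\mathbb{R}_{+}^d} G_t^{\alpha}(x,y) f(y)\, d\mu_{\alpha}(y), \qquad x \in \mathbb{R}^d_{+},\ t>0,$$ where $G_t^{\alpha}(x,y) = \prod_{i=1}^d G_t^{\alpha_i}(x_i,y_i)$ and, for $a>-1$ and $u,v,t>0$, $$G_t^{a}(u,v)= \frac{e^{t(a+1)/2}}{2\sinh(t/2)} \exp\Big( - \frac{e^{-t/2}}{2\sinh(t/2)}(u+v)\Big)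 (uv)^{-a/2} I_{a}\Big( \frac{\sqrt{uv}}{\sinh(t/2)}\Big),$$ with $I_a$ the modified Bessel function of the first kind of order $a$. (Equivalently, $G_t^a(u,v)=\sum_{n\ge0}e^{-tn}\breve L_n^a(u)\breve L_n^a(v)$ with $\breve L_n^a$ the Laguerre polynomials normalized in $L^2(u^ae^{-u}du)$; on $L^2(d\mu_\alpha)$, $T_t^\alpha=\exp(-t\mathbb{L}_\alpha)$ where $\mathbb{L}_\alpha$ is the self-adjoint operator with $\mathbb{L}_\alpha L_n^\alpha=(n_1+\ldots+n_d)L_n^\alpha$, $n\in\mathbb{N}^d$, for the tensor product Laguerre polynomials $L_n^\alpha=\bigotimes_{i=1}^d L_{n_i}^{\alpha_i}$.) *)

theory Defs
  imports "HOL-Analysis.Analysis"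
begin

definition pos_orthant :: "(real ^ 'd) set" where
  "pos_orthant = {x. \<forall>i. 0 < x $ i}"

definition laguerre_measure :: "real ^ 'd \<Rightarrow> (real ^ 'd) measure" where
  "laguerre_measure \<alpha> =
     density (restrict_space lebesgue pos_orthant)
       (\<lambda>x. ennreal ((\<Prod>i\<in>UNIV. (x $ i) powr (\<alpha> $ i)) * exp (- (\<Sum>i\<in>UNIV. x $ i))))"

(* Modified Bessel function of the first kind, by its ascending series. The use of powr makes this
   meaningful for real arguments z > 0 only. *)
definition bessel_I :: "real \<Rightarrow> real \<Rightarrow> real" where
  "bessel_I a z = (\<Sum>k. (z / 2) powr (2 * real k + a) / (fact k * Gamma (real k + a + 1)))"

definition laguerre_kernel_1d :: "real \<Rightarrow> real \<Rightarrow> real \<Rightarrow> real \<Rightarrow> real" where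
  "laguerre_kernel_1d a t u v =
     exp (t * (a + 1) / 2) / (2 * sinh (t / 2))
     * exp (- (exp (- t / 2) / (2 * sinh (t / 2))) * (u + v))
     * (u * v) powr (- a / 2)
     * bessel_I a (sqrt (u * v) / sinh (t / 2))"

definition laguerre_kernel :: "real ^ 'd \<Rightarrow> real \<Rightarrow> real ^ 'd \<Rightarrow> real ^ 'd \<Rightarrow> real" where
  "laguerre_kernel \<alpha> t x y = (\<Prod>i\<in>UNIV. laguerre_kernel_1d (\<alpha> $ i) t (x $ i) (y $ i))"

definition laguerre_semigroup ::
  "real ^ 'd \<Rightarrow> real \<Rightarrow> (real ^ 'd \<Rightarrow> complex) \<Rightarrow> real ^ 'd \<Rightarrow> complex" where
  "laguerre_semigroup \<alpha> t f x =
     (LINT y|laguerre_measure \<alpha>. complex_of_real (laguerre_kernel \<alpha> t x y) * f y)"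

(* The supremum is taken in the extended half-line, so it may be infinite. *)
definition laguerre_maximal ::
  "real ^ 'd \<Rightarrow> (real ^ 'd \<Rightarrow> complex) \<Rightarrow> real ^ 'd \<Rightarrow> ennreal" where
  "laguerre_maximal \<alpha> f x = (SUP t\<in>{0<..}. ennreal (norm (laguerre_semigroup \<alpha> t f x)))"

end

theory Submission
  imports Defs
begin

text \<open>Write \<open>|x|\<close> for the sum of the coordinates, \<open>q = exp (-t)\<close> and \<open>\<tau> = 1 - q\<close>. Everything rests on the
identity \<open>G\<^sub>t(x, y) = exp |x| * P\<^sub>\<tau>(x, q y)\<close> (\<open>laguerre_kernel_1d_conv_sq_bessel\<close>), where \<open>P\<^sub>\<tau>\<close> is the
tensor product of the heat kernels of the squared Bessel processes. These kernels are explicit,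
symmetric, homogeneous under dilations, form a semigroup in \<open>\<tau>\<close>, and have integral one with
respect to \<open>d\<nu> = (\<Prod>i. x\<^sub>i powr \<alpha>\<^sub>i) dx\<close>. They are compared with each other by means of one growth
bound for the Bessel--Clifford function, \<open>bessel_clifford_growth\<close>, which gives Harnack inequalities
in the time and in the second argument along a ray, for all parameters above \<open>-1\<close> alike.

Times are split at \<open>t (1 + |x|) = 1/100\<close>. For smaller \<open>t\<close> the drift of the semigroup is negligible
on the diffusion scale, so \<open>G\<^sub>t(x, y)\<close> is at most a constant times \<open>G\<^sub>s(x, y)\<close> for all \<open>s\<close> between \<open>5t\<close> and
\<open>6t\<close> and all \<open>y\<close> (\<open>bessel_heat_local_comparison\<close>). Hence \<open>|T\<^sub>t f|\<close> is dominated by ergodic averages of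
\<open>T\<^sub>h|f|\<close> for small \<open>h\<close>, and Hopf's maximal ergodic theorem (\<open>hopf_maximal_ergodic\<close>) applies.

For larger \<open>t\<close>, normalise the norm of \<open>f\<close> to one and let \<open>exp R\<close> be the level. Where \<open>|x| < R/2\<close> a crude
bound on \<open>G\<^sub>t\<close> shows that the level is not exceeded, and the region \<open>|x| > 2R\<close> has measure
\<open>O(exp (-R))\<close>. On the remaining shell, replace the supremum over \<open>t\<close> by one over \<open>\<tau>\<close> and over all
points of the ray through \<open>y\<close>, regarded as independent. By Harnack this supremum is at most a
constant times a sum of kernels \<open>P\<close>, over a geometric sequence of times \<open>\<tau> \<ge> c/R\<close> and over points of the ray whose
square roots are spaced by \<open>sqrt \<tau>\<close> (\<open>bessel_heat_le_ray_kernel\<close>). About \<open>sqrt (R/\<tau>)\<close> points matter,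
each kernel has integral one, and so the sum has integral \<open>O(R)\<close>. Since this majorant is essentially constant along
rays while the factor \<open>exp |x|\<close> grows, integrating the Laguerre weight along rays over the superlevel set gains the missing
factor \<open>1/R\<close> (\<open>nonlocal_shell_weak_type\<close>).\<close>

section \<open>The Bessel--Clifford function\<close>

text \<open>The modified Bessel function is \<open>I\<^sub>a(z) = (z/2) powr a * bessel_clifford a (z\<^sup>2/4)\<close>. Splitting off the
power leaves an entire function with positive coefficients, which has no singularity at the
boundary of the orthant.\<close>

definition bessel_clifford :: "real \<Rightarrow> real \<Rightarrow> real" where
  "bessel_clifford a x = (\<Sum>k. x ^ k / (fact k * Gamma (real k + a + 1)))"

text \<open>The heat kernel, with respect to \<open>w powr a dw\<close>, of \<open>x (d/dx)\<^sup>2 + (a + 1) d/dx\<close>, the generator of a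
squared Bessel process; in the variable \<open>sqrt x\<close> it behaves like a Gaussian of width \<open>sqrt \<tau>\<close>.\<close>

definition sq_bessel_kernel :: "real \<Rightarrow> real \<Rightarrow> real \<Rightarrow> real \<Rightarrow> real" where
  "sq_bessel_kernel a \<tau> u w =
     \<tau> powr (- (a + 1)) * exp (- (u + w) / \<tau>) * bessel_clifford a (u * w / \<tau>\<^sup>2)"

lemma Gamma_shift_pos: "a > -1 \<Longrightarrow> Gamma (real k + a + 1) > 0"
  by (intro Gamma_real_pos) auto

lemma Gamma_shift_Suc: "a > -1 \<Longrightarrow> Gamma (real (Suc k) + a + 1) = (real k + a + 1) * Gamma (real k + a + 1)"
  using Gamma_plus1[of "real k + a + 1"] nonpos_Ints_nonpos[of "real k + a + 1"]
  by (force simp: add_ac)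

lemma summable_power_over_Gamma:
  assumes "a > -1"
  shows "summable (\<lambda>k. c ^ k / Gamma (real k + a + 1))"
proof (rule summable_ratio_test[where c = "1/2" and N = "nat \<lceil>2 * \<bar>c\<bar> + 1\<rceil>"])
  fix n assume n: "n \<ge> nat \<lceil>2 * \<bar>c\<bar> + 1\<rceil>"
  then have n': "real n \<ge> 2 * \<bar>c\<bar> + 1" by linarith
  then have pos: "real n + a + 1 > 0" and le: "2 * \<bar>c\<bar> \<le> real n + a + 1" using assms by auto
  have "norm (c ^ Suc n / Gamma (real (Suc n) + a + 1))
      = (\<bar>c\<bar> / (real n + a + 1)) * norm (c ^ n / Gamma (real n + a + 1))"
    using pos Gamma_shift_pos[OF assms, of n]
    by (subst Gamma_shift_Suc[OF assms]) (simp add: abs_mult power_abs)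
  also have "... \<le> 1/2 * norm (c ^ n / Gamma (real n + a + 1))"
    using pos le by (intro mult_right_mono) (auto simp: field_simps)
  finally show "norm (c ^ Suc n / Gamma (real (Suc n) + a + 1)) \<le> 1/2 * norm (c ^ n / Gamma (real n + a + 1))" .
qed auto

lemma summable_bessel_clifford:
  assumes "a > -1"
  shows "summable (\<lambda>k. x ^ k / (fact k * Gamma (real k + a + 1)))"
proof (rule summable_comparison_test')
  show "summable (\<lambda>k. \<bar>x\<bar> ^ k / Gamma (real k + a + 1))"
    using summable_power_over_Gamma[OF assms] .
  fix n :: nat
  have "\<bar>x\<bar> ^ n / (fact n * Gamma (real n + a + 1)) \<le> \<bar>x\<bar> ^ n / (1 * Gamma (real n + a + 1))"
    using Gamma_shift_pos[OF assms, of n]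
    by (intro divide_left_mono mult_right_mono mult_pos_pos) (auto simp: fact_ge_1)
  then show "norm (x ^ n / (fact n * Gamma (real n + a + 1))) \<le> \<bar>x\<bar> ^ n / Gamma (real n + a + 1)"
    using Gamma_shift_pos[OF assms, of n] by (simp add: abs_mult power_abs)
qed

lemma bessel_clifford_sums:
  "a > -1 \<Longrightarrow> (\<lambda>k. x ^ k / (fact k * Gamma (real k + a + 1))) sums bessel_clifford a x"
  unfolding bessel_clifford_def using summable_bessel_clifford by (rule summable_sums)

lemma bessel_clifford_mono:
  assumes "a > -1" "0 \<le> x" "x \<le> y"
  shows "bessel_clifford a x \<le> bessel_clifford a y"
  unfolding bessel_clifford_def
  using assms Gamma_shift_pos[OF assms(1)]
  by (intro suminf_le summable_bessel_clifford divide_right_mono power_mono)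
     (auto intro: less_imp_le)

lemma bessel_clifford_pos:
  assumes "a > -1" "0 \<le> x"
  shows "bessel_clifford a x > 0"
proof -
  have "bessel_clifford a 0 = 1 / Gamma (a + 1)"
    unfolding bessel_clifford_def using powser_zero[of "\<lambda>k. 1 / (fact k * Gamma (real k + a + 1))"]
    by simp
  also have "... > 0" using Gamma_shift_pos[OF assms(1), of 0] by simp
  finally show ?thesis using bessel_clifford_mono[OF assms(1) _ assms(2)] by simp
qed

lemma bessel_clifford_has_derivative:
  assumes "a > -1"
  defines "c \<equiv> \<lambda>k. 1 / (fact k * Gamma (real k + a + 1))"
  shows "(bessel_clifford a has_field_derivative (\<Sum>n. diffs c n * x ^ n)) (at x)"
proof -
  have eq: "bessel_clifford a = (\<lambda>x. \<Sum>k. c k * x ^ k)"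
    by (simp add: bessel_clifford_def c_def fun_eq_iff)
  show ?thesis unfolding eq
    by (rule termdiffs_strong_converges_everywhere) (use summable_bessel_clifford[OF assms(1)] in \<open>simp add: c_def\<close>)
qed

lemma continuous_bessel_clifford:
  "a > -1 \<Longrightarrow> isCont (bessel_clifford a) x"
  using bessel_clifford_has_derivative by (rule DERIV_isCont)

text \<open>If \<open>k\<close> is distributed according to the terms of the series, then \<open>x D / B\<close> is its mean, while the
mean of \<open>k (k + a)\<close> is exactly \<open>x\<close>. Completing the square, \<open>(2c - 1) k \<le> k (k + a) + c\<^sup>2\<close> for
\<open>a > -1\<close>; the choice \<open>c = 1 + sqrt x\<close> bounds the mean by \<open>1 + sqrt x\<close>.\<close>

lemma bessel_clifford_log_derivative:
  assumes a: "a > -1" and x: "x > 0"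
  obtains D where "(bessel_clifford a has_field_derivative D) (at x)"
    and "x * D \<le> (1 + sqrt x) * bessel_clifford a x"
proof
  define c where "c = (\<lambda>k. 1 / (fact k * Gamma (real k + a + 1)))"
  define D where "D = (\<Sum>n. diffs c n * x ^ n)"
  show "(bessel_clifford a has_field_derivative D) (at x)"
    unfolding D_def c_def by (rule bessel_clifford_has_derivative[OF a])
  let ?b = "\<lambda>k. c k * x ^ k"
  have smb: "summable (\<lambda>k. c k * y ^ k)" for y
    using summable_bessel_clifford[OF a, of y] by (simp add: c_def)
  have B: "?b sums bessel_clifford a x"
    using bessel_clifford_sums[OF a, of x] by (simp add: c_def)
  have "(\<lambda>n. diffs c n * x ^ n) sums D"
    unfolding D_def using termdiff_converges_all[OF smb] by (rule summable_sums)
  then have "(\<lambda>n. real (Suc n) * ?b (Suc n)) sums (x * D)"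
    by (auto simp: diffs_def mult_ac dest: sums_mult[where c = x])
  then have D: "(\<lambda>n. real n * ?b n) sums (x * D)"
    using sums_Suc_iff[of "\<lambda>n. real n * ?b n" "x * D"] by simp
  have "(\<lambda>n. x * ?b n) sums (x * bessel_clifford a x)"
    using B by (rule sums_mult)
  moreover have "x * ?b n = real (Suc n) * (real (Suc n) + a) * ?b (Suc n)" for n
  proof -
    define p where "p = real n + a + 1"
    have p: "p \<noteq> 0" "real (Suc n) + a = p" using a by (auto simp: p_def)
    have "c (Suc n) = c n / (real (Suc n) * p)"
      unfolding c_def Gamma_shift_Suc[OF a] p_def[symmetric] by simp
    then show ?thesis using p by simp
  qed
  ultimately have "(\<lambda>n. real (Suc n) * (real (Suc n) + a) * ?b (Suc n)) sums (x * bessel_clifford a x)"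
    by simp
  then have Q: "(\<lambda>n. real n * (real n + a) * ?b n) sums (x * bessel_clifford a x)"
    using sums_Suc_iff[of "\<lambda>n. real n * (real n + a) * ?b n"] by simp
  have bnn: "?b n \<ge> 0" for n
    using Gamma_shift_pos[OF a, of n] x by (simp add: c_def)
  have term_le: "(2 * sqrt x + 1) * (real n * ?b n) \<le> real n * (real n + a) * ?b n + (1 + sqrt x)\<^sup>2 * ?b n" for n
  proof -
    have "real n * a \<ge> real n * (-1)" using a by (intro mult_left_mono) auto
    moreover have "(real n - (1 + sqrt x))\<^sup>2 \<ge> 0" by simp
    ultimately have "(2 * sqrt x + 1) * real n \<le> real n * (real n + a) + (1 + sqrt x)\<^sup>2"
      by (simp add: power2_eq_square algebra_simps)
    from mult_right_mono[OF this bnn[of n]] show ?thesis by (simp add: algebra_simps)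
  qed
  have "(2 * sqrt x + 1) * (x * D) \<le> x * bessel_clifford a x + (1 + sqrt x)\<^sup>2 * bessel_clifford a x"
    by (rule sums_le[OF term_le sums_mult[OF D] sums_add[OF Q sums_mult[OF B]]])
  also have "... \<le> (2 * sqrt x + 1) * ((1 + sqrt x) * bessel_clifford a x)"
  proof -
    have "x + (1 + sqrt x)\<^sup>2 \<le> (2 * sqrt x + 1) * (1 + sqrt x)"
    proof -
      define s where "s = sqrt x"
      have s: "s \<ge> 0" "x = s * s" using x by (auto simp: s_def)
      have "s * s + (1 + s)\<^sup>2 \<le> (2 * s + 1) * (1 + s)"
        using s(1) by (simp add: power2_eq_square algebra_simps)
      then show ?thesis unfolding s_def[symmetric] s(2)[symmetric] .
    qed
    from mult_right_mono[OF this, of "bessel_clifford a x"] show ?thesis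
      using bessel_clifford_pos[OF a, of x] x by (simp add: algebra_simps)
  qed
  finally show "x * D \<le> (1 + sqrt x) * bessel_clifford a x"
    using x by (auto simp: mult_le_cancel_left add_pos_nonneg)
qed

text \<open>Integration of the bound on the logarithmic derivative. Only the ratio of two values is controlled,
and only from above; this replaces the two-sided asymptotics of \<open>I\<^sub>a\<close>.\<close>

lemma bessel_clifford_growth:
  assumes a: "a > -1" and x: "0 < x" "x \<le> y"
  shows "bessel_clifford a y \<le> (y / x) * exp (2 * (sqrt y - sqrt x)) * bessel_clifford a x"
proof -
  define \<phi> where "\<phi> z = bessel_clifford a z * exp (- 2 * sqrt z) / z" for z
  have "\<phi> y \<le> \<phi> x"
  proof (rule DERIV_nonpos_imp_nonincreasing[OF x(2)])
    fix z assume z: "x \<le> z" "z \<le> y"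
    then have z0: "z > 0" using x by simp
    obtain D where D: "(bessel_clifford a has_field_derivative D) (at z)"
      and le: "z * D \<le> (1 + sqrt z) * bessel_clifford a z"
      using bessel_clifford_log_derivative[OF a z0] .
    define B where "B = bessel_clifford a z"
    have "(\<phi> has_field_derivative
       ((D * exp (- 2 * sqrt z) + bessel_clifford a z * (exp (- 2 * sqrt z) * (- 2 * (inverse (sqrt z) / 2)))) * z
         - bessel_clifford a z * exp (- 2 * sqrt z) * 1) / (z * z)) (at z)"
      unfolding \<phi>_def using z0 by (auto intro!: derivative_eq_intros D simp: field_simps)
    moreover have "((D * exp (- 2 * sqrt z) + bessel_clifford a z * (exp (- 2 * sqrt z) * (- 2 * (inverse (sqrt z) / 2)))) * z
         - bessel_clifford a z * exp (- 2 * sqrt z) * 1) / (z * z) \<le> 0"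
    proof -
      have s: "inverse (sqrt z) * z = sqrt z" using z0 by (simp add: field_simps)
      have "((D * exp (- 2 * sqrt z) + B * (exp (- 2 * sqrt z) * (- 2 * (inverse (sqrt z) / 2)))) * z
         - B * exp (- 2 * sqrt z) * 1) = exp (- 2 * sqrt z) * (z * D - B * (inverse (sqrt z) * z) - B)"
        by (simp add: algebra_simps)
      also have "... = exp (- 2 * sqrt z) * (z * D - (1 + sqrt z) * B)"
        unfolding s by (simp add: algebra_simps)
      also have "... \<le> 0" using le by (intro mult_nonneg_nonpos) (auto simp: B_def)
      finally show ?thesis using z0 unfolding B_def by (intro divide_nonpos_nonneg) auto
    qed
    ultimately show "\<exists>d. (\<phi> has_real_derivative d) (at z) \<and> d \<le> 0" by blast
  qed
  then have "\<phi> y * (y * exp (2 * sqrt y)) \<le> \<phi> x * (y * exp (2 * sqrt y))"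
    using x by (intro mult_right_mono) auto
  moreover have "\<phi> y * (y * exp (2 * sqrt y)) = bessel_clifford a y"
  proof -
    have "\<phi> y * (y * exp (2 * sqrt y)) = bessel_clifford a y * (exp (- 2 * sqrt y) * exp (2 * sqrt y))"
      unfolding \<phi>_def using x by simp
    then show ?thesis by (simp flip: exp_add)
  qed
  moreover have "\<phi> x * (y * exp (2 * sqrt y)) = (y / x) * exp (2 * (sqrt y - sqrt x)) * bessel_clifford a x"
  proof -
    have "\<phi> x * (y * exp (2 * sqrt y)) = (y / x) * (exp (- 2 * sqrt x) * exp (2 * sqrt y)) * bessel_clifford a x"
      unfolding \<phi>_def by simp
    also have "exp (- 2 * sqrt x) * exp (2 * sqrt y) = exp (2 * (sqrt y - sqrt x))"
      by (simp add: algebra_simps flip: exp_add)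
    finally show ?thesis .
  qed
  ultimately show ?thesis by simp
qed

text \<open>The constant in a crude bound on the kernels that is uniform in one of the two variables.\<close>

definition crude_const :: "real \<Rightarrow> real" where
  "crude_const a = (1 + 1 / (a + 1)) / Gamma (a + 1)"

lemma crude_const_pos: "a > -1 \<Longrightarrow> crude_const a > 0"
  using Gamma_shift_pos[of a 0] by (simp add: crude_const_def add_pos_pos)

text \<open>For \<open>k \<ge> 1\<close> the Gamma function is at least \<open>(a + 1) * Gamma (a + 1) * fact (k - 1)\<close>, also for negative
\<open>a\<close>, and \<open>s ^ (k - 1) / fact (k - 1) \<le> exp s\<close>.\<close>

lemma power_le_Gamma_exp:
  assumes a: "a > -1" and s: "s \<ge> 0"
  shows "s ^ k / Gamma (real k + a + 1) \<le> crude_const a * (1 + s) * exp s"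
proof -
  have G: "Gamma (a + 1) > 0" using Gamma_shift_pos[OF a, of 0] by simp
  have c: "1 / Gamma (a + 1) \<le> crude_const a" "1 / ((a + 1) * Gamma (a + 1)) \<le> crude_const a"
    using a G by (simp_all add: crude_const_def add_divide_distrib)
  have e: "1 * 1 \<le> (1 + s) * exp s" using s by (intro mult_mono) auto
  show ?thesis
  proof (cases k)
    case 0
    then show ?thesis
      using mult_mono[OF c(1) e] crude_const_pos[OF a] by (simp add: mult.assoc)
  next
    case (Suc n)
    have low: "fact n * ((a + 1) * Gamma (a + 1)) \<le> Gamma (real (Suc n) + a + 1)" for n
    proof (induction n)
      case 0
      then show ?case using Gamma_shift_Suc[OF a, of 0] by simp
    next
      case (Suc n)
      have "fact (Suc n) * ((a + 1) * Gamma (a + 1)) = real (Suc n) * (fact n * ((a + 1) * Gamma (a + 1)))"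
        by (simp add: mult_ac)
      also have "... \<le> (real (Suc n) + a + 1) * Gamma (real (Suc n) + a + 1)"
        using Suc a Gamma_shift_pos[OF a, of "Suc n"] G by (intro mult_mono) auto
      also have "... = Gamma (real (Suc (Suc n)) + a + 1)" by (rule Gamma_shift_Suc[OF a, symmetric])
      finally show ?case .
    qed
    have "s ^ n / fact n \<le> exp s"
      using sum_le_suminf[of "\<lambda>n. s ^ n /\<^sub>R fact n" "{n}"] s summable_exp_generic[of s]
      by (simp add: exp_def divide_inverse mult.commute)
    then have "s * (s ^ n / fact n) * (1 / ((a + 1) * Gamma (a + 1))) \<le> s * exp s * crude_const a"
      using s a G c(2) by (intro mult_mono) auto
    moreover have "s ^ k / Gamma (real k + a + 1) \<le> s ^ k / (fact n * ((a + 1) * Gamma (a + 1)))"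
      unfolding Suc using s a G low[of n] Gamma_shift_pos[OF a, of "Suc n"]
      by (intro divide_left_mono mult_pos_pos) auto
    ultimately have "s ^ k / Gamma (real k + a + 1) \<le> s * exp s * crude_const a"
      by (simp add: Suc)
    also have "... \<le> crude_const a * (1 + s) * exp s"
      using crude_const_pos[OF a] by (simp add: algebra_simps)
    finally show ?thesis .
  qed
qed

lemma bessel_clifford_le_exp:
  assumes a: "a > -1" and s: "s \<ge> 0" and C: "\<And>k. r ^ k / Gamma (real k + a + 1) \<le> C"
  shows "bessel_clifford a (r * s) \<le> C * exp s"
proof -
  have "(r * s) ^ k / (fact k * Gamma (real k + a + 1)) \<le> C * (s ^ k /\<^sub>R fact k)" for k
  proof -
    have "(r * s) ^ k / (fact k * Gamma (real k + a + 1)) = (r ^ k / Gamma (real k + a + 1)) * (s ^ k /\<^sub>R fact k)"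
      by (simp add: power_mult_distrib divide_inverse)
    also have "... \<le> C * (s ^ k /\<^sub>R fact k)" using C s by (intro mult_right_mono) auto
    finally show ?thesis .
  qed
  from sums_le[OF this bessel_clifford_sums[OF a] sums_mult[OF exp_converges]] show ?thesis .
qed

section \<open>Series identities\<close>

lemma suminf_swap_ennreal:
  fixes f :: "nat \<Rightarrow> nat \<Rightarrow> ennreal"
  shows "(\<Sum>i. \<Sum>j. f i j) = (\<Sum>j. \<Sum>i. f i j)"
  using nn_integral_suminf[of "\<lambda>j i. f i j" "count_space (UNIV :: nat set)"]
  by (simp add: nn_integral_count_space_nat)

lemma suminf_shift_ennreal:
  fixes g :: "nat \<Rightarrow> ennreal"
  shows "(\<Sum>j. if m \<le> j then g (j - m) else 0) = (\<Sum>j. g j)"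
  using suminf_offset[of "\<lambda>j. if m \<le> j then g (j - m) else 0" m] by simp

text \<open>The coefficient of \<open>X\<^sup>j Y\<^sup>k\<close> in the power series of \<open>exp (X + Y) * bessel_clifford a (X Y)\<close>.\<close>

definition cross_coeff :: "real \<Rightarrow> nat \<Rightarrow> nat \<Rightarrow> real" where
  "cross_coeff a j k = Gamma (real j + real k + a + 1) / (fact j * fact k * Gamma (real j + a + 1) * Gamma (real k + a + 1))"

text \<open>The Chu--Vandermonde identity for \<open>(a + j + k) gchoose k\<close>, written with Gamma functions.\<close>

lemma Gamma_Vandermonde:
  assumes a: "a > -1"
  shows "cross_coeff a j k
    = (\<Sum>m. if m \<le> j \<and> m \<le> k then 1 / (fact m * Gamma (real m + a + 1) * fact (j - m) * fact (k - m)) else 0)"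
proof -
  let ?c = "\<lambda>m. if m \<le> j \<and> m \<le> k then 1 / (fact m * Gamma (real m + a + 1) * fact (j - m) * fact (k - m)) else 0"
  have notin: "z \<notin> \<int>\<^sub>\<le>\<^sub>0" if "z > 0" for z :: real
    using that nonpos_Ints_nonpos[of z] by force
  have pos: "Gamma (real i + a + 1) > 0" for i by (rule Gamma_shift_pos[OF a])
  have "(\<Sum>m. ?c m)
     = (\<Sum>m\<in>{0..k}. ?c m)"
    by (intro suminf_finite) auto
  also have "... = (\<Sum>m\<in>{0..k}. (real j gchoose m) * ((a + real k) gchoose (k - m)) / (fact j * Gamma (real k + a + 1)))"
  proof (intro sum.cong refl)
    fix m assume m: "m \<in> {0..k}"
    have g: "((a + real k) gchoose (k - m)) = Gamma (real k + a + 1) / (fact (k - m) * Gamma (real m + a + 1))"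
      using m a by (subst gbinomial_Gamma) (auto intro!: notin simp: of_nat_diff add_ac)
    have b: "(real j gchoose m) = (if m \<le> j then fact j / (fact m * fact (j - m)) else 0)"
      using binomial_fact[of m j, where 'a = real] by (auto simp flip: binomial_gbinomial)
    have nz: "Gamma (real k + a + 1) \<noteq> 0" using pos[of k] by linarith
    show "?c m
      = (real j gchoose m) * ((a + real k) gchoose (k - m)) / (fact j * Gamma (real k + a + 1))"
      using m nz unfolding b g by simp
  qed
  also have "... = ((real j + (a + real k)) gchoose k) / (fact j * Gamma (real k + a + 1))"
    by (simp add: gbinomial_Vandermonde flip: sum_divide_distrib)
  also have "((real j + (a + real k)) gchoose k) = Gamma (real j + real k + a + 1) / (fact k * Gamma (real j + a + 1))"
    using a by (subst gbinomial_Gamma) (auto intro!: notin simp: add_ac)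
  finally show ?thesis by (simp add: cross_coeff_def mult_ac)
qed

lemma ennreal_suminf_exp: "x \<ge> 0 \<Longrightarrow> (\<Sum>k. ennreal (x ^ k / fact k)) = ennreal (exp x)"
  using exp_converges[of x] by (intro suminf_ennreal_eq) (auto simp: divide_inverse mult_ac)

lemma ennreal_suminf_bessel_clifford:
  "a > -1 \<Longrightarrow> x \<ge> 0 \<Longrightarrow>
    (\<Sum>k. ennreal (x ^ k / (fact k * Gamma (real k + a + 1)))) = ennreal (bessel_clifford a x)"
  using Gamma_shift_pos[of a]
  by (intro suminf_ennreal_eq bessel_clifford_sums) (auto intro!: divide_nonneg_nonneg mult_nonneg_nonneg less_imp_le)

text \<open>Expanding the coefficient by Vandermonde and summing over \<open>j \<ge> m\<close> and \<open>k \<ge> m\<close> first produces the two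
exponentials; the sum over \<open>m\<close> that remains is the Bessel--Clifford series at \<open>X Y\<close>. This is the
computation behind the semigroup property.\<close>

lemma bessel_clifford_double_series:
  assumes a: "a > -1" and X: "X \<ge> 0" and Y: "Y \<ge> 0"
  shows "(\<Sum>j. \<Sum>k. ennreal (X ^ j * Y ^ k * cross_coeff a j k))
         = ennreal (exp (X + Y) * bessel_clifford a (X * Y))"
proof -
  have pos: "Gamma (real i + a + 1) > 0" for i by (rule Gamma_shift_pos[OF a])
  define g where "g = (\<lambda>Z n. ennreal (Z ^ n / fact n :: real))"
  have gsum: "(\<Sum>n. g Z n) = ennreal (exp Z)" if "Z \<ge> 0" for Z
    unfolding g_def using ennreal_suminf_exp[OF that] .
  define b where "b = (\<lambda>m. ennreal ((X * Y) ^ m / (fact m * Gamma (real m + a + 1))))"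
  have "ennreal (X ^ j * Y ^ k * cross_coeff a j k)
     = (\<Sum>m. b m * (if m \<le> j then g X (j - m) else 0) * (if m \<le> k then g Y (k - m) else 0))" (is "?L = ?R") for j k
  proof -
    define c where "c = (\<lambda>m. if m \<le> j \<and> m \<le> k then 1 / (fact m * Gamma (real m + a + 1) * fact (j - m) * fact (k - m)) else 0)"
    have cnn: "c m \<ge> 0" for m using pos[of m] by (simp add: c_def)
    have "?L = ennreal (X ^ j * Y ^ k * (\<Sum>m. c m))"
      unfolding c_def Gamma_Vandermonde[OF a, symmetric] by simp
    also have "... = ennreal (\<Sum>m\<in>{0..k}. X ^ j * Y ^ k * c m)"
      by (subst suminf_finite[of "{0..k}"]) (auto simp: c_def sum_distrib_left)
    also have "... = (\<Sum>m\<in>{0..k}. ennreal (X ^ j * Y ^ k * c m))"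
      using X Y cnn by (simp add: sum_ennreal)
    also have "... = (\<Sum>m\<in>{0..k}. b m * (if m \<le> j then g X (j - m) else 0) * (if m \<le> k then g Y (k - m) else 0))"
    proof (intro sum.cong refl)
      fix m assume "m \<in> {0..k}"
      show "ennreal (X ^ j * Y ^ k * c m) = b m * (if m \<le> j then g X (j - m) else 0) * (if m \<le> k then g Y (k - m) else 0)"
      proof (cases "m \<le> j \<and> m \<le> k")
        case True
        then have "X ^ j = X ^ m * X ^ (j - m)" "Y ^ k = Y ^ m * Y ^ (k - m)"
          by (auto simp flip: power_add)
        then have "X ^ j * Y ^ k * c m = (X * Y) ^ m / (fact m * Gamma (real m + a + 1))
            * (X ^ (j - m) / fact (j - m)) * (Y ^ (k - m) / fact (k - m))"
          using True by (simp add: c_def power_mult_distrib)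
        then show ?thesis
          using True X Y pos[of m] by (simp add: b_def g_def flip: ennreal_mult')
      qed (auto simp: c_def)
    qed
    also have "... = ?R"
      by (intro suminf_finite[symmetric]) auto
    finally show ?thesis .
  qed
  then have "(\<Sum>j. \<Sum>k. ennreal (X ^ j * Y ^ k * cross_coeff a j k))
      = (\<Sum>j. \<Sum>k. \<Sum>m. b m * (if m \<le> j then g X (j - m) else 0) * (if m \<le> k then g Y (k - m) else 0))"
    by simp
  also have "... = (\<Sum>j. \<Sum>m. \<Sum>k. b m * (if m \<le> j then g X (j - m) else 0) * (if m \<le> k then g Y (k - m) else 0))"
    by (subst suminf_swap_ennreal) simp
  also have "... = (\<Sum>j. \<Sum>m. b m * (if m \<le> j then g X (j - m) else 0) * ennreal (exp Y))"
    using gsum[OF Y] by (simp add: suminf_shift_ennreal)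
  also have "... = (\<Sum>m. \<Sum>j. b m * (if m \<le> j then g X (j - m) else 0) * ennreal (exp Y))"
    by (rule suminf_swap_ennreal)
  also have "... = (\<Sum>m. b m * ennreal (exp X) * ennreal (exp Y))"
    using gsum[OF X] by (simp add: suminf_shift_ennreal)
  also have "... = ennreal (bessel_clifford a (X * Y)) * ennreal (exp X) * ennreal (exp Y)"
    using ennreal_suminf_bessel_clifford[OF a, of "X * Y"] X Y by (simp add: b_def)
  also have "... = ennreal (exp (X + Y) * bessel_clifford a (X * Y))"
    using bessel_clifford_pos[OF a, of "X * Y"] X Y by (simp add: exp_add mult_ac flip: ennreal_mult')
  finally show ?thesis .
qed

lemma nn_integral_Gamma_scaled:
  assumes s: "s > 0" and c: "c > 0"
  shows "(\<integral>\<^sup>+x. ennreal (indicator {0<..} x * (x powr (s - 1) * exp (- (c * x)))) \<partial>lborel) = ennreal (Gamma s * c powr (- s))"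
proof -
  have "(\<integral>\<^sup>+x. ennreal (indicator {0<..} x * (x powr (s - 1) * exp (- (c * x)))) \<partial>lborel)
     = \<bar>1 / c\<bar> * (\<integral>\<^sup>+x. ennreal (indicator {0<..} (0 + (1 / c) * x) * ((0 + (1 / c) * x) powr (s - 1) * exp (- (c * (0 + (1 / c) * x))))) \<partial>lborel)"
    using c by (intro nn_integral_real_affine) auto
  also have "(\<integral>\<^sup>+x. ennreal (indicator {0<..} (0 + (1 / c) * x) * ((0 + (1 / c) * x) powr (s - 1) * exp (- (c * (0 + (1 / c) * x))))) \<partial>lborel)
     = (\<integral>\<^sup>+x. ennreal (c powr (1 - s)) * ennreal (indicator {0..} x * x powr (s - 1) / exp x) \<partial>lborel)"
  proof (intro nn_integral_cong)
    fix x :: real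
    show "ennreal (indicator {0<..} (0 + (1 / c) * x) * ((0 + (1 / c) * x) powr (s - 1) * exp (- (c * (0 + (1 / c) * x)))))
      = ennreal (c powr (1 - s)) * ennreal (indicator {0..} x * x powr (s - 1) / exp x)"
    proof (cases "x > 0")
      case True
      have "(x / c) powr (s - 1) = c powr (1 - s) * x powr (s - 1)"
        using True c by (simp add: powr_divide powr_diff field_simps)
      moreover have "0 + (1 / c) * x = x / c" "c * (x / c) = x" using c by auto
      ultimately have "(0 + (1 / c) * x) powr (s - 1) * exp (- (c * (0 + (1 / c) * x)))
          = c powr (1 - s) * (x powr (s - 1) / exp x)"
        by (simp only: exp_minus) (simp add: divide_inverse)
      then show ?thesis
        using True c by (simp flip: ennreal_mult')
    next
      case False
      then show ?thesis using c by (cases "x = 0") (auto simp: indicator_def zero_less_divide_iff)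
    qed
  qed
  also have "... = ennreal (c powr (1 - s)) * ennreal (Gamma s)"
    by (subst nn_integral_cmult) (auto simp: Gamma_conv_nn_integral_real[OF s])
  also have "ennreal \<bar>1 / c\<bar> * (ennreal (c powr (1 - s)) * ennreal (Gamma s)) = ennreal (Gamma s * c powr (- s))"
    using c Gamma_real_pos[OF s] by (simp add: powr_diff powr_minus field_simps flip: ennreal_mult')
  finally show ?thesis .
qed

section \<open>The squared Bessel heat kernel\<close>

lemma sq_bessel_kernel_nonneg:
  assumes "a > -1" "u \<ge> 0" "w \<ge> 0"
  shows "sq_bessel_kernel a \<tau> u w \<ge> 0"
  using bessel_clifford_pos[OF assms(1), of "u * w / \<tau>\<^sup>2"] assms
  by (simp add: sq_bessel_kernel_def)

lemma borel_measurable_bessel_clifford [measurable]: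
  assumes "a > -1" shows "bessel_clifford a \<in> borel_measurable borel"
  using continuous_bessel_clifford[OF assms]
  by (intro borel_measurable_continuous_onI) (auto simp: continuous_on_eq_continuous_at)

lemma borel_measurable_sq_bessel_kernel [measurable (raw)]:
  assumes "a > -1" and [measurable]: "f \<in> borel_measurable M" "g \<in> borel_measurable M"
  shows "(\<lambda>x. sq_bessel_kernel a \<tau> (f x) (g x)) \<in> borel_measurable M"
  unfolding sq_bessel_kernel_def using borel_measurable_bessel_clifford[OF assms(1), measurable] by measurable

lemma continuous_on_sq_bessel_kernel [continuous_intros]:
  assumes "a > -1" "continuous_on S f" "continuous_on S g"
  shows "continuous_on S (\<lambda>x. sq_bessel_kernel a \<tau> (f x) (g x))"
proof -
  have "continuous_on UNIV (bessel_clifford a)"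
    using continuous_bessel_clifford[OF assms(1)] by (simp add: continuous_on_eq_continuous_at)
  moreover have "continuous_on S (\<lambda>x. f x * g x / \<tau>\<^sup>2)"
    using assms(2,3) unfolding divide_inverse by (intro continuous_intros)
  ultimately have "continuous_on S (\<lambda>x. bessel_clifford a (f x * g x / \<tau>\<^sup>2))"
    by (rule continuous_on_compose2) auto
  then show ?thesis
    unfolding sq_bessel_kernel_def divide_inverse using assms(2,3) by (intro continuous_intros)
qed

lemma sq_bessel_kernel_scale:
  assumes "s > 0" "\<tau> > 0"
  shows "sq_bessel_kernel a \<tau> (s * u) (s * w) = s powr (- (a + 1)) * sq_bessel_kernel a (\<tau> / s) u w"
proof -
  have "\<tau> powr (- (a + 1)) = s powr (- (a + 1)) * (\<tau> / s) powr (- (a + 1))"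
    using assms by (simp flip: powr_mult)
  moreover have "- (s * u + s * w) / \<tau> = - (u + w) / (\<tau> / s)" "s * u * (s * w) / \<tau>\<^sup>2 = u * w / (\<tau> / s)\<^sup>2"
    using assms by (auto simp: field_simps power2_eq_square)
  ultimately show ?thesis
    by (simp only: sq_bessel_kernel_def mult_ac)
qed

text \<open>Since \<open>2 sinh (t/2) = (1 - exp (-t)) / exp (-t/2)\<close>, the exponent of the Laguerre kernel is
\<open>-q (u + v) / \<tau> = u - (u + q v) / \<tau>\<close> with \<open>q = exp (-t)\<close> and \<open>\<tau> = 1 - q\<close>, and the powers of \<open>u v\<close>
cancel.\<close>

lemma laguerre_kernel_1d_conv_sq_bessel:
  assumes a: "a > -1" and t: "t > 0" and u: "u > 0" and v: "v > 0"
  shows "laguerre_kernel_1d a t u v = exp u * sq_bessel_kernel a (1 - exp (- t)) u (exp (- t) * v)"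
proof -
  define p where "p = exp (- t / 2)"
  define \<tau> where "\<tau> = 1 - exp (- t)"
  have p: "p > 0" "exp (- t) = p * p" by (auto simp: p_def simp flip: exp_add)
  have \<tau>: "\<tau> > 0" "\<tau> = 1 - p * p" using t by (simp_all add: \<tau>_def flip: p(2))
  have sh: "2 * sinh (t / 2) = \<tau> / p"
    using p(1) by (simp add: sinh_field_def \<tau>(2) field_simps exp_minus p_def)
  have shp: "sinh (t / 2) = \<tau> / (2 * p)" using sh by simp
  have z: "sqrt (u * v) / sinh (t / 2) / 2 = p * sqrt (u * v) / \<tau>"
    unfolding shp by simp
  have zpos: "p * sqrt (u * v) / \<tau> > 0" using p \<tau> u v by simp
  have "bessel_I a (sqrt (u * v) / sinh (t / 2))
     = (\<Sum>k. (p * sqrt (u * v) / \<tau>) powr a * ((u * (exp (- t) * v) / \<tau>\<^sup>2) ^ k / (fact k * Gamma (real k + a + 1))))"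
    unfolding bessel_I_def z
  proof (intro suminf_cong)
    fix k
    have "(p * sqrt (u * v) / \<tau>)\<^sup>2 = u * (exp (- t) * v) / \<tau>\<^sup>2"
      using u v by (simp add: p power_mult_distrib power_divide power2_eq_square)
    moreover have "(p * sqrt (u * v) / \<tau>) powr (2 * real k + a) = (p * sqrt (u * v) / \<tau>) powr a * ((p * sqrt (u * v) / \<tau>)\<^sup>2) ^ k"
    proof -
      have "z powr (2 * real k + a) = z powr a * (z\<^sup>2) ^ k" if "z > 0" for z :: real
        using that powr_realpow[OF that, of "2 * k"] by (simp add: powr_add power_mult)
      then show ?thesis using zpos .
    qed
    ultimately show "(p * sqrt (u * v) / \<tau>) powr (2 * real k + a) / (fact k * Gamma (real k + a + 1)) =
         (p * sqrt (u * v) / \<tau>) powr a * ((u * (exp (- t) * v) / \<tau>\<^sup>2) ^ k / (fact k * Gamma (real k + a + 1)))"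
      by simp
  qed
  also have "... = (p * sqrt (u * v) / \<tau>) powr a * bessel_clifford a (u * (exp (- t) * v) / \<tau>\<^sup>2)"
    unfolding bessel_clifford_def
    by (rule suminf_mult[OF summable_bessel_clifford[OF a]])
  finally have B: "bessel_I a (sqrt (u * v) / sinh (t / 2)) =
      (p * sqrt (u * v) / \<tau>) powr a * bessel_clifford a (u * (exp (- t) * v) / \<tau>\<^sup>2)" .
  have h1: "exp (- t / 2) / (2 * sinh (t / 2)) = p * p / \<tau>"
    unfolding sh p_def[symmetric] using p by simp
  have h2: "exp (- (p * p / \<tau>) * (u + v)) = exp u * exp (- (u + exp (- t) * v) / \<tau>)"
  proof -
    have pp: "p * p = 1 - \<tau>" using \<tau>(2) by simp
    have "- (p * p / \<tau>) * (u + v) = u + - (u + exp (- t) * v) / \<tau>"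
      using \<tau>(1) unfolding p(2) pp by (simp add: field_simps)
    then show ?thesis by (simp only: exp_add)
  qed
  have h3: "exp (t * (a + 1) / 2) / (\<tau> / p) * (u * v) powr (- a / 2) * (p * sqrt (u * v) / \<tau>) powr a = \<tau> powr (- (a + 1))"
  proof -
    have e1: "exp (t * (a + 1) / 2) = p powr (- (a + 1))"
      by (simp add: p_def powr_def field_simps)
    have e2: "(p * sqrt (u * v) / \<tau>) powr a = p powr a * (u * v) powr (a / 2) * \<tau> powr (- a)"
      using p \<tau> u v by (simp add: powr_mult powr_divide powr_minus_divide powr_half_sqrt[symmetric] powr_powr)
    have "(u * v) powr (- a / 2) * (u * v) powr (a / 2) = 1"
      using u v by (simp flip: powr_add)
    then have "exp (t * (a + 1) / 2) / (\<tau> / p) * (u * v) powr (- a / 2) * (p * sqrt (u * v) / \<tau>) powr a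
       = (p powr (- (a + 1)) * p powr a * p) * (\<tau> powr (- a) / \<tau>)"
      unfolding e1 e2 by (simp add: mult_ac)
    also have "p powr (- (a + 1)) * p powr a * p = 1"
    proof -
      have "p powr (- (a + 1)) * p powr a * p powr 1 = 1"
        using p(1) by (simp only: powr_add[symmetric]) simp
      then show ?thesis using p(1) by simp
    qed
    also have "\<tau> powr (- a) / \<tau> = \<tau> powr (- (a + 1))"
      using \<tau>(1) powr_diff[of \<tau> "- a" 1] by simp
    finally show ?thesis by simp
  qed
  have "laguerre_kernel_1d a t u v = (exp (t * (a + 1) / 2) / (\<tau> / p) * (u * v) powr (- a / 2) * (p * sqrt (u * v) / \<tau>) powr a)
      * exp (- (p * p / \<tau>) * (u + v)) * bessel_clifford a (u * (exp (- t) * v) / \<tau>\<^sup>2)"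
    unfolding laguerre_kernel_1d_def B h1 unfolding sh by (simp only: mult_ac)
  also have "... = exp u * sq_bessel_kernel a \<tau> u (exp (- t) * v)"
    unfolding h2 h3 sq_bessel_kernel_def by (simp only: mult_ac)
  finally show ?thesis unfolding \<tau>_def .
qed

text \<open>Term by term, the Gamma integrals cancel the Gamma functions of the coefficients and leave the
exponential series of \<open>w / \<tau>\<close>.\<close>

lemma nn_integral_sq_bessel_kernel:
  assumes a: "a > -1" and \<tau>: "\<tau> > 0" and w: "w \<ge> 0"
  shows "(\<integral>\<^sup>+u. ennreal (indicator {0<..} u * (u powr a * sq_bessel_kernel a \<tau> u w)) \<partial>lborel) = 1"
proof -
  have pos: "Gamma (real i + a + 1) > 0" for i by (rule Gamma_shift_pos[OF a])
  define \<phi> where "\<phi> = (\<lambda>k u. ennreal (indicator {0<..} u * (u powr (real k + a + 1 - 1) * exp (- (1 / \<tau> * u)))))"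
  have [measurable]: "\<phi> k \<in> borel_measurable borel" for k unfolding \<phi>_def by measurable
  define c where "c = (\<lambda>k. \<tau> powr (- (a + 1)) * exp (- (w / \<tau>)) * (w / \<tau>\<^sup>2) ^ k / (fact k * Gamma (real k + a + 1)))"
  have cnn: "c k \<ge> 0" for k using \<tau> w pos[of k] by (simp add: c_def)
  have "ennreal (indicator {0<..} u * (u powr a * sq_bessel_kernel a \<tau> u w))
     = (\<Sum>k. ennreal (c k) * \<phi> k u)" for u
  proof (cases "u > 0")
    case True
    have "(\<lambda>k. \<tau> powr (- (a + 1)) * exp (- (w / \<tau>)) * u powr a * exp (- (1 / \<tau> * u)) * ((u * w / \<tau>\<^sup>2) ^ k / (fact k * Gamma (real k + a + 1))))
       sums (\<tau> powr (- (a + 1)) * exp (- (w / \<tau>)) * u powr a * exp (- (1 / \<tau> * u)) * bessel_clifford a (u * w / \<tau>\<^sup>2))"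
      by (intro sums_mult bessel_clifford_sums a)
    moreover have "\<tau> powr (- (a + 1)) * exp (- (w / \<tau>)) * u powr a * exp (- (1 / \<tau> * u)) * ((u * w / \<tau>\<^sup>2) ^ k / (fact k * Gamma (real k + a + 1)))
        = c k * (u powr (real k + a + 1 - 1) * exp (- (1 / \<tau> * u)))" for k
      using True by (simp add: c_def powr_add powr_realpow power_mult_distrib power_divide)
    moreover have "exp (- (u + w) / \<tau>) = exp (- (w / \<tau>)) * exp (- (1 / \<tau> * u))"
    proof -
      have "- (u + w) / \<tau> = - (w / \<tau>) + - (1 / \<tau> * u)" using \<tau> by (simp add: field_simps)
      then show ?thesis by (simp only: exp_add)
    qed
    ultimately have "(\<lambda>k. c k * (u powr (real k + a + 1 - 1) * exp (- (1 / \<tau> * u)))) sums (u powr a * sq_bessel_kernel a \<tau> u w)"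
      by (simp add: sq_bessel_kernel_def mult_ac)
    then show ?thesis
      using True cnn by (subst suminf_ennreal_eq[symmetric]) (auto simp: \<phi>_def ennreal_mult')
  qed (auto simp: \<phi>_def)
  then have "(\<integral>\<^sup>+u. ennreal (indicator {0<..} u * (u powr a * sq_bessel_kernel a \<tau> u w)) \<partial>lborel)
     = (\<Sum>k. \<integral>\<^sup>+u. ennreal (c k) * \<phi> k u \<partial>lborel)"
    by (simp only:) (rule nn_integral_suminf, measurable)
  also have "... = (\<Sum>k. ennreal (exp (- (w / \<tau>))) * ennreal ((w / \<tau>) ^ k / fact k))"
  proof (intro suminf_cong)
    fix k
    have "(\<integral>\<^sup>+u. ennreal (c k) * \<phi> k u \<partial>lborel)
      = ennreal (c k) * ennreal (Gamma (real k + a + 1) * (1 / \<tau>) powr (- (real k + a + 1)))"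
      unfolding \<phi>_def using a \<tau> by (subst nn_integral_cmult, measurable, subst nn_integral_Gamma_scaled) auto
    also have "... = ennreal (c k * (Gamma (real k + a + 1) * (1 / \<tau>) powr (- (real k + a + 1))))"
      using cnn by (simp add: ennreal_mult')
    also have "c k * (Gamma (real k + a + 1) * (1 / \<tau>) powr (- (real k + a + 1))) = exp (- (w / \<tau>)) * ((w / \<tau>) ^ k / fact k)"
    proof -
      have "(1 / \<tau>) powr (- (real k + a + 1)) = \<tau> ^ k * \<tau> powr (a + 1)"
      proof -
        have "(1 / \<tau>) powr (- b) = \<tau> powr b" for b
          using \<tau> by (simp add: powr_divide powr_minus)
        then have "(1 / \<tau>) powr (- (real k + a + 1)) = \<tau> powr (real k + (a + 1))"
          by (simp only: add.assoc)
        then show ?thesis using \<tau> by (simp only: powr_add powr_realpow)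
      qed
      moreover have "\<tau> powr (- (a + 1)) * \<tau> powr (a + 1) = 1" using \<tau> by (simp flip: powr_add)
      moreover have "(w / \<tau>\<^sup>2) ^ k * \<tau> ^ k = (w / \<tau>) ^ k"
        using \<tau> by (simp add: power2_eq_square flip: power_mult_distrib)
      moreover have "c k * (Gamma (real k + a + 1) * (\<tau> ^ k * \<tau> powr (a + 1)))
         = (\<tau> powr (- (a + 1)) * \<tau> powr (a + 1)) * exp (- (w / \<tau>)) * ((w / \<tau>\<^sup>2) ^ k * \<tau> ^ k) / fact k"
        using pos[of k] by (simp add: c_def)
      ultimately show ?thesis by simp
    qed
    also have "ennreal (exp (- (w / \<tau>)) * ((w / \<tau>) ^ k / fact k)) = ennreal (exp (- (w / \<tau>))) * ennreal ((w / \<tau>) ^ k / fact k)"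
      by (rule ennreal_mult') simp
    finally show "(\<integral>\<^sup>+u. ennreal (c k) * \<phi> k u \<partial>lborel)
      = ennreal (exp (- (w / \<tau>))) * ennreal ((w / \<tau>) ^ k / fact k)" .
  qed
  also have "... = ennreal (exp (- (w / \<tau>))) * ennreal (exp (w / \<tau>))"
    using \<tau> w by (simp add: ennreal_suminf_exp del: suminf_ennreal)
  also have "... = 1"
    by (simp flip: ennreal_mult' exp_add)
  finally show ?thesis .
qed

text \<open>The condition on \<open>\<kappa>\<close> says that the Bessel--Clifford argument decreases, which is the direction
covered by the growth bound. The square roots that it produces complete the exponents
\<open>-(u + w)/\<tau>\<close> to squares of differences of \<open>sqrt u\<close> and \<open>sqrt w\<close>.\<close>

lemma sq_bessel_kernel_harnack:
  assumes a: "a > -1" and \<tau>: "0 < \<tau>" "\<tau> \<le> \<tau>'" and \<kappa>: "0 < \<kappa>" "\<kappa> * \<tau>\<^sup>2 \<le> \<tau>'\<^sup>2"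
    and u: "u > 0" and w: "w > 0"
  shows "sq_bessel_kernel a \<tau> u w \<le> (\<tau>' / \<tau>) powr (a + 3) / \<kappa>
     * exp ((sqrt u - sqrt \<kappa> * sqrt w)\<^sup>2 / \<tau>' - (sqrt u - sqrt w)\<^sup>2 / \<tau>) * sq_bessel_kernel a \<tau>' u (\<kappa> * w)"
proof -
  have \<tau>': "\<tau>' > 0" using \<tau> by simp
  define y x where "y = u * w / \<tau>\<^sup>2" and "x = u * (\<kappa> * w) / \<tau>'\<^sup>2"
  have x: "x > 0" using u w \<kappa> \<tau>' by (simp add: x_def)
  have yx: "y / x = \<tau>'\<^sup>2 / (\<kappa> * \<tau>\<^sup>2)" using u w \<kappa> \<tau> \<tau>' by (simp add: x_def y_def field_simps)
  have "y / x \<ge> 1" unfolding yx using \<kappa> \<tau> by simp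
  then have xy: "x \<le> y" using x by (simp add: field_simps)
  define E where "E = (sqrt u - sqrt \<kappa> * sqrt w)\<^sup>2 / \<tau>' - (sqrt u - sqrt w)\<^sup>2 / \<tau>"
  have sy: "sqrt y = sqrt u * sqrt w / \<tau>" and sx: "sqrt x = sqrt u * (sqrt \<kappa> * sqrt w) / \<tau>'"
    using \<tau> \<tau>' by (simp_all add: y_def x_def real_sqrt_mult real_sqrt_divide)
  have E: "- (u + w) / \<tau> + 2 * (sqrt y - sqrt x) = E + - (u + \<kappa> * w) / \<tau>'"
  proof -
    have "(sqrt u - sqrt \<kappa> * sqrt w)\<^sup>2 = u + \<kappa> * w - 2 * (sqrt u * (sqrt \<kappa> * sqrt w))"
      "(sqrt u - sqrt w)\<^sup>2 = u + w - 2 * (sqrt u * sqrt w)"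
      using u w \<kappa> by (simp_all add: power2_diff power_mult_distrib)
    then show ?thesis
      unfolding E_def sy sx by (simp only: diff_divide_distrib add_divide_distrib minus_add_distrib right_diff_distrib)
  qed
  have "bessel_clifford a y \<le> (y / x) * exp (2 * (sqrt y - sqrt x)) * bessel_clifford a x"
    by (rule bessel_clifford_growth[OF a x xy])
  then have "\<tau> powr (- (a + 1)) * exp (- (u + w) / \<tau>) * bessel_clifford a y
      \<le> \<tau> powr (- (a + 1)) * exp (- (u + w) / \<tau>) * ((y / x) * exp (2 * (sqrt y - sqrt x)) * bessel_clifford a x)"
    by (intro mult_left_mono) auto
  also have "... = (\<tau> powr (- (a + 1)) * (y / x)) * exp (E + - (u + \<kappa> * w) / \<tau>') * bessel_clifford a x"
    unfolding E[symmetric] exp_add by (simp only: mult_ac)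
  also have "\<tau> powr (- (a + 1)) * (y / x) = (\<tau>' / \<tau>) powr (a + 3) / \<kappa> * \<tau>' powr (- (a + 1))"
  proof -
    have "(\<tau>' / \<tau>) powr (a + 3) = (\<tau>' / \<tau>) powr (a + 1) * (\<tau>' / \<tau>)\<^sup>2"
    proof -
      have "(\<tau>' / \<tau>) powr (a + 3) = (\<tau>' / \<tau>) powr (a + 1) * (\<tau>' / \<tau>) powr 2"
        by (simp add: add.commute flip: powr_add)
      then show ?thesis using \<tau> \<tau>' by simp
    qed
    moreover have "(\<tau>' / \<tau>) powr (a + 1) = \<tau>' powr (a + 1) * \<tau> powr (- (a + 1))"
      using \<tau> \<tau>' by (simp only: powr_divide powr_minus_divide) simp
    moreover have "\<tau>' powr (a + 1) * \<tau>' powr (- (a + 1)) = 1" using \<tau>' by (simp flip: powr_add)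
    ultimately show ?thesis unfolding yx by (simp add: power_divide mult_ac)
  qed
  finally show ?thesis
    unfolding sq_bessel_kernel_def y_def x_def E_def exp_add by (simp add: mult_ac)
qed

lemma sq_bessel_kernel_le_right:
  assumes a: "a > -1" and \<tau>: "0 < \<tau>" and u: "u \<ge> 0" and w: "0 \<le> w" "w \<le> w'"
  shows "sq_bessel_kernel a \<tau> u w \<le> exp ((w' - w) / \<tau>) * sq_bessel_kernel a \<tau> u w'"
proof -
  have "bessel_clifford a (u * w / \<tau>\<^sup>2) \<le> bessel_clifford a (u * w' / \<tau>\<^sup>2)"
    using u w \<tau> by (intro bessel_clifford_mono[OF a] divide_right_mono mult_left_mono) auto
  then have "sq_bessel_kernel a \<tau> u w \<le> \<tau> powr (- (a + 1)) * exp (- (u + w) / \<tau>) * bessel_clifford a (u * w' / \<tau>\<^sup>2)"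
    unfolding sq_bessel_kernel_def by (intro mult_left_mono) auto
  also have "exp (- (u + w) / \<tau>) = exp ((w' - w) / \<tau>) * exp (- (u + w') / \<tau>)"
    by (simp flip: exp_add add: diff_divide_distrib add_divide_distrib)
  finally show ?thesis by (simp add: sq_bessel_kernel_def mult_ac)
qed

text \<open>The series of the kernel is an average of \<open>(u/\<tau>)\<^sup>k exp (-u/\<tau>) / Gamma (k + a + 1)\<close> with the Poisson
weights of \<open>w/\<tau>\<close>, so a bound on these quantities that is uniform in \<open>k\<close> is one on the kernel that is uniform
in \<open>w\<close>.\<close>

lemma sq_bessel_kernel_le_linear:
  assumes a: "a > -1" and \<tau>: "\<tau> > 0" and u: "u \<ge> 0" and w: "w \<ge> 0"
  shows "sq_bessel_kernel a \<tau> u w \<le> crude_const a * \<tau> powr (- (a + 1)) * (1 + u / \<tau>)"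
proof -
  have "bessel_clifford a (u / \<tau> * (w / \<tau>)) \<le> crude_const a * (1 + u / \<tau>) * exp (u / \<tau>) * exp (w / \<tau>)"
    using u w \<tau> by (intro bessel_clifford_le_exp power_le_Gamma_exp a) auto
  also have "u / \<tau> * (w / \<tau>) = u * w / \<tau>\<^sup>2" by (simp add: power2_eq_square)
  finally have "exp (- (u + w) / \<tau>) * bessel_clifford a (u * w / \<tau>\<^sup>2)
      \<le> exp (- (u + w) / \<tau>) * (crude_const a * (1 + u / \<tau>) * exp (u / \<tau>) * exp (w / \<tau>))"
    by (intro mult_left_mono) auto
  also have "... = crude_const a * (1 + u / \<tau>) * (exp (- (u + w) / \<tau>) * (exp (u / \<tau>) * exp (w / \<tau>)))"
    by (simp only: mult_ac)
  also have "exp (- (u + w) / \<tau>) * (exp (u / \<tau>) * exp (w / \<tau>)) = 1"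
    by (simp add: diff_divide_distrib flip: exp_add)
  finally have "exp (- (u + w) / \<tau>) * bessel_clifford a (u * w / \<tau>\<^sup>2) \<le> crude_const a * (1 + u / \<tau>)" by simp
  from mult_left_mono[OF this, of "\<tau> powr (- (a + 1))"] show ?thesis
    by (simp add: sq_bessel_kernel_def mult_ac)
qed

lemma sq_bessel_kernel_Chapman_Kolmogorov:
  assumes a: "a > -1" and \<sigma>: "\<sigma> > 0" and \<tau>: "\<tau> > 0" and u: "u \<ge> 0" and w: "w \<ge> 0"
  shows "(\<integral>\<^sup>+v. ennreal (indicator {0<..} v * (v powr a * sq_bessel_kernel a \<sigma> u v * sq_bessel_kernel a \<tau> v w)) \<partial>lborel)
    = ennreal (sq_bessel_kernel a (\<sigma> + \<tau>) u w)"
proof -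
  have pos: "Gamma (real i + a + 1) > 0" for i by (rule Gamma_shift_pos[OF a])
  define c where "c = 1 / \<sigma> + 1 / \<tau>"
  have c: "c > 0" using \<sigma> \<tau> by (simp add: c_def add_pos_pos)
  define P Q where "P = u / \<sigma>\<^sup>2" and "Q = w / \<tau>\<^sup>2"
  have PQ: "P \<ge> 0" "Q \<ge> 0" using u w by (auto simp: P_def Q_def)
  define S where "S = \<sigma> powr (- (a + 1)) * \<tau> powr (- (a + 1)) * exp (- (u / \<sigma>)) * exp (- (w / \<tau>))"
  have S: "S > 0" using \<sigma> \<tau> by (simp add: S_def)
  define p where "p = (\<lambda>j. P ^ j / (fact j * Gamma (real j + a + 1)))"
  define q where "q = (\<lambda>k. Q ^ k / (fact k * Gamma (real k + a + 1)))"
  have pq: "p j \<ge> 0" "q j \<ge> 0" for j using PQ pos[of j] by (auto simp: p_def q_def)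
  define \<phi> where "\<phi> = (\<lambda>j k v. ennreal (indicator {0<..} v * (v powr (real j + real k + a + 1 - 1) * exp (- (c * v)))))"
  have [measurable]: "\<phi> j k \<in> borel_measurable borel" for j k unfolding \<phi>_def by measurable
  have "ennreal (indicator {0<..} v * (v powr a * sq_bessel_kernel a \<sigma> u v * sq_bessel_kernel a \<tau> v w))
     = ennreal S * (\<Sum>j. \<Sum>k. ennreal (p j) * ennreal (q k) * \<phi> j k v)" for v
  proof (cases "v > 0")
    case True
    have eP: "(\<Sum>j. ennreal (p j * v ^ j)) = ennreal (bessel_clifford a (u * v / \<sigma>\<^sup>2))"
      using ennreal_suminf_bessel_clifford[OF a, of "u * v / \<sigma>\<^sup>2"] u True
      by (simp add: p_def P_def power_mult_distrib power_divide del: suminf_ennreal)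
    have eQ: "(\<Sum>k. ennreal (q k * v ^ k)) = ennreal (bessel_clifford a (v * w / \<tau>\<^sup>2))"
      using ennreal_suminf_bessel_clifford[OF a, of "v * w / \<tau>\<^sup>2"] w True
      by (simp add: q_def Q_def power_mult_distrib power_divide mult.commute del: suminf_ennreal)
    have "\<phi> j k v = ennreal (v ^ j) * ennreal (v ^ k) * ennreal (v powr a * exp (- (c * v)))" for j k
      using True by (simp add: \<phi>_def powr_add powr_realpow flip: ennreal_mult')
    then have "ennreal (p j) * ennreal (q k) * \<phi> j k v
        = ennreal (p j * v ^ j) * (ennreal (q k * v ^ k) * ennreal (v powr a * exp (- (c * v))))" for j k
      using pq[of j] pq[of k] True by (simp add: ennreal_mult mult_ac)
    then have e1: "(\<Sum>j. \<Sum>k. ennreal (p j) * ennreal (q k) * \<phi> j k v)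
       = ennreal (bessel_clifford a (u * v / \<sigma>\<^sup>2)) * (ennreal (bessel_clifford a (v * w / \<tau>\<^sup>2)) * ennreal (v powr a * exp (- (c * v))))"
      by (simp only: ennreal_suminf_cmult ennreal_suminf_multc eP eQ)
    have e2: "v powr a * sq_bessel_kernel a \<sigma> u v * sq_bessel_kernel a \<tau> v w
       = S * (bessel_clifford a (u * v / \<sigma>\<^sup>2) * (bessel_clifford a (v * w / \<tau>\<^sup>2) * (v powr a * exp (- (c * v)))))"
    proof -
      have "- (u + v) / \<sigma> + - (v + w) / \<tau> = - (u / \<sigma>) + - (w / \<tau>) + - (c * v)"
        by (simp add: c_def diff_divide_distrib algebra_simps)
      then have "exp (- (u + v) / \<sigma>) * exp (- (v + w) / \<tau>) = exp (- (u / \<sigma>)) * exp (- (w / \<tau>)) * exp (- (c * v))"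
        by (simp only: flip: exp_add)
      then show ?thesis by (simp add: sq_bessel_kernel_def S_def mult_ac)
    qed
    show ?thesis
      unfolding e1 e2
      using True S bessel_clifford_pos[OF a, of "u * v / \<sigma>\<^sup>2"] bessel_clifford_pos[OF a, of "v * w / \<tau>\<^sup>2"] u w
      by (simp add: ennreal_mult)
  next
    case False
    then show ?thesis by (simp add: \<phi>_def)
  qed
  then have "(\<integral>\<^sup>+v. ennreal (indicator {0<..} v * (v powr a * sq_bessel_kernel a \<sigma> u v * sq_bessel_kernel a \<tau> v w)) \<partial>lborel)
     = ennreal S * (\<integral>\<^sup>+v. (\<Sum>j. \<Sum>k. ennreal (p j) * ennreal (q k) * \<phi> j k v) \<partial>lborel)"
    by (simp only:) (rule nn_integral_cmult, measurable)
  also have "(\<integral>\<^sup>+v. (\<Sum>j. \<Sum>k. ennreal (p j) * ennreal (q k) * \<phi> j k v) \<partial>lborel)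
     = (\<Sum>j. \<Sum>k. ennreal (p j) * ennreal (q k) * (\<integral>\<^sup>+v. \<phi> j k v \<partial>lborel))"
    by (simp add: nn_integral_suminf nn_integral_cmult)
  also have "... = (\<Sum>j. \<Sum>k. ennreal (c powr (- (a + 1))) * ennreal ((P / c) ^ j * (Q / c) ^ k * cross_coeff a j k))"
  proof (intro suminf_cong)
    fix j k
    have G: "Gamma (real j + real k + a + 1) > 0" using a by (intro Gamma_real_pos) auto
    have "(\<integral>\<^sup>+v. \<phi> j k v \<partial>lborel) = ennreal (Gamma (real j + real k + a + 1) * c powr (- (real j + real k + a + 1)))"
      unfolding \<phi>_def using a c by (intro nn_integral_Gamma_scaled) auto
    also have "c powr (- (real j + real k + a + 1)) = c powr (- (a + 1)) * (1 / c) ^ j * (1 / c) ^ k"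
    proof -
      have "- (real j + real k + a + 1) = - (a + 1) - real j - real k" by simp
      then show ?thesis using c by (simp only: powr_diff powr_realpow) (simp add: power_divide)
    qed
    also have "ennreal (p j) * ennreal (q k) * ennreal (Gamma (real j + real k + a + 1) * (c powr (- (a + 1)) * (1 / c) ^ j * (1 / c) ^ k))
       = ennreal (p j * q k * (Gamma (real j + real k + a + 1) * (c powr (- (a + 1)) * (1 / c) ^ j * (1 / c) ^ k)))"
      using pq by (simp add: ennreal_mult')
    also have "p j * q k * (Gamma (real j + real k + a + 1) * (c powr (- (a + 1)) * (1 / c) ^ j * (1 / c) ^ k))
       = c powr (- (a + 1)) * ((P / c) ^ j * (Q / c) ^ k * cross_coeff a j k)"
      unfolding p_def q_def cross_coeff_def power_divide times_divide_eq_right times_divide_eq_left divide_divide_eq_left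
      by (simp only: mult_ac power_one mult_1)
    also have "ennreal ... = ennreal (c powr (- (a + 1))) * ennreal ((P / c) ^ j * (Q / c) ^ k * cross_coeff a j k)"
      by (rule ennreal_mult') simp
    finally show "ennreal (p j) * ennreal (q k) * (\<integral>\<^sup>+v. \<phi> j k v \<partial>lborel) = ennreal (c powr (- (a + 1))) * ennreal ((P / c) ^ j * (Q / c) ^ k * cross_coeff a j k)" .
  qed
  also have "... = ennreal (c powr (- (a + 1))) * ennreal (exp (P / c + Q / c) * bessel_clifford a (P / c * (Q / c)))"
    using PQ c by (simp only: ennreal_suminf_cmult) (simp add: bessel_clifford_double_series[OF a] del: suminf_ennreal)
  also have "ennreal S * ... = ennreal (S * (c powr (- (a + 1)) * (exp (P / c + Q / c) * bessel_clifford a (P / c * (Q / c)))))"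
    using S by (simp add: ennreal_mult')
  also have "S * (c powr (- (a + 1)) * (exp (P / c + Q / c) * bessel_clifford a (P / c * (Q / c)))) = sq_bessel_kernel a (\<sigma> + \<tau>) u w"
  proof -
    have cst: "c * (\<sigma> * \<tau>) = \<sigma> + \<tau>" using \<sigma> \<tau> by (simp add: c_def field_simps)
    have 1: "\<sigma> powr (- (a + 1)) * \<tau> powr (- (a + 1)) * c powr (- (a + 1)) = (\<sigma> + \<tau>) powr (- (a + 1))"
      using \<sigma> \<tau> c unfolding cst[symmetric] by (simp only: powr_mult) (simp add: mult_ac)
    have Pc: "P / c = u * \<tau> / (\<sigma> * (\<sigma> + \<tau>))" "Q / c = w * \<sigma> / (\<tau> * (\<sigma> + \<tau>))"
      using \<sigma> \<tau> c unfolding cst[symmetric] by (simp_all add: P_def Q_def power2_eq_square)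
    have 2: "- (u / \<sigma>) + - (w / \<tau>) + (P / c + Q / c) = - (u + w) / (\<sigma> + \<tau>)"
    proof -
      have "\<sigma> + \<tau> \<noteq> 0" using \<sigma> \<tau> by simp
      have "P / c - u / \<sigma> = - u / (\<sigma> + \<tau>)" "Q / c - w / \<tau> = - w / (\<sigma> + \<tau>)"
        unfolding Pc using \<sigma> \<tau> \<open>\<sigma> + \<tau> \<noteq> 0\<close> by (simp_all add: divide_simps) (simp_all add: algebra_simps)
      then show ?thesis by (simp add: diff_divide_distrib)
    qed
    have 3: "P / c * (Q / c) = u * w / (\<sigma> + \<tau>)\<^sup>2"
      unfolding Pc using \<sigma> \<tau> by (simp add: power2_eq_square)
    show ?thesis
      unfolding sq_bessel_kernel_def S_def 3 1[symmetric] 2[symmetric] exp_add by (simp only: mult_ac)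
  qed
  finally show ?thesis .
qed

section \<open>Product kernels on the orthant\<close>

abbreviation power_weight :: "real \<Rightarrow> real \<Rightarrow> ennreal" where
  "power_weight a v \<equiv> ennreal (indicator {0<..} v * v powr a)"

definition coord_sum :: "real ^ 'd \<Rightarrow> real" where
  "coord_sum x = (\<Sum>i\<in>UNIV. x $ i)"

definition bessel_heat :: "real ^ 'd \<Rightarrow> real \<Rightarrow> real ^ 'd \<Rightarrow> real ^ 'd \<Rightarrow> real" where
  "bessel_heat \<alpha> \<tau> u w = (\<Prod>i\<in>UNIV. sq_bessel_kernel (\<alpha> $ i) \<tau> (u $ i) (w $ i))"

text \<open>Both measures below live on the whole space and on the Borel sets, and vanish off the orthant: this gives
Tonelli's theorem and the product formula of Lebesgue measure without restrictions.\<close>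

definition power_measure :: "real ^ 'd \<Rightarrow> (real ^ 'd) measure" where
  "power_measure \<alpha> = density lborel (\<lambda>x. \<Prod>i\<in>UNIV. power_weight (\<alpha> $ i) (x $ i))"

definition borel_laguerre_measure :: "real ^ 'd \<Rightarrow> (real ^ 'd) measure" where
  "borel_laguerre_measure \<alpha> = density (power_measure \<alpha>) (\<lambda>x. ennreal (exp (- coord_sum x)))"

lemma coord_sum_scaleR: "coord_sum (c *\<^sub>R x) = c * coord_sum x"
  by (simp add: coord_sum_def sum_distrib_left)

lemma coord_sum_pos: "x \<in> pos_orthant \<Longrightarrow> coord_sum x > 0"
  unfolding coord_sum_def pos_orthant_def by (intro sum_pos) auto

lemma pos_orthant_scaleR: "c > 0 \<Longrightarrow> x \<in> pos_orthant \<Longrightarrow> c *\<^sub>R x \<in> pos_orthant"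
  by (auto simp: pos_orthant_def)

lemma open_pos_orthant: "open (pos_orthant :: (real ^ 'd) set)"
proof -
  have "pos_orthant = (\<Inter>i. {x :: real ^ 'd. 0 < x $ i})" by (auto simp: pos_orthant_def)
  also have "open ..." by (intro open_INT) (auto intro!: open_Collect_less continuous_intros)
  finally show ?thesis .
qed

lemma borel_pos_orthant [measurable]: "pos_orthant \<in> sets borel"
  using open_pos_orthant by (rule borel_open)

lemma borel_measurable_vec_nth_comp [measurable (raw)]:
  fixes f :: "'a \<Rightarrow> real ^ 'd"
  assumes [measurable]: "f \<in> borel_measurable M"
  shows "(\<lambda>x. f x $ i) \<in> borel_measurable M"
  by (rule measurable_compose[OF assms]) measurable

lemma coord_sum_measurable [measurable]: "coord_sum \<in> borel_measurable borel"
  unfolding coord_sum_def by measurable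

lemma sets_power_measure [simp, measurable_cong]: "sets (power_measure \<alpha>) = sets borel"
  by (simp add: power_measure_def)

lemma sets_borel_laguerre_measure [simp, measurable_cong]: "sets (borel_laguerre_measure \<alpha>) = sets borel"
  by (simp add: borel_laguerre_measure_def)

lemma space_borel_laguerre_measure [simp]: "space (borel_laguerre_measure \<alpha>) = UNIV"
  by (simp add: borel_laguerre_measure_def power_measure_def)

lemma nn_integral_lborel_vec_prod:
  fixes f :: "'d::finite \<Rightarrow> real \<Rightarrow> ennreal"
  assumes [measurable]: "\<And>i. f i \<in> borel_measurable borel"
  shows "(\<integral>\<^sup>+x. (\<Prod>i\<in>UNIV. f i (x $ i)) \<partial>(lborel :: (real ^ 'd) measure)) = (\<Prod>i\<in>UNIV. \<integral>\<^sup>+v. f i v \<partial>lborel)"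
proof -
  define e :: "'d \<Rightarrow> real ^ 'd" where "e = (\<lambda>i. axis i 1)"
  have inj: "inj e" by (auto simp: e_def inj_def axis_eq_axis)
  have B: "Basis = range e" by (auto simp: Basis_vec_def e_def)
  define F where "F = (\<lambda>b. f (inv e b))"
  have F: "F (e i) = f i" for i using inj by (simp add: F_def)
  have "(\<integral>\<^sup>+x. (\<Prod>b\<in>Basis. F b (x \<bullet> b)) \<partial>(lborel :: (real ^ 'd) measure)) = (\<Prod>b\<in>Basis. (\<integral>\<^sup>+x. F b x \<partial>lborel))"
    by (rule nn_integral_lborel_prod) (auto simp: F_def)
  then show ?thesis
    unfolding B by (simp add: prod.reindex[OF inj] F) (simp add: e_def inner_axis)
qed

lemma nn_integral_power_measure_prod:
  fixes \<alpha> :: "real ^ 'd" and g :: "'d::finite \<Rightarrow> real \<Rightarrow> ennreal"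
  assumes [measurable]: "\<And>i. g i \<in> borel_measurable borel"
  shows "(\<integral>\<^sup>+x. (\<Prod>i\<in>UNIV. g i (x $ i)) \<partial>power_measure (\<alpha> :: real ^ 'd))
    = (\<Prod>i\<in>UNIV. \<integral>\<^sup>+v. power_weight (\<alpha> $ i) v * g i v \<partial>lborel)"
proof -
  have "(\<integral>\<^sup>+x. (\<Prod>i\<in>UNIV. g i (x $ i)) \<partial>power_measure (\<alpha> :: real ^ 'd))
    = (\<integral>\<^sup>+x. (\<Prod>i\<in>UNIV. power_weight (\<alpha> $ i) (x $ i) * g i (x $ i)) \<partial>lborel)"
    unfolding power_measure_def by (subst nn_integral_density) (auto simp: prod.distrib)
  also have "... = (\<Prod>i\<in>UNIV. \<integral>\<^sup>+v. power_weight (\<alpha> $ i) v * g i v \<partial>lborel)"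
    by (rule nn_integral_lborel_vec_prod) measurable
  finally show ?thesis .
qed

lemma AE_power_measure: "AE x in power_measure (\<alpha> :: real ^ 'd). x \<in> pos_orthant"
proof -
  have "power_weight (\<alpha> $ i) (x $ i) = 0" if "\<not> x $ i > 0" for x :: "real ^ 'd" and i
    using that by simp
  then have "x \<in> pos_orthant" if "(\<Prod>i\<in>UNIV. power_weight (\<alpha> $ i) (x $ i)) > 0" for x :: "real ^ 'd"
    using that by (auto simp: pos_orthant_def zero_less_iff_neq_zero indicator_def split: if_splits)
  then show ?thesis
    unfolding power_measure_def by (subst AE_density) (auto simp: zero_less_iff_neq_zero)
qed

lemma AE_borel_laguerre_measure: "AE x in borel_laguerre_measure \<alpha>. x \<in> pos_orthant"
  unfolding borel_laguerre_measure_def using AE_power_measure[of \<alpha>] by (subst AE_density) auto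

lemma nn_integral_borel_laguerre:
  assumes [measurable]: "f \<in> borel_measurable borel"
  shows "(\<integral>\<^sup>+x. f x \<partial>borel_laguerre_measure \<alpha>) = (\<integral>\<^sup>+x. ennreal (exp (- coord_sum x)) * f x \<partial>power_measure \<alpha>)"
  unfolding borel_laguerre_measure_def by (subst nn_integral_density) auto

locale laguerre_type =
  fixes \<alpha> :: "real ^ 'd"
  assumes type_gt: "\<And>i. \<alpha> $ i > -1"
begin

abbreviation \<mu> where "\<mu> \<equiv> borel_laguerre_measure \<alpha>"

abbreviation \<nu> where "\<nu> \<equiv> power_measure \<alpha>"

abbreviation heat where "heat \<equiv> bessel_heat \<alpha>"

text \<open>The homogeneous dimension: \<open>\<nu>\<close> scales by \<open>s powr hom_dim\<close> under the dilation by \<open>s\<close>.\<close>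

definition hom_dim :: real where "hom_dim = (\<Sum>i\<in>UNIV. \<alpha> $ i + 1)"

lemma hom_dim_pos: "hom_dim > 0"
  unfolding hom_dim_def using type_gt by (intro sum_pos) (auto, smt (verit))

lemma bessel_heat_nonneg: "(\<And>i. u $ i \<ge> 0) \<Longrightarrow> (\<And>i. w $ i \<ge> 0) \<Longrightarrow> heat \<tau> u w \<ge> 0"
  unfolding bessel_heat_def by (intro prod_nonneg ballI sq_bessel_kernel_nonneg type_gt) auto

lemma bessel_heat_nonneg': "u \<in> pos_orthant \<Longrightarrow> w \<in> pos_orthant \<Longrightarrow> heat \<tau> u w \<ge> 0"
  by (rule bessel_heat_nonneg) (auto simp: pos_orthant_def less_imp_le)

lemma borel_measurable_bessel_heat [measurable (raw)]:
  assumes [measurable]: "f \<in> borel_measurable M" "g \<in> borel_measurable M"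
  shows "(\<lambda>x. heat \<tau> (f x) (g x)) \<in> borel_measurable M"
  unfolding bessel_heat_def
  by (intro borel_measurable_prod borel_measurable_sq_bessel_kernel type_gt) measurable

lemma bessel_heat_scale:
  assumes "s > 0" "\<tau> > 0"
  shows "heat \<tau> (s *\<^sub>R u) (s *\<^sub>R w) = s powr (- hom_dim) * heat (\<tau> / s) u w"
  using assms by (simp add: hom_dim_def bessel_heat_def sq_bessel_kernel_scale prod.distrib powr_sum sum_negf[symmetric] del: sum_negf)

lemma nn_integral_bessel_heat:
  assumes "\<tau> > 0" "w \<in> pos_orthant"
  shows "(\<integral>\<^sup>+u. ennreal (heat \<tau> u w) \<partial>\<nu>) = 1"
proof -
  have w: "w $ i > 0" for i using assms by (simp add: pos_orthant_def)
  have [measurable]: "(\<lambda>v. sq_bessel_kernel (\<alpha> $ i) \<tau> v (w $ i)) \<in> borel_measurable borel" for i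
    by (auto intro!: borel_measurable_sq_bessel_kernel type_gt)
  have "(\<integral>\<^sup>+u. ennreal (heat \<tau> u w) \<partial>\<nu>)
    = (\<integral>\<^sup>+u. (\<Prod>i\<in>UNIV. ennreal (sq_bessel_kernel (\<alpha> $ i) \<tau> (u $ i) (w $ i))) \<partial>\<nu>)"
  proof (rule nn_integral_cong_AE, rule AE_mp[OF AE_power_measure], intro AE_I2 impI)
    fix u :: "real ^ 'd" assume "u \<in> pos_orthant"
    then show "ennreal (heat \<tau> u w) = (\<Prod>i\<in>UNIV. ennreal (sq_bessel_kernel (\<alpha> $ i) \<tau> (u $ i) (w $ i)))"
      unfolding bessel_heat_def using w
      by (intro prod_ennreal[symmetric] sq_bessel_kernel_nonneg type_gt) (auto simp: pos_orthant_def less_imp_le)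
  qed
  also have "... = (\<Prod>i\<in>UNIV. \<integral>\<^sup>+v. power_weight (\<alpha> $ i) v * ennreal (sq_bessel_kernel (\<alpha> $ i) \<tau> v (w $ i)) \<partial>lborel)"
    by (rule nn_integral_power_measure_prod) measurable
  also have "... = (\<Prod>i\<in>(UNIV :: 'd set). 1)"
  proof (intro prod.cong refl)
    fix i
    show "(\<integral>\<^sup>+v. power_weight (\<alpha> $ i) v * ennreal (sq_bessel_kernel (\<alpha> $ i) \<tau> v (w $ i)) \<partial>lborel) = 1"
    proof (rule trans[OF _ nn_integral_sq_bessel_kernel[OF type_gt[of i] assms(1) less_imp_le[OF w[of i]]]], intro nn_integral_cong)
      fix v :: real
      show "power_weight (\<alpha> $ i) v * ennreal (sq_bessel_kernel (\<alpha> $ i) \<tau> v (w $ i))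
        = ennreal (indicator {0<..} v * (v powr (\<alpha> $ i) * sq_bessel_kernel (\<alpha> $ i) \<tau> v (w $ i)))"
        by (cases "v > 0") (auto simp: ennreal_mult')
    qed
  qed
  finally show ?thesis by simp
qed

lemma bessel_heat_Chapman_Kolmogorov:
  assumes "\<sigma> > 0" "\<tau> > 0" "u \<in> pos_orthant" "w \<in> pos_orthant"
  shows "(\<integral>\<^sup>+v. ennreal (heat \<sigma> u v) * ennreal (heat \<tau> v w) \<partial>\<nu>)
    = ennreal (heat (\<sigma> + \<tau>) u w)"
proof -
  have w: "u $ i > 0" "w $ i > 0" for i using assms by (simp_all add: pos_orthant_def)
  have nn: "v \<in> pos_orthant \<Longrightarrow> sq_bessel_kernel (\<alpha> $ i) \<sigma> (u $ i) (v $ i) \<ge> 0"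
    "v \<in> pos_orthant \<Longrightarrow> sq_bessel_kernel (\<alpha> $ i) \<tau> (v $ i) (w $ i) \<ge> 0" for v i
    using w by (auto intro!: sq_bessel_kernel_nonneg type_gt simp: pos_orthant_def less_imp_le)
  have [measurable]: "(\<lambda>v. sq_bessel_kernel (\<alpha> $ i) \<tau> v (w $ i)) \<in> borel_measurable borel"
     "(\<lambda>v. sq_bessel_kernel (\<alpha> $ i) \<sigma> (u $ i) v) \<in> borel_measurable borel" for i
    by (auto intro!: borel_measurable_sq_bessel_kernel type_gt)
  have "(\<integral>\<^sup>+v. ennreal (heat \<sigma> u v) * ennreal (heat \<tau> v w) \<partial>\<nu>)
    = (\<integral>\<^sup>+v. (\<Prod>i\<in>UNIV. ennreal (sq_bessel_kernel (\<alpha> $ i) \<sigma> (u $ i) (v $ i)) * ennreal (sq_bessel_kernel (\<alpha> $ i) \<tau> (v $ i) (w $ i))) \<partial>\<nu>)"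
  proof (rule nn_integral_cong_AE, rule AE_mp[OF AE_power_measure], intro AE_I2 impI)
    fix v :: "real ^ 'd" assume v: "v \<in> pos_orthant"
    show "ennreal (heat \<sigma> u v) * ennreal (heat \<tau> v w)
      = (\<Prod>i\<in>UNIV. ennreal (sq_bessel_kernel (\<alpha> $ i) \<sigma> (u $ i) (v $ i)) * ennreal (sq_bessel_kernel (\<alpha> $ i) \<tau> (v $ i) (w $ i)))"
      unfolding bessel_heat_def prod.distrib using nn[OF v] by (subst (1 2) prod_ennreal) auto
  qed
  also have "... = (\<Prod>i\<in>UNIV. \<integral>\<^sup>+v. power_weight (\<alpha> $ i) v * (ennreal (sq_bessel_kernel (\<alpha> $ i) \<sigma> (u $ i) v) * ennreal (sq_bessel_kernel (\<alpha> $ i) \<tau> v (w $ i))) \<partial>lborel)"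
    by (rule nn_integral_power_measure_prod) measurable
  also have "... = (\<Prod>i\<in>UNIV. ennreal (sq_bessel_kernel (\<alpha> $ i) (\<sigma> + \<tau>) (u $ i) (w $ i)))"
  proof (intro prod.cong refl)
    fix i
    show "(\<integral>\<^sup>+v. power_weight (\<alpha> $ i) v * (ennreal (sq_bessel_kernel (\<alpha> $ i) \<sigma> (u $ i) v) * ennreal (sq_bessel_kernel (\<alpha> $ i) \<tau> v (w $ i))) \<partial>lborel)
      = ennreal (sq_bessel_kernel (\<alpha> $ i) (\<sigma> + \<tau>) (u $ i) (w $ i))"
      unfolding sq_bessel_kernel_Chapman_Kolmogorov[OF type_gt[of i] assms(1,2) less_imp_le[OF w(1)[of i]] less_imp_le[OF w(2)[of i]], symmetric]
    proof (intro nn_integral_cong)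
      fix v :: real
      show "power_weight (\<alpha> $ i) v * (ennreal (sq_bessel_kernel (\<alpha> $ i) \<sigma> (u $ i) v) * ennreal (sq_bessel_kernel (\<alpha> $ i) \<tau> v (w $ i)))
        = ennreal (indicator {0<..} v * (v powr (\<alpha> $ i) * sq_bessel_kernel (\<alpha> $ i) \<sigma> (u $ i) v * sq_bessel_kernel (\<alpha> $ i) \<tau> v (w $ i)))"
        using sq_bessel_kernel_nonneg[OF type_gt[of i] less_imp_le[OF w(1)[of i]], of v \<sigma>]
        by (cases "v > 0") (auto simp: mult.assoc ennreal_mult')
    qed
  qed
  also have "... = ennreal (heat (\<sigma> + \<tau>) u w)"
    unfolding bessel_heat_def by (intro prod_ennreal sq_bessel_kernel_nonneg type_gt) (auto simp: less_imp_le w)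
  finally show ?thesis .
qed

lemma laguerre_kernel_conv_bessel_heat:
  assumes "t > 0" "x \<in> pos_orthant" "y \<in> pos_orthant"
  shows "laguerre_kernel \<alpha> t x y = exp (coord_sum x) * heat (1 - exp (- t)) x (exp (- t) *\<^sub>R y)"
  using assms
  by (simp add: laguerre_kernel_def bessel_heat_def coord_sum_def exp_sum pos_orthant_def
      laguerre_kernel_1d_conv_sq_bessel[OF type_gt] prod.distrib)

lemma laguerre_kernel_commute: "laguerre_kernel \<alpha> t x y = laguerre_kernel \<alpha> t y x"
  unfolding laguerre_kernel_def laguerre_kernel_1d_def by (simp add: add.commute mult.commute)

lemma laguerre_kernel_nonneg:
  assumes "t > 0" "x \<in> pos_orthant" "y \<in> pos_orthant"
  shows "laguerre_kernel \<alpha> t x y \<ge> 0"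
  using assms by (simp add: laguerre_kernel_conv_bessel_heat bessel_heat_nonneg' pos_orthant_scaleR)

text \<open>The Laguerre kernel, extended by zero off the orthant in order to integrate over the whole
space.\<close>

definition ext_kernel :: "real \<Rightarrow> real ^ 'd \<Rightarrow> real ^ 'd \<Rightarrow> ennreal" where
  "ext_kernel t x y = (if x \<in> pos_orthant \<and> y \<in> pos_orthant
     then ennreal (exp (coord_sum x) * heat (1 - exp (- t)) x (exp (- t) *\<^sub>R y)) else 0)"

lemma ext_kernel_eq: "t > 0 \<Longrightarrow> x \<in> pos_orthant \<Longrightarrow> y \<in> pos_orthant \<Longrightarrow> ext_kernel t x y = ennreal (laguerre_kernel \<alpha> t x y)"
  by (simp add: ext_kernel_def laguerre_kernel_conv_bessel_heat)

lemma ext_kernel_commute: "t > 0 \<Longrightarrow> ext_kernel t x y = ext_kernel t y x"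
  by (cases "x \<in> pos_orthant \<and> y \<in> pos_orthant")
     (auto simp: ext_kernel_eq laguerre_kernel_commute[of t x y], auto simp: ext_kernel_def)

lemma ext_kernel_measurable [measurable (raw)]:
  assumes [measurable]: "f \<in> borel_measurable M" "g \<in> borel_measurable M"
  shows "(\<lambda>z. ext_kernel t (f z) (g z)) \<in> borel_measurable M"
  unfolding ext_kernel_def by measurable

lemma nn_integral_ext_kernel_le:
  assumes t: "t > 0"
  shows "(\<integral>\<^sup>+y. ext_kernel t x y \<partial>\<mu>) \<le> 1"
proof (cases "x \<in> pos_orthant")
  case True
  have "(\<integral>\<^sup>+y. ext_kernel t x y \<partial>\<mu>) = (\<integral>\<^sup>+y. ext_kernel t y x \<partial>\<mu>)"
    using t by (simp add: ext_kernel_commute)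
  also have "... = (\<integral>\<^sup>+y. ennreal (exp (- coord_sum y)) * ext_kernel t y x \<partial>\<nu>)"
    by (rule nn_integral_borel_laguerre) measurable
  also have "... = (\<integral>\<^sup>+y. ennreal (heat (1 - exp (- t)) y (exp (- t) *\<^sub>R x)) \<partial>\<nu>)"
    by (rule nn_integral_cong_AE, rule AE_mp[OF AE_power_measure], intro AE_I2 impI)
       (auto simp: ext_kernel_def True mult.assoc[symmetric] simp flip: ennreal_mult' exp_add)
  also have "... = 1"
    using t True by (intro nn_integral_bessel_heat pos_orthant_scaleR) auto
  finally show ?thesis by simp
qed (simp add: ext_kernel_def)

text \<open>In terms of the squared Bessel kernels, \<open>exp (-|y|)\<close> cancels the factor \<open>exp |y|\<close> of the second kernel, and a
dilation by \<open>p\<close> turns the product into \<open>P\<^sub>\<sigma>(x/p, y) P\<^sub>\<tau>(y, q z)\<close>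
with \<open>\<sigma> = (1 - p)/p\<close> and \<open>\<tau> = 1 - q\<close>.\<close>

lemma ext_kernel_Chapman_Kolmogorov:
  assumes s: "s > 0" and t: "t > 0"
  shows "(\<integral>\<^sup>+y. ext_kernel s x y * ext_kernel t y z \<partial>\<mu>) = ext_kernel (s + t) x z"
proof (cases "x \<in> pos_orthant \<and> z \<in> pos_orthant")
  case True
  define p q where "p = exp (- s)" and "q = exp (- t)"
  have pq: "p > 0" "p < 1" "q > 0" "q < 1" using s t by (auto simp: p_def q_def)
  define H where "H = heat ((1 - p) / p) ((1 / p) *\<^sub>R x)"
  define K where "K = (\<lambda>y. heat (1 - q) y (q *\<^sub>R z))"
  have sc: "heat (1 - p) x (p *\<^sub>R y) = p powr (- hom_dim) * H y" for y
    using bessel_heat_scale[of p "1 - p" "(1 / p) *\<^sub>R x" y] pq by (simp add: H_def)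
  have "(\<integral>\<^sup>+y. ext_kernel s x y * ext_kernel t y z \<partial>\<mu>)
    = (\<integral>\<^sup>+y. ennreal (exp (- coord_sum y)) * (ext_kernel s x y * ext_kernel t y z) \<partial>\<nu>)"
    by (rule nn_integral_borel_laguerre) measurable
  also have "... = (\<integral>\<^sup>+y. ennreal (exp (coord_sum x) * p powr (- hom_dim)) * (ennreal (H y)
       * ennreal (K y)) \<partial>\<nu>)"
  proof (rule nn_integral_cong_AE, rule AE_mp[OF AE_power_measure], intro AE_I2 impI)
    fix y :: "real ^ 'd" assume y: "y \<in> pos_orthant"
    have nn: "H y \<ge> 0" "K y \<ge> 0"
      unfolding H_def K_def using True y pq by (auto intro!: bessel_heat_nonneg' pos_orthant_scaleR)
    have "ennreal (exp (- coord_sum y)) * (ext_kernel s x y * ext_kernel t y z)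
       = ennreal (exp (- coord_sum y) * ((exp (coord_sum x) * (p powr (- hom_dim) * H y)) * (exp (coord_sum y) * K y)))"
      using True y nn unfolding ext_kernel_def p_def[symmetric] q_def[symmetric] sc
      by (simp add: ennreal_mult K_def)
    also have "exp (- coord_sum y) * ((exp (coord_sum x) * (p powr (- hom_dim) * H y)) * (exp (coord_sum y) * K y))
       = (exp (- coord_sum y) * exp (coord_sum y)) * ((exp (coord_sum x) * p powr (- hom_dim)) * (H y * K y))"
      by (simp only: mult_ac)
    also have "exp (- coord_sum y) * exp (coord_sum y) = 1" by (simp flip: exp_add)
    also have "ennreal (1 * ((exp (coord_sum x) * p powr (- hom_dim)) * (H y * K y)))
       = ennreal (exp (coord_sum x) * p powr (- hom_dim)) * (ennreal (H y)
       * ennreal (K y))"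
      using nn by (simp add: ennreal_mult)
    finally show "ennreal (exp (- coord_sum y)) * (ext_kernel s x y * ext_kernel t y z) = ..." .
  qed
  also have "... = ennreal (exp (coord_sum x) * p powr (- hom_dim)) * ennreal (heat ((1 - p) / p + (1 - q)) ((1 / p) *\<^sub>R x) (q *\<^sub>R z))"
    unfolding H_def K_def using True pq by (subst nn_integral_cmult, measurable, subst bessel_heat_Chapman_Kolmogorov)
      (auto intro!: pos_orthant_scaleR)
  also have "... = ennreal (exp (coord_sum x) * (p powr (- hom_dim) * heat ((1 - p) / p + (1 - q)) ((1 / p) *\<^sub>R x) (q *\<^sub>R z)))"
    by (simp add: mult.assoc flip: ennreal_mult')
  also have "p powr (- hom_dim) * heat ((1 - p) / p + (1 - q)) ((1 / p) *\<^sub>R x) (q *\<^sub>R z) = heat (1 - p * q) x ((p * q) *\<^sub>R z)"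
  proof -
    have "p * q < 1 * 1" using pq by (intro mult_strict_mono) auto
    moreover have "(1 - p * q) / p = (1 - p) / p + (1 - q)" using pq by (simp add: field_simps)
    ultimately show ?thesis
      using bessel_heat_scale[of p "1 - p * q" "(1 / p) *\<^sub>R x" "q *\<^sub>R z"] pq by simp
  qed
  also have "p * q = exp (- (s + t))" by (simp add: p_def q_def flip: exp_add)
  finally show ?thesis using True by (simp add: ext_kernel_def)
qed (auto simp: ext_kernel_def)

end

section \<open>Hopf's maximal ergodic theorem\<close>

text \<open>Garsia's proof, for a sub-Markovian kernel \<open>k\<close> that also contracts the integral. The function \<open>A n\<close> is the
sum of the first \<open>n\<close> iterates applied to \<open>g\<close>. Working with truncated differences in \<open>ennreal\<close>,
the maximal function \<open>m = max (A n - n l)\<close> satisfies \<open>m + l \<le> g + T m\<close> wherever it is positive;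
integrating, \<open>T m\<close> is absorbed by \<open>m\<close>, whose integral is finite.\<close>

lemma hopf_maximal_ergodic:
  fixes k :: "'a \<Rightarrow> 'a \<Rightarrow> ennreal" and A :: "nat \<Rightarrow> 'a \<Rightarrow> ennreal" and l :: real
  assumes "sigma_finite_measure M"
    and k [measurable]: "(\<lambda>(x, y). k x y) \<in> borel_measurable (M \<Otimes>\<^sub>M M)"
    and k1: "\<And>x. x \<in> space M \<Longrightarrow> (\<integral>\<^sup>+y. k x y \<partial>M) \<le> 1"
    and k2: "\<And>y. y \<in> space M \<Longrightarrow> (\<integral>\<^sup>+x. k x y \<partial>M) \<le> 1"
    and g [measurable]: "g \<in> borel_measurable M" and fin: "(\<integral>\<^sup>+x. g x \<partial>M) < \<infinity>"
    and A0: "\<And>x. A 0 x = 0" and A_Suc: "\<And>n x. A (Suc n) x = g x + (\<integral>\<^sup>+y. k x y * A n y \<partial>M)"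
    and l: "l > 0"
  shows "{x \<in> space M. \<exists>n\<le>N. A n x > of_nat n * ennreal l} \<in> sets M"
    and "ennreal l * emeasure M {x \<in> space M. \<exists>n\<le>N. A n x > of_nat n * ennreal l} \<le> (\<integral>\<^sup>+x. g x \<partial>M)"
proof -
  interpret sigma_finite_measure M by fact
  interpret P: pair_sigma_finite M M by unfold_locales
  define T where "T = (\<lambda>h x. \<integral>\<^sup>+y. k x y * h y \<partial>M)"
  have T_meas [measurable]: "T h \<in> borel_measurable M" if [measurable]: "h \<in> borel_measurable M" for h
    unfolding T_def by measurable
  have T_int: "(\<integral>\<^sup>+x. T h x \<partial>M) \<le> (\<integral>\<^sup>+x. h x \<partial>M)" if [measurable]: "h \<in> borel_measurable M" for h
  proof -
    have "(\<integral>\<^sup>+x. T h x \<partial>M) = (\<integral>\<^sup>+y. \<integral>\<^sup>+x. k x y * h y \<partial>M \<partial>M)"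
      unfolding T_def by (rule P.Fubini') measurable
    also have "... = (\<integral>\<^sup>+y. (\<integral>\<^sup>+x. k x y \<partial>M) * h y \<partial>M)"
      by (intro nn_integral_cong nn_integral_multc) measurable
    also have "... \<le> (\<integral>\<^sup>+y. 1 * h y \<partial>M)"
      by (intro nn_integral_mono mult_right_mono k2) auto
    finally show ?thesis by simp
  qed
  have A_Suc': "A (Suc n) = (\<lambda>x. g x + T (A n) x)" for n
    by (simp add: A_Suc T_def fun_eq_iff)
  have A_meas [measurable]: "A n \<in> borel_measurable M" for n
  proof (induction n)
    case 0
    have "A 0 = (\<lambda>x. 0)" by (simp add: A0 fun_eq_iff)
    then show ?case by simp
  next
    case (Suc n)
    then show ?case unfolding A_Suc' by measurable
  qed
  have A_fin: "(\<integral>\<^sup>+x. A n x \<partial>M) < \<infinity>" for n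
  proof (induction n)
    case (Suc n)
    have "(\<integral>\<^sup>+x. A (Suc n) x \<partial>M) = (\<integral>\<^sup>+x. g x \<partial>M) + (\<integral>\<^sup>+x. T (A n) x \<partial>M)"
      unfolding A_Suc' by (rule nn_integral_add) measurable
    also have "... \<le> (\<integral>\<^sup>+x. g x \<partial>M) + (\<integral>\<^sup>+x. A n x \<partial>M)"
      by (intro add_left_mono T_int) measurable
    also have "... < \<infinity>" using Suc fin by (simp add: less_top)
    finally show ?case .
  qed (simp add: A0)
  define m where "m = (\<lambda>x. Max ((\<lambda>n. A n x - of_nat n * ennreal l) ` {..N}))"
  have m_meas [measurable]: "m \<in> borel_measurable M"
    unfolding m_def by (intro borel_measurable_Max) auto
  have m_ge: "A n x - of_nat n * ennreal l \<le> m x" if "n \<le> N" for n x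
    unfolding m_def using that by (intro Max_ge) auto
  have m_ex: "\<exists>n\<le>N. m x = A n x - of_nat n * ennreal l" for x
    using Max_in[of "(\<lambda>n. A n x - of_nat n * ennreal l) ` {..N}"] unfolding m_def by fastforce
  have E_eq: "{x \<in> space M. \<exists>n\<le>N. A n x > of_nat n * ennreal l} = {x \<in> space M. m x > 0}" (is "?E = _")
  proof (intro Collect_cong conj_cong refl iffI)
    fix x assume "\<exists>n\<le>N. A n x > of_nat n * ennreal l"
    then obtain n where n: "n \<le> N" "A n x > of_nat n * ennreal l" by blast
    then have "A n x - of_nat n * ennreal l > 0" by (simp add: diff_gr0_ennreal ennreal_mult_less_top of_nat_less_top)
    then show "m x > 0" using m_ge[OF n(1), of x] by order
  next
    fix x assume pos: "m x > 0"
    obtain n where n: "n \<le> N" "m x = A n x - of_nat n * ennreal l" using m_ex by blast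
    then have "A n x > of_nat n * ennreal l" using pos
      by (metis diff_eq_0_iff_ennreal ennreal_top_neq_zero linorder_not_less not_gr_zero diff_eq_0_ennreal order_le_less ennreal_mult_less_top ennreal_less_top of_nat_less_top less_top)
    with n(1) show "\<exists>n\<le>N. A n x > of_nat n * ennreal l" by blast
  qed
  show E_meas: "?E \<in> sets M" unfolding E_eq by measurable
  have key: "m x + ennreal l * indicator ?E x \<le> g x + T m x" if x: "x \<in> space M" for x
  proof (cases "x \<in> ?E")
    case True
    then have pos: "m x > 0" using E_eq by blast
    obtain n where n: "n \<le> N" "m x = A n x - of_nat n * ennreal l" using m_ex by blast
    have "n \<noteq> 0" using pos n(2) A0[of x] by (cases n) auto
    then obtain j where j: "n = Suc j" by (cases n) auto
    define c where "c = of_nat j * ennreal l"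
    have c: "c < \<infinity>" by (simp add: c_def ennreal_mult_less_top of_nat_less_top)
    have "of_nat n * ennreal l \<le> A n x"
      using pos n(2) diff_eq_0_ennreal[of "A n x" "of_nat n * ennreal l"]
      by (metis ennreal_mult_less_top ennreal_less_top of_nat_less_top less_irrefl linorder_le_cases order_le_less_trans infinity_ennreal_def)
    then have "A n x = m x + of_nat n * ennreal l"
      unfolding n(2) by (simp add: diff_add_cancel_ennreal)
    also have "of_nat n * ennreal l = ennreal l + c" by (simp add: j c_def distrib_right)
    finally have 1: "A n x = c + (m x + ennreal l)" by (simp add: add_ac)
    have "T (A j) x \<le> (\<integral>\<^sup>+y. k x y * m y + c * k x y \<partial>M)"
      unfolding T_def
    proof (intro nn_integral_mono)
      fix y
      have "A j y \<le> m y + c"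
        using m_ge[of j y] n(1) j unfolding c_def by (simp add: ennreal_minus_le_iff add.commute)
      from mult_left_mono[OF this, of "k x y"]
      show "k x y * A j y \<le> k x y * m y + c * k x y" by (simp add: distrib_left mult.commute)
    qed
    also have "... = T m x + c * (\<integral>\<^sup>+y. k x y \<partial>M)"
      unfolding T_def using x by (subst nn_integral_add) (auto simp: nn_integral_cmult)
    also have "... \<le> T m x + c * 1" using x by (intro add_left_mono mult_left_mono k1) auto
    finally have "A n x \<le> c + (g x + T m x)"
      unfolding j A_Suc' by (simp add: add_ac add_left_mono)
    then have "c + (m x + ennreal l) \<le> c + (g x + T m x)" unfolding 1 .
    then have "m x + ennreal l \<le> g x + T m x"
      using c by (auto simp: ennreal_add_left_cancel_le)
    then show ?thesis using True by simp
  next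
    case False
    then have "m x = 0" using E_eq x by (auto simp: zero_less_iff_neq_zero)
    then show ?thesis using False by simp
  qed
  have m_fin: "(\<integral>\<^sup>+x. m x \<partial>M) < \<infinity>"
  proof -
    have "(\<integral>\<^sup>+x. m x \<partial>M) \<le> (\<integral>\<^sup>+x. (\<Sum>n\<le>N. A n x) \<partial>M)"
    proof (intro nn_integral_mono)
      fix x
      obtain n where n: "n \<le> N" "m x = A n x - of_nat n * ennreal l" using m_ex by blast
      then have "m x \<le> A n x" by (simp add: diff_le_self_ennreal)
      also have "... \<le> (\<Sum>n\<le>N. A n x)" using n(1) by (intro member_le_sum) auto
      finally show "m x \<le> (\<Sum>n\<le>N. A n x)" .
    qed
    also have "... = (\<Sum>n\<le>N. \<integral>\<^sup>+x. A n x \<partial>M)" by (intro nn_integral_sum) auto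
    also have "... < \<infinity>" using A_fin by (simp add: less_top)
    finally show ?thesis .
  qed
  have "(\<integral>\<^sup>+x. m x \<partial>M) + ennreal l * emeasure M ?E = (\<integral>\<^sup>+x. m x + ennreal l * indicator ?E x \<partial>M)"
    using E_meas by (subst nn_integral_add) (auto simp: nn_integral_cmult_indicator)
  also have "... \<le> (\<integral>\<^sup>+x. g x + T m x \<partial>M)" by (intro nn_integral_mono key)
  also have "... = (\<integral>\<^sup>+x. g x \<partial>M) + (\<integral>\<^sup>+x. T m x \<partial>M)" by (rule nn_integral_add) measurable
  also have "... \<le> (\<integral>\<^sup>+x. g x \<partial>M) + (\<integral>\<^sup>+x. m x \<partial>M)" by (intro add_left_mono T_int) measurable
  finally show "ennreal l * emeasure M ?E \<le> (\<integral>\<^sup>+x. g x \<partial>M)"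
    using m_fin by (auto simp: add.commute[of _ "\<integral>\<^sup>+x. m x \<partial>M"] ennreal_add_left_cancel_le)
qed

context laguerre_type
begin

section \<open>Harnack inequalities for the product kernel\<close>

definition harnack_degree :: real where "harnack_degree = (\<Sum>i\<in>UNIV. \<alpha> $ i + 3)"

text \<open>The logarithm of what is lost in the Gaussian factors when time changes from \<open>\<tau>\<close> to \<open>\<tau>'\<close> and the
point moves from \<open>w\<close> to \<open>\<kappa> w\<close>.\<close>

definition gauss_defect :: "real \<Rightarrow> real \<Rightarrow> real \<Rightarrow> real ^ 'd \<Rightarrow> real ^ 'd \<Rightarrow> real" where
  "gauss_defect \<tau> \<tau>' \<kappa> u w = (\<Sum>i\<in>UNIV.
     (sqrt (u $ i) - sqrt \<kappa> * sqrt (w $ i))\<^sup>2 / \<tau>' - (sqrt (u $ i) - sqrt (w $ i))\<^sup>2 / \<tau>)"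

text \<open>The three factors bound those of the Harnack inequality when the time increases at most by the factor
8, the point moves inwards at most by the factor 4, and the Gaussian loss is bounded.\<close>

definition harnack_const :: real where "harnack_const = 8 powr harnack_degree * 4 ^ CARD('d) * exp 2"

lemma harnack_degree_pos: "harnack_degree > 0"
  unfolding harnack_degree_def using type_gt by (intro sum_pos) (auto, smt (verit))

lemma harnack_const_pos: "harnack_const > 0"
  by (simp add: harnack_const_def)

lemma bessel_heat_harnack:
  assumes \<tau>: "0 < \<tau>" "\<tau> \<le> \<tau>'" and \<kappa>: "0 < \<kappa>" "\<kappa> * \<tau>\<^sup>2 \<le> \<tau>'\<^sup>2"
    and u: "u \<in> pos_orthant" and w: "w \<in> pos_orthant"
  shows "heat \<tau> u w \<le> (\<tau>' / \<tau>) powr harnack_degree * (1 / \<kappa>) ^ CARD('d)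
     * exp (gauss_defect \<tau> \<tau>' \<kappa> u w)
     * heat \<tau>' u (\<kappa> *\<^sub>R w)"
proof -
  have pos: "u $ i > 0" "w $ i > 0" for i using u w by (auto simp: pos_orthant_def)
  have "heat \<tau> u w \<le> (\<Prod>i\<in>UNIV. (\<tau>' / \<tau>) powr (\<alpha> $ i + 3) * (1 / \<kappa>)
     * exp ((sqrt (u $ i) - sqrt \<kappa> * sqrt (w $ i))\<^sup>2 / \<tau>' - (sqrt (u $ i) - sqrt (w $ i))\<^sup>2 / \<tau>)
     * sq_bessel_kernel (\<alpha> $ i) \<tau>' (u $ i) (\<kappa> * w $ i))"
    unfolding bessel_heat_def
    using sq_bessel_kernel_harnack[OF type_gt \<tau> \<kappa> pos(1) pos(2)] pos
    by (intro prod_mono conjI sq_bessel_kernel_nonneg type_gt) (auto simp: less_imp_le)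
  also have "... = (\<tau>' / \<tau>) powr harnack_degree * (1 / \<kappa>) ^ CARD('d)
     * exp (gauss_defect \<tau> \<tau>' \<kappa> u w)
     * heat \<tau>' u (\<kappa> *\<^sub>R w)"
    using \<tau> by (simp only: prod.distrib exp_sum[OF finite] prod_constant bessel_heat_def vector_scaleR_component harnack_degree_def gauss_defect_def)
      (simp add: powr_sum)
  finally show ?thesis .
qed

lemma bessel_heat_harnack_const:
  assumes \<tau>: "0 < \<tau>" "\<tau> \<le> \<tau>'" "\<tau>' \<le> 8 * \<tau>" and \<kappa>: "1 / 4 \<le> \<kappa>" "\<kappa> \<le> 1"
    and u: "u \<in> pos_orthant" and w: "w \<in> pos_orthant" and gd: "gauss_defect \<tau> \<tau>' \<kappa> u w \<le> 2"
  shows "heat \<tau> u w \<le> harnack_const * heat \<tau>' u (\<kappa> *\<^sub>R w)"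
proof -
  have "\<kappa> * \<tau>\<^sup>2 \<le> 1 * \<tau>'\<^sup>2" using \<tau> \<kappa> by (intro mult_mono power_mono) auto
  then have "heat \<tau> u w \<le> (\<tau>' / \<tau>) powr harnack_degree * (1 / \<kappa>) ^ CARD('d)
     * exp (gauss_defect \<tau> \<tau>' \<kappa> u w) * heat \<tau>' u (\<kappa> *\<^sub>R w)"
    using \<tau> \<kappa> by (intro bessel_heat_harnack u w) auto
  also have "... \<le> 8 powr harnack_degree * 4 ^ CARD('d) * exp 2 * heat \<tau>' u (\<kappa> *\<^sub>R w)"
  proof (intro mult_right_mono mult_mono)
    show "(\<tau>' / \<tau>) powr harnack_degree \<le> 8 powr harnack_degree"
      using \<tau> harnack_degree_pos by (intro powr_mono2) (auto simp: field_simps)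
    show "(1 / \<kappa>) ^ CARD('d) \<le> 4 ^ CARD('d)"
      using \<kappa> by (intro power_mono) (auto simp: field_simps)
    show "heat \<tau>' u (\<kappa> *\<^sub>R w) \<ge> 0"
      using \<kappa> u w by (intro bessel_heat_nonneg' pos_orthant_scaleR) auto
  qed (use \<kappa> gd in auto)
  finally show ?thesis by (simp add: harnack_const_def)
qed

text \<open>A move along the ray by at most the diffusion distance \<open>sqrt \<tau>'\<close>, in square-root coordinates, is
absorbed if the time is at least doubled, since \<open>(D + e)\<^sup>2 \<le> 2 D\<^sup>2 + 2 e\<^sup>2\<close>.\<close>

lemma bessel_heat_near:
  assumes \<tau>: "0 < \<tau>" "\<tau>' \<le> 8 * \<tau>" "2 * \<tau> \<le> \<tau>'" and \<kappa>: "1 / 4 \<le> \<kappa>" "\<kappa> \<le> 1"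
    and close: "(1 - sqrt \<kappa>)\<^sup>2 * coord_sum w \<le> \<tau>'"
    and u: "u \<in> pos_orthant" and w: "w \<in> pos_orthant"
  shows "heat \<tau> u w \<le> harnack_const * heat \<tau>' u (\<kappa> *\<^sub>R w)"
proof -
  have pos: "u $ i > 0" "w $ i > 0" for i using u w by (auto simp: pos_orthant_def)
  have \<tau>': "\<tau>' > 0" "\<tau> \<le> \<tau>'" using \<tau> by auto
  have "gauss_defect \<tau> \<tau>' \<kappa> u w
     \<le> (\<Sum>i\<in>UNIV. 2 * (1 - sqrt \<kappa>)\<^sup>2 * w $ i / \<tau>')"
    unfolding gauss_defect_def
  proof (intro sum_mono)
    fix i
    define D e where "D = sqrt (u $ i) - sqrt (w $ i)" and "e = (1 - sqrt \<kappa>) * sqrt (w $ i)"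
    have "(sqrt (u $ i) - sqrt \<kappa> * sqrt (w $ i))\<^sup>2 = (D + e)\<^sup>2" by (simp add: D_def e_def algebra_simps)
    also have "... \<le> 2 * D\<^sup>2 + 2 * e\<^sup>2"
      using zero_le_power2[of "D - e"] by (simp add: power2_eq_square algebra_simps)
    finally have "(sqrt (u $ i) - sqrt \<kappa> * sqrt (w $ i))\<^sup>2 / \<tau>' \<le> (2 * D\<^sup>2 + 2 * e\<^sup>2) / \<tau>'"
      using \<tau>' by (intro divide_right_mono) auto
    moreover have "2 * D\<^sup>2 / \<tau>' \<le> 2 * D\<^sup>2 / (2 * \<tau>)"
      using \<tau> \<tau>' by (intro divide_left_mono) auto
    moreover have "e\<^sup>2 = (1 - sqrt \<kappa>)\<^sup>2 * w $ i" using pos(2)[of i] by (simp add: e_def power_mult_distrib)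
    ultimately show "(sqrt (u $ i) - sqrt \<kappa> * sqrt (w $ i))\<^sup>2 / \<tau>' - (sqrt (u $ i) - sqrt (w $ i))\<^sup>2 / \<tau>
        \<le> 2 * (1 - sqrt \<kappa>)\<^sup>2 * w $ i / \<tau>'"
      unfolding D_def[symmetric] by (simp add: add_divide_distrib)
  qed
  also have "... = 2 * ((1 - sqrt \<kappa>)\<^sup>2 * coord_sum w) / \<tau>'"
    by (simp add: coord_sum_def sum_distrib_left sum_divide_distrib mult.assoc)
  also have "... \<le> 2" using close \<tau>' by (simp add: field_simps)
  finally have "gauss_defect \<tau> \<tau>' \<kappa> u w \<le> 2" .
  then show ?thesis using \<tau> \<tau>' \<kappa> by (intro bessel_heat_harnack_const u w) auto
qed

text \<open>Beyond suitable multiples of \<open>|u|\<close> and of \<open>\<tau>\<close> the Gaussian decay along a ray beats the power of \<open>\<kappa>\<close> that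
the Harnack inequality loses, so a supremum over a ray only concerns a bounded part of it.\<close>

lemma bessel_heat_far:
  assumes \<tau>: "0 < \<tau>" and \<kappa>: "0 < \<kappa>" "\<kappa> \<le> 1"
    and far: "\<kappa> * coord_sum w \<ge> 4 * coord_sum u" "\<kappa> * coord_sum w \<ge> 2 * real CARD('d) * \<tau>"
    and u: "u \<in> pos_orthant" and w: "w \<in> pos_orthant"
  shows "heat \<tau> u w \<le> heat \<tau> u (\<kappa> *\<^sub>R w)"
proof -
  have pos: "u $ i > 0" "w $ i > 0" for i using u w by (auto simp: pos_orthant_def)
  define r W U d where "r = sqrt \<kappa>" and "W = coord_sum w" and "U = coord_sum u" and "d = real CARD('d)"
  have r: "0 < r" "r \<le> 1" "\<kappa> = r * r" using \<kappa> by (auto simp: r_def)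
  have W: "W > 0" "U > 0" using coord_sum_pos u w by (auto simp: W_def U_def)
  have "\<kappa> * \<tau>\<^sup>2 \<le> 1 * \<tau>\<^sup>2" using \<kappa> by (intro mult_right_mono) auto
  then have main: "heat \<tau> u w \<le> (\<tau> / \<tau>) powr harnack_degree * (1 / \<kappa>) ^ CARD('d)
     * exp (gauss_defect \<tau> \<tau> \<kappa> u w)
     * heat \<tau> u (\<kappa> *\<^sub>R w)"
    using \<tau> \<kappa> by (intro bessel_heat_harnack u w) auto
  have "gauss_defect \<tau> \<tau> \<kappa> u w
     \<le> (\<Sum>i\<in>UNIV. (- (1 - \<kappa>) * w $ i + (1 - r) * (2 * u $ i + w $ i / 2)) / \<tau>)"
    unfolding gauss_defect_def
  proof (intro sum_mono)
    fix i
    define a b where "a = sqrt (u $ i)" and "b = sqrt (w $ i)"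
    have ab: "u $ i = a * a" "w $ i = b * b" using pos[of i] by (auto simp: a_def b_def)
    have "(2 * a - b) * (2 * a - b) \<ge> 0" by simp
    then have "2 * (a * b) \<le> 2 * (a * a) + b * b / 2" by (simp add: algebra_simps)
    then have "(1 - r) * (2 * (a * b)) \<le> (1 - r) * (2 * (a * a) + b * b / 2)"
      using r by (intro mult_left_mono) auto
    then have "(a - r * b)\<^sup>2 - (a - b)\<^sup>2 \<le> - (1 - r * r) * (b * b) + (1 - r) * (2 * (a * a) + b * b / 2)"
      by (simp add: power2_eq_square algebra_simps)
    then have "(a - r * b)\<^sup>2 - (a - b)\<^sup>2 \<le> - (1 - \<kappa>) * w $ i + (1 - r) * (2 * u $ i + w $ i / 2)"
      by (simp only: ab r(3))
    then show "(sqrt (u $ i) - sqrt \<kappa> * sqrt (w $ i))\<^sup>2 / \<tau> - (sqrt (u $ i) - sqrt (w $ i))\<^sup>2 / \<tau>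
        \<le> (- (1 - \<kappa>) * w $ i + (1 - r) * (2 * u $ i + w $ i / 2)) / \<tau>"
      unfolding a_def[symmetric] b_def[symmetric] r_def[symmetric] diff_divide_distrib[symmetric]
      using \<tau> by (intro divide_right_mono) auto
  qed
  also have "... = (- (1 - \<kappa>) * W + (1 - r) * (2 * U + W / 2)) / \<tau>"
    by (simp add: W_def U_def coord_sum_def sum.distrib distrib_left flip: sum_divide_distrib sum_distrib_left)
  also have "... \<le> - ((1 - \<kappa>) * W / 2) / \<tau>"
  proof (intro divide_right_mono)
    have "4 * U \<le> r * (r * W)" using far(1) by (simp add: U_def W_def r(3) mult_ac)
    also have "... \<le> 1 * (r * W)" using r W by (intro mult_right_mono) auto
    finally have "2 * U + W / 2 \<le> (1 + r) * W / 2" by (simp add: algebra_simps)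
    then have "(1 - r) * (2 * U + W / 2) \<le> (1 - r) * ((1 + r) * W / 2)"
      using r by (intro mult_left_mono) auto
    also have "... = (1 - \<kappa>) * W / 2" by (simp add: r(3) algebra_simps)
    finally show "- (1 - \<kappa>) * W + (1 - r) * (2 * U + W / 2) \<le> - ((1 - \<kappa>) * W / 2)"
      by (simp only: minus_mult_left[symmetric])
  qed (use \<tau> in auto)
  also have "... \<le> - (d * (1 / \<kappa> - 1))"
  proof -
    have "d / \<kappa> \<le> W / (2 * \<tau>)" using far(2) \<kappa> \<tau> by (simp add: W_def d_def field_simps)
    then have "(1 - \<kappa>) * (d / \<kappa>) \<le> (1 - \<kappa>) * (W / (2 * \<tau>))" using \<kappa> by (intro mult_left_mono) auto
    then show ?thesis using \<kappa> by (simp add: field_simps)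
  qed
  finally have E: "exp (gauss_defect \<tau> \<tau> \<kappa> u w)
      \<le> exp (- (d * (1 / \<kappa> - 1)))" by simp
  have "(1 / \<kappa>) ^ CARD('d) \<le> exp (1 / \<kappa> - 1) ^ CARD('d)"
    using \<kappa> exp_ge_add_one_self[of "1 / \<kappa> - 1"] by (intro power_mono) auto
  also have "... = exp (d * (1 / \<kappa> - 1))" by (simp add: d_def exp_of_nat_mult)
  finally have "(1 / \<kappa>) ^ CARD('d) * exp (gauss_defect \<tau> \<tau> \<kappa> u w)
     \<le> exp (d * (1 / \<kappa> - 1)) * exp (- (d * (1 / \<kappa> - 1)))"
    using E \<kappa> by (intro mult_mono) auto
  also have "... = 1" by (simp flip: exp_add)
  finally have "(1 / \<kappa>) ^ CARD('d) * exp (gauss_defect \<tau> \<tau> \<kappa> u w)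
     * heat \<tau> u (\<kappa> *\<^sub>R w) \<le> 1 * heat \<tau> u (\<kappa> *\<^sub>R w)"
    using \<kappa> u w by (intro mult_right_mono bessel_heat_nonneg' pos_orthant_scaleR) auto
  with main show ?thesis using \<tau> by simp
qed

text \<open>Near the origin points are moved outwards instead: the Bessel--Clifford factor increases, at the
expense of an exponential that is bounded on the diffusion scale.\<close>

lemma bessel_heat_le_right:
  assumes \<tau>: "0 < \<tau>" and \<kappa>: "1 \<le> \<kappa>" and u: "u \<in> pos_orthant" and w: "w \<in> pos_orthant"
  shows "heat \<tau> u w \<le> exp ((\<kappa> - 1) * coord_sum w / \<tau>) * heat \<tau> u (\<kappa> *\<^sub>R w)"
proof -
  have pos: "u $ i > 0" "w $ i > 0" for i using u w by (auto simp: pos_orthant_def)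
  have "heat \<tau> u w \<le> (\<Prod>i\<in>UNIV. exp ((\<kappa> * w $ i - w $ i) / \<tau>) * sq_bessel_kernel (\<alpha> $ i) \<tau> (u $ i) (\<kappa> * w $ i))"
    unfolding bessel_heat_def
    using \<kappa> pos by (intro prod_mono conjI sq_bessel_kernel_nonneg sq_bessel_kernel_le_right type_gt \<tau>) (auto simp: less_imp_le)
  also have "... = exp (\<Sum>i\<in>UNIV. (\<kappa> * w $ i - w $ i) / \<tau>) * heat \<tau> u (\<kappa> *\<^sub>R w)"
    by (simp add: prod.distrib exp_sum bessel_heat_def)
  also have "(\<Sum>i\<in>UNIV. (\<kappa> * w $ i - w $ i) / \<tau>) = (\<kappa> - 1) * coord_sum w / \<tau>"
    by (simp add: coord_sum_def sum_subtractf sum_distrib_left left_diff_distrib flip: sum_divide_distrib)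
  finally show ?thesis .
qed

text \<open>Between the times \<open>t\<close> and \<open>s\<close> the centre \<open>exp (-t) y\<close> moves by the relative amount \<open>O(t)\<close>. In
square-root coordinates that is at most \<open>O(t) (sqrt x + D)\<close>, with \<open>D\<close> the distance from \<open>sqrt x\<close>. The part
with \<open>D\<close> is paid for by the longer time \<open>\<tau>' \<ge> 4 \<tau>\<close>, and the other costs \<open>O(t |x|)\<close> in the exponent,
which is where locality enters.\<close>

lemma bessel_heat_local_comparison:
  assumes t: "t > 0" "t * (1 + coord_sum x) \<le> 1 / 100" and s: "5 * t \<le> s" "s \<le> 6 * t"
    and x: "x \<in> pos_orthant" and y: "y \<in> pos_orthant"
  shows "heat (1 - exp (- t)) x (exp (- t) *\<^sub>R y)
    \<le> harnack_const * heat (1 - exp (- s)) x (exp (- s) *\<^sub>R y)"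
proof -
  have pos: "x $ i > 0" "y $ i > 0" for i using x y by (auto simp: pos_orthant_def)
  have X: "coord_sum x > 0" using x by (rule coord_sum_pos)
  have t100: "t \<le> 1 / 100"
  proof -
    have "t * 1 \<le> t * (1 + coord_sum x)" using t X by (intro mult_left_mono) auto
    from order_trans[OF this t(2)] show ?thesis by simp
  qed
  define \<tau> \<tau>' \<kappa> w where "\<tau> = 1 - exp (- t)" and "\<tau>' = 1 - exp (- s)" and "\<kappa> = exp (- (s - t))" and "w = exp (- t) *\<^sub>R y"
  have w: "w \<in> pos_orthant" using y by (simp add: w_def pos_orthant_scaleR)
  have \<kappa>w: "\<kappa> *\<^sub>R w = exp (- s) *\<^sub>R y" by (simp add: \<kappa>_def w_def flip: exp_add)
  have \<tau>t: "\<tau> > 0" "\<tau> \<le> t" "t / 2 \<le> \<tau>"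
  proof -
    show "\<tau> > 0" using t by (simp add: \<tau>_def)
    show "\<tau> \<le> t" using exp_ge_add_one_self[of "- t"] by (simp add: \<tau>_def)
    have "exp (- t) \<le> 1 / (1 + t)"
      using exp_ge_add_one_self[of t] t by (simp add: exp_minus field_simps)
    also have "... \<le> 1 - t / 2" using t t100 by (simp add: field_simps)
    finally show "t / 2 \<le> \<tau>" by (simp add: \<tau>_def)
  qed
  have le6: "\<tau>' \<le> 6 * \<tau>"
  proof -
    have "1 + real 6 * (- \<tau>) \<le> (1 + - \<tau>) ^ 6" using \<tau>t t100 by (intro Bernoulli_inequality) auto
    also have "(1 + - \<tau>) ^ 6 = exp (- (6 * t))" by (simp add: \<tau>_def flip: exp_of_nat_mult)
    also have "... \<le> exp (- s)" using s by simp
    finally show ?thesis by (simp add: \<tau>'_def)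
  qed
  have ge4: "4 * \<tau> \<le> \<tau>'"
  proof -
    have "exp (- s) \<le> exp (- (5 * t))" using s by simp
    also have "... \<le> 1 / (1 + 5 * t)"
      using exp_ge_add_one_self[of "5 * t"] t by (simp add: exp_minus field_simps)
    also have "... \<le> 1 - 4 * t"
    proof -
      have "20 * (t * t) \<le> 20 * (t * (1 / 100))" using t t100 by (intro mult_left_mono) auto
      then show ?thesis using t by (simp add: field_simps)
    qed
    finally show ?thesis using \<tau>t by (simp add: \<tau>'_def)
  qed
  have \<tau>': "\<tau>' > 0" "\<tau> \<le> \<tau>'" using ge4 \<tau>t by auto
  have \<kappa>: "1 / 4 \<le> \<kappa>" "\<kappa> \<le> 1"
    using exp_ge_add_one_self[of "- (s - t)"] s t t100 unfolding \<kappa>_def by (simp_all del: exp_ge_add_one_self)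
  define e where "e = 1 - sqrt \<kappa>"
  have e: "0 \<le> e" "e \<le> 5 / 2 * t"
  proof -
    show "0 \<le> e" using \<kappa> by (simp add: e_def)
    have "sqrt \<kappa> = exp (- ((s - t) / 2))"
      unfolding \<kappa>_def by (rule real_sqrt_unique) (auto simp: power2_eq_square field_simps simp flip: exp_add)
    moreover have "1 - exp (- z) \<le> z" for z :: real
      using exp_ge_add_one_self[of "- z"] by linarith
    ultimately have "e \<le> (s - t) / 2" unfolding e_def by metis
    then show "e \<le> 5 / 2 * t" using s by simp
  qed
  have "gauss_defect \<tau> \<tau>' \<kappa> x w
     \<le> (\<Sum>i\<in>UNIV. 25 / 4 * t * x $ i)"
    unfolding gauss_defect_def
  proof (intro sum_mono)
    fix i
    define D r where "D = \<bar>sqrt (x $ i) - sqrt (w $ i)\<bar>" and "r = sqrt (x $ i)"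
    have D: "D \<ge> 0" and r: "r \<ge> 0" "r * r = x $ i" using pos(1)[of i] by (auto simp: D_def r_def)
    have sw: "sqrt (w $ i) \<le> r + D" by (auto simp: D_def r_def)
    have "sqrt (x $ i) - sqrt \<kappa> * sqrt (w $ i) = (sqrt (x $ i) - sqrt (w $ i)) + e * sqrt (w $ i)"
      by (simp add: e_def algebra_simps)
    then have "\<bar>sqrt (x $ i) - sqrt \<kappa> * sqrt (w $ i)\<bar> \<le> D + e * sqrt (w $ i)"
      using e pos(2)[of i] w unfolding D_def
      by (metis (no_types, lifting) abs_mult abs_of_nonneg abs_triangle_ineq less_eq_real_def mem_Collect_eq pos_orthant_def real_sqrt_ge_zero)
    also have "... \<le> D + e * (r + D)" using e sw by (intro add_left_mono mult_left_mono) auto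
    also have "... = (1 + e) * D + e * r" by (simp add: algebra_simps)
    finally have "(sqrt (x $ i) - sqrt \<kappa> * sqrt (w $ i))\<^sup>2 \<le> ((1 + e) * D + e * r)\<^sup>2"
      using power_mono[of "\<bar>sqrt (x $ i) - sqrt \<kappa> * sqrt (w $ i)\<bar>" _ 2] by simp
    also have "... \<le> 2 * ((1 + e) * D)\<^sup>2 + 2 * (e * r)\<^sup>2"
      using zero_le_power2[of "(1 + e) * D - e * r"] unfolding power2_sum power2_diff by linarith
    also have "... \<le> 4 * D\<^sup>2 + 2 * (e * r)\<^sup>2"
    proof -
      have "(1 + e)\<^sup>2 \<le> (41 / 40)\<^sup>2" using e t100 by (intro power_mono) auto
      also have "... \<le> (2 :: real)" by (simp add: power2_eq_square)
      finally have "(1 + e)\<^sup>2 * D\<^sup>2 \<le> 2 * D\<^sup>2" by (intro mult_right_mono) auto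
      then show ?thesis by (simp add: power_mult_distrib mult.commute)
    qed
    finally have "(sqrt (x $ i) - sqrt \<kappa> * sqrt (w $ i))\<^sup>2 / \<tau>' \<le> (4 * D\<^sup>2 + 2 * (e * r)\<^sup>2) / \<tau>'"
      using \<tau>' by (intro divide_right_mono) auto
    also have "... \<le> (4 * D\<^sup>2 + 2 * (e * r)\<^sup>2) / (4 * \<tau>)"
      using \<tau>t ge4 \<tau>' by (intro divide_left_mono) auto
    also have "... = D\<^sup>2 / \<tau> + (e * e) * x $ i / (2 * \<tau>)"
      using \<tau>t r(2) by (simp add: field_simps power2_eq_square)
    also have "(e * e) * x $ i / (2 * \<tau>) \<le> ((5 / 2 * t) * (5 / 2 * t)) * x $ i / (2 * (t / 2))"
      using e t \<tau>t pos(1)[of i] by (intro frac_le mult_right_mono mult_mono) auto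
    also have "... = 25 / 4 * t * x $ i" using t by (simp add: field_simps)
    finally show "(sqrt (x $ i) - sqrt \<kappa> * sqrt (w $ i))\<^sup>2 / \<tau>' - (sqrt (x $ i) - sqrt (w $ i))\<^sup>2 / \<tau> \<le> 25 / 4 * t * x $ i"
      unfolding D_def power2_abs by (simp only: diff_le_eq add.commute)
  qed
  also have "... = 25 / 4 * (t * coord_sum x)" by (simp add: coord_sum_def sum_distrib_left mult.assoc)
  also have "... \<le> 2" using t by (simp add: distrib_left)
  finally have "gauss_defect \<tau> \<tau>' \<kappa> x w \<le> 2" .
  then have "heat \<tau> x w \<le> harnack_const * heat \<tau>' x (\<kappa> *\<^sub>R w)"
    using \<tau>t \<tau>' le6 \<kappa> by (intro bessel_heat_harnack_const x w) auto
  then show ?thesis unfolding \<kappa>w by (simp add: \<tau>_def \<tau>'_def w_def)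
qed

end

section \<open>Borel representatives and continuity\<close>

lemma nn_integral_laguerre_measure:
  fixes \<alpha> :: "real ^ 'd"
  assumes F [measurable]: "F \<in> borel_measurable borel"
  shows "(\<integral>\<^sup>+x. F x \<partial>laguerre_measure \<alpha>) = (\<integral>\<^sup>+x. F x \<partial>borel_laguerre_measure \<alpha>)"
proof -
  define h where "h = (\<lambda>x :: real ^ 'd. ennreal ((\<Prod>i\<in>UNIV. (x $ i) powr (\<alpha> $ i)) * exp (- (\<Sum>i\<in>UNIV. x $ i))))"
  have h [measurable]: "h \<in> borel_measurable borel" unfolding h_def by measurable
  have leb: "G \<in> borel_measurable (restrict_space lebesgue pos_orthant)" if "G \<in> borel_measurable borel" for G :: "real ^ 'd \<Rightarrow> ennreal"
    using that by (intro measurable_restrict_space1 measurable_completion) simp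
  have "(\<integral>\<^sup>+x. F x \<partial>laguerre_measure \<alpha>) = (\<integral>\<^sup>+x. h x * F x \<partial>restrict_space lebesgue pos_orthant)"
    unfolding laguerre_measure_def h_def[symmetric]
    by (rule nn_integral_density) (auto intro!: leb h F)
  also have "... = (\<integral>\<^sup>+x. h x * F x * indicator pos_orthant x \<partial>lebesgue)"
    by (rule nn_integral_restrict_space) simp
  also have "... = (\<integral>\<^sup>+x. h x * F x * indicator pos_orthant x \<partial>lborel)"
    by (rule nn_integral_completion)
  also have "... = (\<integral>\<^sup>+x. (\<Prod>i\<in>UNIV. power_weight (\<alpha> $ i) (x $ i)) * (ennreal (exp (- coord_sum x)) * F x) \<partial>lborel)"
  proof (intro nn_integral_cong)
    fix x :: "real ^ 'd"
    show "h x * F x * indicator pos_orthant x = (\<Prod>i\<in>UNIV. power_weight (\<alpha> $ i) (x $ i)) * (ennreal (exp (- coord_sum x)) * F x)"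
    proof (cases "x \<in> pos_orthant")
      case True
      then have "(\<Prod>i\<in>UNIV. power_weight (\<alpha> $ i) (x $ i)) = ennreal (\<Prod>i\<in>UNIV. (x $ i) powr (\<alpha> $ i))"
        by (subst prod_ennreal) (auto simp: pos_orthant_def)
      then show ?thesis using True
        by (simp add: h_def coord_sum_def ennreal_mult'' mult.assoc)
    next
      case False
      then obtain i where "\<not> x $ i > 0" by (auto simp: pos_orthant_def)
      then have "(\<Prod>i\<in>UNIV. power_weight (\<alpha> $ i) (x $ i)) = 0"
        by (intro prod_zero bexI[of _ i]) auto
      then show ?thesis using False by simp
    qed
  qed
  also have "... = (\<integral>\<^sup>+x. ennreal (exp (- coord_sum x)) * F x \<partial>power_measure \<alpha>)"
    unfolding power_measure_def by (subst nn_integral_density) auto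
  also have "... = (\<integral>\<^sup>+x. F x \<partial>borel_laguerre_measure \<alpha>)"
    by (rule nn_integral_borel_laguerre[symmetric]) measurable
  finally show ?thesis .
qed

lemma sets_laguerre_measure: "sets (laguerre_measure \<alpha>) = sets (restrict_space lebesgue pos_orthant)"
  by (simp add: laguerre_measure_def)

lemma space_laguerre_measure [simp]: "space (laguerre_measure \<alpha>) = pos_orthant"
  by (simp add: laguerre_measure_def)

lemma borel_in_sets_laguerre_measure:
  assumes "S \<in> sets borel" "S \<subseteq> pos_orthant"
  shows "S \<in> sets (laguerre_measure \<alpha>)"
  unfolding sets_laguerre_measure using assms by (subst sets_restrict_space_iff) auto

lemma emeasure_laguerre_measure:
  assumes [measurable]: "S \<in> sets borel" and "S \<subseteq> pos_orthant"
  shows "emeasure (laguerre_measure \<alpha>) S = emeasure (borel_laguerre_measure \<alpha>) S"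
proof -
  have "emeasure (laguerre_measure \<alpha>) S = (\<integral>\<^sup>+x. indicator S x \<partial>laguerre_measure \<alpha>)"
    using borel_in_sets_laguerre_measure[OF assms] by simp
  also have "... = (\<integral>\<^sup>+x. indicator S x \<partial>borel_laguerre_measure \<alpha>)"
    by (rule nn_integral_laguerre_measure) measurable
  finally show ?thesis by simp
qed

lemma borel_measurable_imp_laguerre:
  assumes "F \<in> borel_measurable borel"
  shows "F \<in> borel_measurable (laguerre_measure \<alpha>)"
proof -
  have "F \<in> borel_measurable (restrict_space lebesgue pos_orthant)"
    using assms by (intro measurable_restrict_space1 measurable_completion) simp
  then show ?thesis by (simp add: laguerre_measure_def)
qed

text \<open>Functions measurable for the completed measure are replaced by Borel functions, so that Tonelli's
theorem becomes available; this only affects null sets, which the kernels integrate away.\<close>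

lemma laguerre_measurable_ex_borel:
  fixes f :: "real ^ 'd \<Rightarrow> ennreal"
  assumes f: "f \<in> borel_measurable (laguerre_measure \<alpha>)"
  obtains g where "g \<in> borel_measurable borel" "AE x in laguerre_measure \<alpha>. f x = g x"
proof -
  have "f \<in> borel_measurable (restrict_space lebesgue pos_orthant)"
    using f by (simp add: laguerre_measure_def)
  then have "(\<lambda>x. if x \<in> pos_orthant then f x else 0) \<in> borel_measurable lebesgue"
    by (subst (asm) measurable_restrict_space_iff[of _ _ 0]) auto
  then obtain g where g: "g \<in> borel_measurable lborel" "AE x in lborel. (if x \<in> pos_orthant then f x else 0) = g x"
    using completion_ex_borel_measurable by blast
  have "AE x in lebesgue. (if x \<in> pos_orthant then f x else 0) = g x"
    using g(2) by (rule AE_completion)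
  then have "AE x in restrict_space lebesgue pos_orthant. f x = g x"
    by (subst AE_restrict_space_iff) (auto elim!: eventually_mono)
  moreover have "(\<lambda>x :: real ^ 'd. ennreal ((\<Prod>i\<in>UNIV. (x $ i) powr (\<alpha> $ i)) * exp (- (\<Sum>i\<in>UNIV. x $ i)))) \<in> borel_measurable (restrict_space lebesgue pos_orthant)"
    by (intro measurable_restrict_space1 measurable_completion) measurable
  ultimately have "AE x in laguerre_measure \<alpha>. f x = g x"
    unfolding laguerre_measure_def by (subst AE_density) (auto elim!: eventually_mono)
  with g(1) show ?thesis by (intro that[of g]) auto
qed

context laguerre_type
begin

text \<open>Locally uniformly in \<open>x\<close> the kernel is bounded in \<open>y\<close>. Hence the integral defining the semigroup
converges absolutely, and dominated convergence makes it continuous in \<open>x\<close>; superlevel sets of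
suprema over uncountably many \<open>t\<close> are then open.\<close>

lemma laguerre_kernel_bounded:
  assumes t: "t > 0"
  obtains C where "\<And>x y. x \<in> pos_orthant \<Longrightarrow> y \<in> pos_orthant \<Longrightarrow> (\<And>i. x $ i \<le> U) \<Longrightarrow> laguerre_kernel \<alpha> t x y \<le> C"
proof -
  define V where "V = max U 0"
  define \<tau> where "\<tau> = 1 - exp (- t)"
  have \<tau>: "\<tau> > 0" using t by (simp add: \<tau>_def)
  define c where "c = (\<lambda>i. crude_const (\<alpha> $ i) * (1 + V / \<tau>))"
  have K: "sq_bessel_kernel (\<alpha> $ i) \<tau> u w \<le> \<tau> powr (- (\<alpha> $ i + 1)) * c i" if "0 \<le> u" "u \<le> V" "w \<ge> 0" for i u w
  proof -
    have "crude_const (\<alpha> $ i) * \<tau> powr (- (\<alpha> $ i + 1)) * (1 + u / \<tau>)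
        \<le> crude_const (\<alpha> $ i) * \<tau> powr (- (\<alpha> $ i + 1)) * (1 + V / \<tau>)"
      using that \<tau> crude_const_pos[OF type_gt[of i]]
      by (intro mult_left_mono add_left_mono divide_right_mono) auto
    from order_trans[OF sq_bessel_kernel_le_linear[OF type_gt \<tau> that(1,3)] this]
    show ?thesis by (simp add: c_def mult_ac)
  qed
  show ?thesis
  proof
    fix x y :: "real ^ 'd" assume x: "x \<in> pos_orthant" and y: "y \<in> pos_orthant" and U: "\<And>i. x $ i \<le> U"
    have xV: "x $ i \<le> V" "x $ i \<ge> 0" "(exp (- t) *\<^sub>R y) $ i \<ge> 0" for i
      using U[of i] x y by (auto simp: V_def pos_orthant_def less_imp_le)
    have "laguerre_kernel \<alpha> t x y = exp (coord_sum x) * heat \<tau> x (exp (- t) *\<^sub>R y)"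
      using t x y by (simp add: laguerre_kernel_conv_bessel_heat \<tau>_def)
    also have "... \<le> exp (\<Sum>i\<in>(UNIV :: 'd set). V) * (\<Prod>i\<in>UNIV. \<tau> powr (- (\<alpha> $ i + 1)) * c i)"
      unfolding bessel_heat_def
    proof (intro mult_mono prod_mono conjI)
      show "exp (coord_sum x) \<le> exp (\<Sum>i\<in>(UNIV :: 'd set). V)"
        unfolding coord_sum_def exp_le_cancel_iff using xV by (intro sum_mono) auto
    qed (use xV K in \<open>blast intro: sq_bessel_kernel_nonneg prod_nonneg type_gt exp_ge_zero\<close>)+
    finally show "laguerre_kernel \<alpha> t x y \<le> exp (\<Sum>i\<in>(UNIV :: 'd set). V) * (\<Prod>i\<in>UNIV. \<tau> powr (- (\<alpha> $ i + 1)) * c i)" .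
  qed
qed

lemma laguerre_kernel_borel:
  assumes "t > 0" "x \<in> pos_orthant"
  shows "laguerre_kernel \<alpha> t x \<in> borel_measurable (laguerre_measure \<alpha>)"
proof -
  have "(\<lambda>y. exp (coord_sum x) * heat (1 - exp (- t)) x (exp (- t) *\<^sub>R y)) \<in> borel_measurable (laguerre_measure \<alpha>)"
    by (intro borel_measurable_imp_laguerre) measurable
  then show ?thesis
    by (subst measurable_cong[where g = "\<lambda>y. exp (coord_sum x) * heat (1 - exp (- t)) x (exp (- t) *\<^sub>R y)"])
       (auto simp: laguerre_kernel_conv_bessel_heat assms)
qed

lemma continuous_on_laguerre_semigroup:
  assumes t: "t > 0" and f: "integrable (laguerre_measure \<alpha>) f"
  shows "continuous_on pos_orthant (laguerre_semigroup \<alpha> t f)"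
proof (rule continuous_on_sequentiallyI)
  fix u :: "nat \<Rightarrow> real ^ 'd" and a assume u: "\<forall>n. u n \<in> pos_orthant" and a: "a \<in> pos_orthant" and lim: "u \<longlonglongrightarrow> a"
  obtain U where U: "\<And>n. norm (u n) \<le> U"
    using convergent_imp_Bseq[OF convergentI[OF lim]] by (auto simp: Bseq_def)
  have U': "u n $ i \<le> U" for n i
    using component_le_norm_cart[of "u n" i] U[of n] by linarith
  obtain C where C: "\<And>x y. x \<in> pos_orthant \<Longrightarrow> y \<in> pos_orthant \<Longrightarrow> (\<And>i. x $ i \<le> U) \<Longrightarrow> laguerre_kernel \<alpha> t x y \<le> C"
    using laguerre_kernel_bounded[OF t] by blast
  have [measurable]: "f \<in> borel_measurable (laguerre_measure \<alpha>)" using f by simp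
  have [measurable]: "laguerre_kernel \<alpha> t a \<in> borel_measurable (laguerre_measure \<alpha>)"
    "laguerre_kernel \<alpha> t (u n) \<in> borel_measurable (laguerre_measure \<alpha>)" for n
    using laguerre_kernel_borel[OF t] u a by auto
  show "(\<lambda>n. laguerre_semigroup \<alpha> t f (u n)) \<longlonglongrightarrow> laguerre_semigroup \<alpha> t f a"
    unfolding laguerre_semigroup_def
  proof (rule integral_dominated_convergence[where w = "\<lambda>y. C * norm (f y)"])
    show "(\<lambda>y. complex_of_real (laguerre_kernel \<alpha> t a y) * f y) \<in> borel_measurable (laguerre_measure \<alpha>)"
      by measurable
    show "(\<lambda>y. complex_of_real (laguerre_kernel \<alpha> t (u n) y) * f y) \<in> borel_measurable (laguerre_measure \<alpha>)" for n
      by measurable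
    show "integrable (laguerre_measure \<alpha>) (\<lambda>y. C * norm (f y))" using f by simp
    show "AE y in laguerre_measure \<alpha>. norm (complex_of_real (laguerre_kernel \<alpha> t (u n) y) * f y) \<le> C * norm (f y)" for n
      using C[of "u n"] U' u laguerre_kernel_nonneg[OF t]
      by (intro AE_I2) (auto simp: norm_mult intro!: mult_right_mono)
    show "AE y in laguerre_measure \<alpha>. (\<lambda>n. complex_of_real (laguerre_kernel \<alpha> t (u n) y) * f y) \<longlonglongrightarrow> complex_of_real (laguerre_kernel \<alpha> t a y) * f y"
    proof (intro AE_I2 tendsto_mult tendsto_const tendsto_of_real)
      fix y assume "y \<in> space (laguerre_measure \<alpha>)"
      then have y: "y \<in> pos_orthant" by simp
      have "continuous_on UNIV (\<lambda>x. exp (coord_sum x) * heat (1 - exp (- t)) x (exp (- t) *\<^sub>R y))"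
        unfolding coord_sum_def bessel_heat_def by (intro continuous_intros type_gt)
      then have "(\<lambda>n. exp (coord_sum (u n)) * heat (1 - exp (- t)) (u n) (exp (- t) *\<^sub>R y))
          \<longlonglongrightarrow> exp (coord_sum a) * heat (1 - exp (- t)) a (exp (- t) *\<^sub>R y)"
        by (rule continuous_on_tendsto_compose[OF _ lim]) auto
      then show "(\<lambda>n. laguerre_kernel \<alpha> t (u n) y) \<longlonglongrightarrow> laguerre_kernel \<alpha> t a y"
        using u a y t by (simp add: laguerre_kernel_conv_bessel_heat)
    qed
  qed
qed

lemma open_laguerre_semigroup_superlevel:
  assumes t: "t > 0" and f: "integrable (laguerre_measure \<alpha>) f"
  shows "open {x \<in> pos_orthant. norm (laguerre_semigroup \<alpha> t f x) > r}"
proof -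
  have "continuous_on pos_orthant (\<lambda>x. norm (laguerre_semigroup \<alpha> t f x))"
    using continuous_on_laguerre_semigroup[OF assms] by (rule continuous_on_norm)
  then have "open ((\<lambda>x. norm (laguerre_semigroup \<alpha> t f x)) -` {r<..} \<inter> pos_orthant)"
    using continuous_on_open_vimage[OF open_pos_orthant] open_greaterThan by blast
  also have "(\<lambda>x. norm (laguerre_semigroup \<alpha> t f x)) -` {r<..} \<inter> pos_orthant = {x \<in> pos_orthant. norm (laguerre_semigroup \<alpha> t f x) > r}"
    by auto
  finally show ?thesis .
qed

definition pos_semigroup :: "(real ^ 'd \<Rightarrow> ennreal) \<Rightarrow> real \<Rightarrow> real ^ 'd \<Rightarrow> ennreal" where
  "pos_semigroup g t x = (\<integral>\<^sup>+y. ext_kernel t x y * g y \<partial>\<mu>)"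

lemma norm_laguerre_semigroup_le:
  assumes t: "t > 0" and x: "x \<in> pos_orthant" and f: "f \<in> borel_measurable (laguerre_measure \<alpha>)"
    and g [measurable]: "g \<in> borel_measurable borel" and fg: "AE y in laguerre_measure \<alpha>. ennreal (norm (f y)) = g y"
  shows "ennreal (norm (laguerre_semigroup \<alpha> t f x)) \<le> pos_semigroup g t x"
proof (cases "integrable (laguerre_measure \<alpha>) (\<lambda>y. complex_of_real (laguerre_kernel \<alpha> t x y) * f y)")
  case True
  then have "ennreal (norm (laguerre_semigroup \<alpha> t f x)) \<le> (\<integral>\<^sup>+y. ennreal (norm (complex_of_real (laguerre_kernel \<alpha> t x y) * f y)) \<partial>laguerre_measure \<alpha>)"
    unfolding laguerre_semigroup_def by (rule integral_norm_bound_ennreal)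
  also have "... = (\<integral>\<^sup>+y. ext_kernel t x y * g y \<partial>laguerre_measure \<alpha>)"
  proof (rule nn_integral_cong_AE, rule AE_mp[OF fg], intro AE_I2 impI)
    fix y assume "y \<in> space (laguerre_measure \<alpha>)" and e: "ennreal (norm (f y)) = g y"
    then have y: "y \<in> pos_orthant" by simp
    show "ennreal (norm (complex_of_real (laguerre_kernel \<alpha> t x y) * f y)) = ext_kernel t x y * g y"
      using t x y laguerre_kernel_nonneg[OF t x y] by (simp add: norm_mult ext_kernel_eq ennreal_mult' flip: e)
  qed
  also have "... = pos_semigroup g t x"
    unfolding pos_semigroup_def by (rule nn_integral_laguerre_measure) measurable
  finally show ?thesis .
qed (simp add: laguerre_semigroup_def not_integrable_integral_eq)

section \<open>The local part of the maximal operator\<close>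

abbreviation half_mass :: ennreal where
  "half_mass \<equiv> \<integral>\<^sup>+x. ennreal (exp (- (coord_sum x / 2))) \<partial>\<nu>"

lemma half_mass_finite:
  "half_mass < \<infinity>"
proof -
  have "half_mass
    = (\<integral>\<^sup>+x. (\<Prod>i\<in>UNIV. ennreal (exp (- (1 / 2 * x $ i)))) \<partial>\<nu>)"
    by (intro nn_integral_cong)
      (simp add: prod_ennreal coord_sum_def sum_divide_distrib flip: exp_sum sum_negf)
  also have "... = (\<Prod>i\<in>UNIV. \<integral>\<^sup>+v. power_weight (\<alpha> $ i) v * ennreal (exp (- (1 / 2 * v))) \<partial>lborel)"
    by (rule nn_integral_power_measure_prod) measurable
  also have "... = (\<Prod>i\<in>UNIV. ennreal (Gamma (\<alpha> $ i + 1) * (1 / 2) powr (- (\<alpha> $ i + 1))))"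
  proof (intro prod.cong refl)
    fix i
    have "(\<integral>\<^sup>+v. power_weight (\<alpha> $ i) v * ennreal (exp (- (1 / 2 * v))) \<partial>lborel)
      = (\<integral>\<^sup>+v. ennreal (indicator {0<..} v * (v powr (\<alpha> $ i + 1 - 1) * exp (- (1 / 2 * v)))) \<partial>lborel)"
      by (intro nn_integral_cong) (simp add: mult.assoc flip: ennreal_mult')
    also have "... = ennreal (Gamma (\<alpha> $ i + 1) * (1 / 2) powr (- (\<alpha> $ i + 1)))"
      using type_gt[of i] by (intro nn_integral_Gamma_scaled) auto
    finally show "(\<integral>\<^sup>+v. power_weight (\<alpha> $ i) v * ennreal (exp (- (1 / 2 * v))) \<partial>lborel)
      = ennreal (Gamma (\<alpha> $ i + 1) * (1 / 2) powr (- (\<alpha> $ i + 1)))" .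
  qed
  also have "... < \<infinity>"
    by (auto simp: ennreal_prod_eq_top less_top[symmetric])
  finally show ?thesis .
qed

lemma emeasure_laguerre_tail:
  "emeasure \<mu> {x \<in> pos_orthant. coord_sum x > 2 * R}
    \<le> ennreal (exp (- R)) * half_mass"
proof -
  have "emeasure \<mu> {x \<in> pos_orthant. coord_sum x > 2 * R}
    = (\<integral>\<^sup>+x. indicator {x \<in> pos_orthant. coord_sum x > 2 * R} x \<partial>\<mu>)"
    by (intro nn_integral_indicator[symmetric]) simp
  also have "... = (\<integral>\<^sup>+x. ennreal (exp (- coord_sum x)) * indicator {x \<in> pos_orthant. coord_sum x > 2 * R} x \<partial>\<nu>)"
    by (rule nn_integral_borel_laguerre) measurable
  also have "... \<le> (\<integral>\<^sup>+x. ennreal (exp (- R)) * ennreal (exp (- (coord_sum x / 2))) \<partial>\<nu>)"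
    by (intro nn_integral_mono)
       (auto simp: indicator_def simp flip: ennreal_mult' exp_add intro!: ennreal_leI)
  also have "... = ennreal (exp (- R)) * half_mass"
    by (rule nn_integral_cmult) measurable
  finally show ?thesis .
qed

lemma emeasure_laguerre_finite: "emeasure \<mu> UNIV < \<infinity>"
proof -
  have "emeasure \<mu> UNIV = (\<integral>\<^sup>+x. 1 \<partial>\<mu>)"
    by simp
  also have "... = (\<integral>\<^sup>+x. ennreal (exp (- coord_sum x)) * 1 \<partial>\<nu>)"
    by (rule nn_integral_borel_laguerre) measurable
  also have "... \<le> half_mass"
  proof (rule nn_integral_mono_AE, rule AE_mp[OF AE_power_measure], intro AE_I2 impI)
    fix x :: "real ^ 'd" assume "x \<in> pos_orthant"
    from coord_sum_pos[OF this] show "ennreal (exp (- coord_sum x)) * 1 \<le> ennreal (exp (- (coord_sum x / 2)))"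
      by (auto intro!: ennreal_leI)
  qed
  also have "... < \<infinity>" by (rule half_mass_finite)
  finally show ?thesis .
qed

lemma sigma_finite_borel_laguerre: "sigma_finite_measure \<mu>"
proof -
  interpret finite_measure \<mu>
    using emeasure_laguerre_finite by (intro finite_measureI) simp
  show ?thesis ..
qed

lemma sigma_finite_power_measure: "sigma_finite_measure \<nu>"
  unfolding power_measure_def
  by (subst sigma_finite_measure.sigma_finite_iff_density_finite[OF sigma_finite_lborel]) (auto simp: ennreal_prod_eq_top)

lemma pos_semigroup_measurable [measurable]:
  assumes [measurable]: "g \<in> borel_measurable borel"
  shows "pos_semigroup g t \<in> borel_measurable borel"
proof -
  interpret sigma_finite_measure \<mu> by (rule sigma_finite_borel_laguerre)
  show ?thesis unfolding pos_semigroup_def by measurable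
qed

lemma pos_semigroup_add:
  assumes s: "s > 0" and t: "t > 0" and g [measurable]: "g \<in> borel_measurable borel"
  shows "(\<integral>\<^sup>+y. ext_kernel s x y * pos_semigroup g t y \<partial>\<mu>) = pos_semigroup g (s + t) x"
proof -
  interpret sigma_finite_measure \<mu> by (rule sigma_finite_borel_laguerre)
  interpret P: pair_sigma_finite \<mu> \<mu> by unfold_locales
  have "(\<integral>\<^sup>+y. ext_kernel s x y * pos_semigroup g t y \<partial>\<mu>)
     = (\<integral>\<^sup>+y. \<integral>\<^sup>+z. ext_kernel s x y * (ext_kernel t y z * g z) \<partial>\<mu> \<partial>\<mu>)"
    unfolding pos_semigroup_def by (intro nn_integral_cong nn_integral_cmult[symmetric]) measurable
  also have "... = (\<integral>\<^sup>+z. \<integral>\<^sup>+y. ext_kernel s x y * (ext_kernel t y z * g z) \<partial>\<mu> \<partial>\<mu>)"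
    by (rule P.Fubini'[symmetric]) measurable
  also have "... = (\<integral>\<^sup>+z. (\<integral>\<^sup>+y. ext_kernel s x y * ext_kernel t y z \<partial>\<mu>) * g z \<partial>\<mu>)"
    unfolding mult.assoc[symmetric] by (intro nn_integral_cong nn_integral_multc) measurable
  also have "... = pos_semigroup g (s + t) x"
    by (simp add: ext_kernel_Chapman_Kolmogorov s t pos_semigroup_def)
  finally show ?thesis .
qed

text \<open>Hopf's theorem for the single operator \<open>T\<^sub>h\<close>. At least a fixed proportion of the first \<open>m + k\<close>
iterates have their time \<open>j h\<close> between \<open>5t\<close> and \<open>6t\<close>, where they dominate \<open>T\<^sub>t g\<close>. The constant does
not depend on \<open>h\<close>. Locality forces \<open>t \<le> 1/100\<close>, so finitely many averages suffice for each \<open>h\<close>.\<close>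

lemma local_maximal_weak_type:
  assumes g [measurable]: "g \<in> borel_measurable borel" and fin: "integral\<^sup>N \<mu> g < \<infinity>"
    and h: "h > 0" and r: "r > 0"
  obtains E where "E \<in> sets borel"
    and "\<And>x t. x \<in> pos_orthant \<Longrightarrow> t \<ge> h \<Longrightarrow> t * (1 + coord_sum x) \<le> 1 / 100 \<Longrightarrow> pos_semigroup g t x > ennreal r \<Longrightarrow> x \<in> E"
    and "emeasure \<mu> E \<le> ennreal (16 * harnack_const / r) * integral\<^sup>N \<mu> g"
proof -
  interpret sigma_finite_measure \<mu> by (rule sigma_finite_borel_laguerre)
  define A where "A = rec_nat (\<lambda>x. 0) (\<lambda>_ B x. g x + (\<integral>\<^sup>+y. ext_kernel h x y * B y \<partial>\<mu>))"
  have A0: "A 0 x = 0" and A_Suc: "A (Suc n) x = g x + (\<integral>\<^sup>+y. ext_kernel h x y * A n y \<partial>\<mu>)" for n x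
    by (simp_all add: A_def)
  have A_eq: "A (Suc n) x = g x + (\<Sum>j=1..n. pos_semigroup g (real j * h) x)" for n x
  proof (induction n arbitrary: x)
    case 0
    show ?case by (simp add: A_Suc A0)
  next
    case (Suc n)
    have "A (Suc (Suc n)) x = g x + (\<integral>\<^sup>+y. ext_kernel h x y * (g y + (\<Sum>j=1..n. pos_semigroup g (real j * h) y)) \<partial>\<mu>)"
      by (subst A_Suc) (simp add: Suc)
    also have "(\<integral>\<^sup>+y. ext_kernel h x y * (g y + (\<Sum>j=1..n. pos_semigroup g (real j * h) y)) \<partial>\<mu>)
       = pos_semigroup g h x + (\<Sum>j=1..n. \<integral>\<^sup>+y. ext_kernel h x y * pos_semigroup g (real j * h) y \<partial>\<mu>)"
      unfolding distrib_left sum_distrib_left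
      by (subst nn_integral_add, measurable, subst nn_integral_sum, measurable, simp add: pos_semigroup_def)
    also have "(\<Sum>j=1..n. \<integral>\<^sup>+y. ext_kernel h x y * pos_semigroup g (real j * h) y \<partial>\<mu>)
       = (\<Sum>j=1..n. pos_semigroup g (real (Suc j) * h) x)"
      using h by (intro sum.cong refl) (simp add: pos_semigroup_add distrib_right)
    also have "... = (\<Sum>j=2..Suc n. pos_semigroup g (real j * h) x)"
      using sum.shift_bounds_cl_Suc_ivl[of "\<lambda>j. pos_semigroup g (real j * h) x" 1 n] by (simp add: numeral_2_eq_2)
    also have "pos_semigroup g h x + ... = (\<Sum>j=1..Suc n. pos_semigroup g (real j * h) x)"
      by (subst (2) sum.atLeast_Suc_atMost) (simp_all add: numeral_2_eq_2)
    finally show ?case .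
  qed
  define l where "l = r / (16 * harnack_const)"
  have l: "l > 0" using r harnack_const_pos by (simp add: l_def)
  define N where "N = nat \<lceil>1 / h\<rceil>"
  define E where "E = {x \<in> space \<mu>. \<exists>n\<le>N. A n x > of_nat n * ennreal l}"
  have ext_kernel_int: "(\<integral>\<^sup>+y. ext_kernel h x y \<partial>\<mu>) \<le> 1" "(\<integral>\<^sup>+y. ext_kernel h y x \<partial>\<mu>) \<le> 1" for x
    using nn_integral_ext_kernel_le[OF h, of x] by (simp_all add: ext_kernel_commute[OF h, of _ x])
  note hopf = hopf_maximal_ergodic[OF sigma_finite_borel_laguerre, of "ext_kernel h" g A l N, OF _ ext_kernel_int(1) ext_kernel_int(2) _ fin A0 A_Suc l, folded E_def]
  have E1: "E \<in> sets \<mu>" by (rule hopf) measurable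
  have E2: "ennreal l * emeasure \<mu> E \<le> integral\<^sup>N \<mu> g"
    by (rule hopf) measurable
  show ?thesis
  proof
    show "E \<in> sets borel" using E1 by simp
    have "emeasure \<mu> E = ennreal (1 / l) * (ennreal l * emeasure \<mu> E)"
      using l by (simp add: mult.assoc[symmetric] ennreal_mult'[symmetric])
    also have "... \<le> ennreal (1 / l) * integral\<^sup>N \<mu> g"
      by (intro mult_left_mono E2) auto
    finally show "emeasure \<mu> E \<le> ennreal (16 * harnack_const / r) * integral\<^sup>N \<mu> g"
      by (simp add: l_def)
    fix x t assume x: "x \<in> pos_orthant" and th: "t \<ge> h" and t: "t * (1 + coord_sum x) \<le> 1 / 100"
      and gt: "pos_semigroup g t x > ennreal r"
    have t0: "t > 0" using th h by simp
    have t100: "t \<le> 1 / 100"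
    proof -
      have "t * 1 \<le> t * (1 + coord_sum x)" using t0 coord_sum_pos[OF x] by (intro mult_left_mono) auto
      from order_trans[OF this t] show ?thesis by simp
    qed
    define q where "q = t / h"
    have q: "q \<ge> 1" "q * h = t" using th h by (auto simp: q_def)
    \<comment> \<open>The integers \<open>j\<close> with \<open>m \<le> j < m + k\<close> lie in \<open>{5q..6q}\<close>, and \<open>k \<ge> q/2\<close>.\<close>
    define m k where "m = nat \<lceil>5 * q\<rceil>" and "k = nat \<lfloor>q\<rfloor>"
    have m: "5 * q \<le> real m" "real m \<le> 5 * q + 1" "m \<ge> 1" using q unfolding m_def by linarith+
    have k: "real k \<le> q" "q \<le> 2 * real k" "k \<ge> 1"
    proof -
      have "\<lfloor>q\<rfloor> \<ge> 1" using q(1) by simp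
      moreover from this have "real k = of_int \<lfloor>q\<rfloor>" by (simp add: k_def)
      ultimately show "real k \<le> q" "q \<le> 2 * real k" "k \<ge> 1" unfolding k_def by linarith+
    qed
    have each: "ennreal (r / harnack_const) \<le> pos_semigroup g (real j * h) x" if j: "j \<in> {m..<m+k}" for j
    proof -
      have j': "5 * q \<le> real j" "real j \<le> 6 * q" using j m k by auto
      have s: "5 * t \<le> real j * h" "real j * h \<le> 6 * t"
        using mult_right_mono[OF j'(1), of h] mult_right_mono[OF j'(2), of h] h q(2) by (auto simp: mult.assoc)
      have "ext_kernel t x y \<le> ennreal harnack_const * ext_kernel (real j * h) x y" for y
      proof (cases "y \<in> pos_orthant")
        case True
        have "exp (coord_sum x) * heat (1 - exp (- t)) x (exp (- t) *\<^sub>R y)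
          \<le> exp (coord_sum x) * (harnack_const * heat (1 - exp (- (real j * h))) x (exp (- (real j * h)) *\<^sub>R y))"
          by (intro mult_left_mono bessel_heat_local_comparison t0 t s x True) auto
        then show ?thesis
          using True x harnack_const_pos by (auto simp: ext_kernel_def mult_ac simp flip: ennreal_mult' intro!: ennreal_leI)
      qed (simp add: ext_kernel_def)
      then have "pos_semigroup g t x \<le> (\<integral>\<^sup>+y. ennreal harnack_const * ext_kernel (real j * h) x y * g y \<partial>\<mu>)"
        unfolding pos_semigroup_def by (intro nn_integral_mono mult_right_mono) auto
      also have "... = ennreal harnack_const * pos_semigroup g (real j * h) x"
        unfolding pos_semigroup_def mult.assoc by (rule nn_integral_cmult) measurable
      finally have "ennreal r \<le> ennreal harnack_const * pos_semigroup g (real j * h) x" using gt by order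
      then have "ennreal (1 / harnack_const) * ennreal r \<le> ennreal (1 / harnack_const) * (ennreal harnack_const * pos_semigroup g (real j * h) x)"
        by (intro mult_left_mono) auto
      then show ?thesis
        using harnack_const_pos r by (simp add: mult.assoc[symmetric] ennreal_mult'[symmetric])
    qed
    have "ennreal (real k * (r / harnack_const)) = (\<Sum>j\<in>{m..<m+k}. ennreal (r / harnack_const))"
    proof -
      have "(\<Sum>j\<in>{m..<m+k}. ennreal (r / harnack_const)) = of_nat k * ennreal (r / harnack_const)" by simp
      moreover have "ennreal (real k * (r / harnack_const)) = ennreal (real k) * ennreal (r / harnack_const)"
        by (rule ennreal_mult') simp
      ultimately show ?thesis by (simp only: ennreal_of_nat_eq_real_of_nat)
    qed
    also have "... \<le> (\<Sum>j\<in>{m..<m+k}. pos_semigroup g (real j * h) x)" by (intro sum_mono each)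
    also have "... \<le> (\<Sum>j=1..m+k-1. pos_semigroup g (real j * h) x)"
      using m by (intro sum_mono2) auto
    also have "... \<le> A (Suc (m + k - 1)) x" unfolding A_eq by (simp add: add_increasing)
    finally have Age: "ennreal (real k * (r / harnack_const)) \<le> A (m + k) x" using m by simp
    have mk: "real (m + k) < 16 * real k" using m k q by simp
    have "of_nat (m + k) * ennreal l = ennreal (real (m + k) * l)"
      unfolding ennreal_of_nat_eq_real_of_nat by (rule ennreal_mult'[symmetric]) simp
    also have "... < ennreal (16 * real k * l)"
      using l mk k by (intro ennreal_lessI mult_strict_right_mono) auto
    also have "16 * real k * l = real k * (r / harnack_const)" by (simp add: l_def)
    finally have "of_nat (m + k) * ennreal l < A (m + k) x" using Age by order
    moreover have "m + k \<le> N"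
    proof -
      have "real (m + k) \<le> 7 * q" using m k q by simp
      also have "... = 7 * t / h" by (simp add: q_def)
      also have "... \<le> 1 / h" using t100 h by (intro divide_right_mono) auto
      finally show ?thesis unfolding N_def by linarith
    qed
    ultimately show "x \<in> E" unfolding E_def by auto
  qed
qed

section \<open>The nonlocal part of the maximal operator\<close>

definition time_scale :: "real \<Rightarrow> nat \<Rightarrow> real" where
  "time_scale R j = 4 ^ j / (100 * R)"

abbreviation ray_term :: "real \<Rightarrow> real ^ 'd \<Rightarrow> real ^ 'd \<Rightarrow> nat \<Rightarrow> nat \<Rightarrow> ennreal" where
  "ray_term R y v j k \<equiv> ennreal (heat (time_scale R j) y (((real k)\<^sup>2 * time_scale R j / coord_sum v) *\<^sub>R v))"

definition radii :: "real \<Rightarrow> nat \<Rightarrow> nat set" where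
  "radii R j = {1..nat \<lfloor>sqrt (8 * R / time_scale R j)\<rfloor>}"

text \<open>Up to a constant, a majorant for the supremum of \<open>heat \<tau> y w\<close> over \<open>w\<close> on the ray through \<open>v\<close> and over
\<open>1/(800 R) \<le> \<tau> \<le> 1\<close>, for \<open>|y| \<le> 2R\<close>. At the time \<open>\<tau>\<^sub>j = time_scale R j\<close> the sample points have \<open>|w| = k\<^sup>2 \<tau>\<^sub>j\<close>,
which is spacing \<open>sqrt \<tau>\<^sub>j\<close> for \<open>sqrt |w|\<close>, and they stop at \<open>|w| = 8R\<close>.\<close>

definition ray_kernel :: "real \<Rightarrow> real ^ 'd \<Rightarrow> real ^ 'd \<Rightarrow> ennreal" where
  "ray_kernel R y v = (\<Sum>j. \<Sum>k\<in>radii R j. ray_term R y v j k)"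

lemma time_scale_pos: "R > 0 \<Longrightarrow> time_scale R j > 0"
  by (simp add: time_scale_def)

lemma ray_kernel_measurable [measurable (raw)]:
  assumes [measurable]: "f \<in> borel_measurable M" "g \<in> borel_measurable M"
  shows "(\<lambda>z. ray_kernel R (f z) (g z)) \<in> borel_measurable M"
  unfolding ray_kernel_def by measurable

text \<open>Each kernel contributes one, and there are at most \<open>sqrt (8R/\<tau>\<^sub>j) = sqrt 800 * R / 2\<^sup>j\<close> of them at scale \<open>j\<close>;
the decay in \<open>j\<close> makes the sum over all scales comparable to the first one.\<close>

lemma nn_integral_ray_kernel_le:
  assumes R: "R > 0" and v: "v \<in> pos_orthant"
  shows "(\<integral>\<^sup>+y. ray_kernel R y v \<partial>\<nu>) \<le> ennreal (60 * R)"
proof -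
  have "(\<integral>\<^sup>+y. ray_kernel R y v \<partial>\<nu>)
    = (\<Sum>j. \<Sum>k\<in>radii R j. \<integral>\<^sup>+y. ray_term R y v j k \<partial>\<nu>)"
    unfolding ray_kernel_def
    by (rule trans[OF nn_integral_suminf]) (auto intro!: suminf_cong nn_integral_sum)
  also have "... = (\<Sum>j. \<Sum>k\<in>radii R j. 1)"
    using R v coord_sum_pos[OF v]
    by (intro suminf_cong sum.cong refl nn_integral_bessel_heat time_scale_pos pos_orthant_scaleR)
       (auto simp: radii_def time_scale_pos)
  also have "... \<le> (\<Sum>j. ennreal (30 * R * (1 / 2) ^ j))"
  proof (intro suminf_le summableI)
    fix j
    have sq: "sqrt (8 * R / time_scale R j) = sqrt 800 * R * (1 / 2) ^ j"
    proof (rule real_sqrt_unique)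
      have "(2 :: real) ^ (j * 2) = 4 ^ j" by (simp add: power_mult mult.commute[of j] )
      then show "(sqrt 800 * R * (1 / 2) ^ j)\<^sup>2 = 8 * R / time_scale R j"
        using R by (simp add: time_scale_def power_mult_distrib power_divide power2_eq_square[of R] flip: power_mult)
    qed (use R in auto)
    have "(\<Sum>k\<in>radii R j. 1 :: ennreal) = ennreal (real (card (radii R j)))"
      by (simp add: ennreal_of_nat_eq_real_of_nat)
    also have "... \<le> ennreal (sqrt (8 * R / time_scale R j))"
      using R by (intro ennreal_leI) (simp add: radii_def time_scale_def)
    also have "... \<le> ennreal (30 * R * (1 / 2) ^ j)"
      unfolding sq using R by (intro ennreal_leI mult_right_mono real_le_lsqrt) auto
    finally show "(\<Sum>k\<in>radii R j. 1 :: ennreal) \<le> ennreal (30 * R * (1 / 2) ^ j)" .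
  qed
  also have "... = ennreal (30 * R * 2)"
    using R geometric_sums[of "1 / 2 :: real"] by (intro suminf_ennreal_eq sums_mult) auto
  finally show ?thesis by simp
qed

text \<open>First bring \<open>|w|\<close> between \<open>\<tau>\<^sub>j\<close> and \<open>8R\<close> (monotonicity far out and near the origin), then round
\<open>sqrt (|w|/\<tau>\<^sub>j)\<close> down to an integer \<open>k\<close> and pass from \<open>\<tau>\<close> to \<open>\<tau>\<^sub>j\<close> by the Harnack inequality.\<close>

lemma bessel_heat_le_ray_kernel:
  assumes R: "R \<ge> 1" "R \<ge> real CARD('d)" and y: "y \<in> pos_orthant" "coord_sum y \<le> 2 * R"
    and v: "v \<in> pos_orthant" and \<sigma>: "\<sigma> > 0" and \<tau>: "1 / (800 * R) \<le> \<tau>" "\<tau> \<le> 1"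
  shows "ennreal (heat \<tau> y (\<sigma> *\<^sub>R v)) \<le> ennreal (exp 8 * harnack_const) * ray_kernel R y v"
proof -
  have \<tau>0: "\<tau> > 0" using \<tau>(1) R by (intro less_le_trans[OF _ \<tau>(1)]) auto
  define V where "V = coord_sum v"
  have V: "V > 0" using coord_sum_pos[OF v] by (simp add: V_def)
  have ex: "\<exists>j. 2 * \<tau> \<le> time_scale R j"
  proof -
    obtain j where "200 * R * \<tau> < 4 ^ j" using real_arch_pow[of 4 "200 * R * \<tau>"] by auto
    then show ?thesis using R by (intro exI[of _ j]) (simp add: time_scale_def field_simps)
  qed
  \<comment> \<open>The first scale above \<open>2\<tau>\<close>; consecutive scales differ by a factor 4, and the scale 0 is \<open>1/(100 R)\<close>.\<close>
  define j where "j = (LEAST j. 2 * \<tau> \<le> time_scale R j)"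
  define \<tau>' where "\<tau>' = time_scale R j"
  have lo: "2 * \<tau> \<le> \<tau>'" unfolding \<tau>'_def j_def using ex by (rule LeastI_ex)
  have hi: "\<tau>' \<le> 8 * \<tau>"
  proof (cases j)
    case 0
    then show ?thesis using \<tau>(1) R by (simp add: \<tau>'_def time_scale_def field_simps)
  next
    case (Suc i)
    then have "\<not> 2 * \<tau> \<le> time_scale R i" using not_less_Least[of i "\<lambda>j. 2 * \<tau> \<le> time_scale R j"] by (simp add: j_def)
    moreover have "\<tau>' = 4 * time_scale R i" by (simp add: \<tau>'_def Suc time_scale_def)
    ultimately show ?thesis by simp
  qed
  have \<tau>': "\<tau>' > 0" using lo \<tau>0 by simp
  define W where "W = 8 * R"
  have W: "W > 0" "\<tau>' \<le> W" using R \<tau> hi by (auto simp: W_def)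
  define \<omega> where "\<omega> = \<sigma> * V"
  have \<omega>: "\<omega> > 0" "\<sigma> = \<omega> / V" using \<sigma> V by (auto simp: \<omega>_def)
  obtain \<rho> where \<rho>: "\<tau>' \<le> \<rho>" "\<rho> \<le> W"
    and 1: "heat \<tau> y (\<sigma> *\<^sub>R v) \<le> exp 8 * heat \<tau> y ((\<rho> / V) *\<^sub>R v)"
  proof -
    have \<sigma>v: "\<sigma> *\<^sub>R v \<in> pos_orthant" "coord_sum (\<sigma> *\<^sub>R v) = \<omega>"
      using v \<sigma> by (auto simp: pos_orthant_scaleR coord_sum_scaleR \<omega>_def V_def)
    have le8: "b \<le> exp 8 * b" if "b \<ge> 0" for b :: real
      using that mult_right_mono[of 1 "exp 8" b] by simp
    have nn: "heat \<tau> y (s *\<^sub>R v) \<ge> 0" if "s > 0" for s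
      using that y v by (intro bessel_heat_nonneg' pos_orthant_scaleR)
    consider "\<omega> > W" | "\<omega> < \<tau>'" | "\<tau>' \<le> \<omega>" "\<omega> \<le> W" by linarith
    then show ?thesis
    proof cases
      case 1
      have "heat \<tau> y (\<sigma> *\<^sub>R v) \<le> heat \<tau> y ((W / \<omega>) *\<^sub>R (\<sigma> *\<^sub>R v))"
      proof (rule bessel_heat_far[OF \<tau>0 _ _ _ _ y(1) \<sigma>v(1)])
        have "real CARD('d) * \<tau> \<le> R * 1" using R \<tau> \<tau>0 by (intro mult_mono) auto
        then show "2 * real CARD('d) * \<tau> \<le> W / \<omega> * coord_sum (\<sigma> *\<^sub>R v)"
          using \<omega> R unfolding \<sigma>v(2) by (simp add: W_def mult_ac)
      qed (use 1 W \<omega> y \<sigma>v(2) in \<open>auto simp: W_def\<close>)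
      also have "(W / \<omega>) *\<^sub>R (\<sigma> *\<^sub>R v) = (W / V) *\<^sub>R v" using \<omega> by simp
      finally show ?thesis using W nn[of "W / V"] V
        by (intro that[of W]) (auto intro: order_trans[OF _ le8])
    next
      case 2
      have "heat \<tau> y (\<sigma> *\<^sub>R v) \<le> exp ((\<tau>' / \<omega> - 1) * coord_sum (\<sigma> *\<^sub>R v) / \<tau>) * heat \<tau> y ((\<tau>' / \<omega>) *\<^sub>R (\<sigma> *\<^sub>R v))"
        using 2 \<omega> by (intro bessel_heat_le_right \<tau>0 y \<sigma>v) (simp add: field_simps)
      also have "(\<tau>' / \<omega>) *\<^sub>R (\<sigma> *\<^sub>R v) = (\<tau>' / V) *\<^sub>R v" using \<omega> by simp
      also have "(\<tau>' / \<omega> - 1) * coord_sum (\<sigma> *\<^sub>R v) / \<tau> = (\<tau>' - \<omega>) / \<tau>"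
      proof -
        have "(\<tau>' / \<omega> - 1) * \<omega> = \<tau>' - \<omega>" using \<omega> by (simp add: left_diff_distrib)
        then show ?thesis unfolding \<sigma>v(2) by simp
      qed
      also have "exp ((\<tau>' - \<omega>) / \<tau>) * heat \<tau> y ((\<tau>' / V) *\<^sub>R v) \<le> exp 8 * heat \<tau> y ((\<tau>' / V) *\<^sub>R v)"
        using hi \<omega> \<tau>0 V \<tau>' by (intro mult_right_mono nn) (auto simp: field_simps)
      finally show ?thesis using W by (intro that[of \<tau>']) auto
    next
      case 3
      then show ?thesis using le8[OF nn[OF \<sigma>]] by (intro that[of \<omega>]) (auto simp flip: \<omega>(2))
    qed
  qed
  have \<rho>0: "\<rho> > 0" using \<rho>(1) \<tau>' by simp
  define z where "z = sqrt (\<rho> / \<tau>')"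
  have z: "z \<ge> 1" "\<rho> = z\<^sup>2 * \<tau>'" using \<rho>(1) \<tau>' \<rho>0 by (auto simp: z_def field_simps)
  define k where "k = nat \<lfloor>z\<rfloor>"
  have k: "real k \<le> z" "z \<le> 2 * real k" "z - real k \<le> 1" "k \<ge> 1"
  proof -
    have "\<lfloor>z\<rfloor> \<ge> 1" using z(1) by simp
    moreover from this have "real k = of_int \<lfloor>z\<rfloor>" by (simp add: k_def)
    ultimately show "real k \<le> z" "z \<le> 2 * real k" "z - real k \<le> 1" "k \<ge> 1" unfolding k_def by linarith+
  qed
  have k_in: "k \<in> radii R j"
  proof -
    have "z \<le> sqrt (8 * R / \<tau>')"
      unfolding z_def using \<rho>(2) \<tau>' by (intro real_sqrt_le_mono divide_right_mono) (auto simp: W_def)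
    then have "k \<le> nat \<lfloor>sqrt (8 * R / \<tau>')\<rfloor>" unfolding k_def by (intro nat_mono floor_mono)
    then show ?thesis using k(4) by (simp add: radii_def \<tau>'_def)
  qed
  define \<kappa> where "\<kappa> = (real k / z)\<^sup>2"
  have sk: "sqrt \<kappa> = real k / z" using z by (simp add: \<kappa>_def)
  have kz: "1 / 2 \<le> real k / z" "real k / z \<le> 1" using k z by (auto simp: field_simps)
  have \<kappa>: "1 / 4 \<le> \<kappa>" "\<kappa> \<le> 1"
    using power_mono[OF kz(1), of 2] power_mono[OF kz(2), of 2] z by (auto simp: \<kappa>_def power2_eq_square)
  have rv: "(\<rho> / V) *\<^sub>R v \<in> pos_orthant" "coord_sum ((\<rho> / V) *\<^sub>R v) = \<rho>"
    using v V \<rho>0 by (auto simp: pos_orthant_scaleR coord_sum_scaleR V_def)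
  have 2: "heat \<tau> y ((\<rho> / V) *\<^sub>R v) \<le> harnack_const * heat \<tau>' y (\<kappa> *\<^sub>R ((\<rho> / V) *\<^sub>R v))"
  proof (rule bessel_heat_near[OF \<tau>0 hi lo \<kappa> _ y(1) rv(1)])
    have "(1 - real k / z)\<^sup>2 * \<rho> = (z - real k)\<^sup>2 * \<tau>'"
    proof -
      have "(1 - real k / z) * z = z - real k" using z(1) by (simp add: field_simps)
      then have "(1 - real k / z)\<^sup>2 * z\<^sup>2 = (z - real k)\<^sup>2" by (simp flip: power_mult_distrib)
      then show ?thesis unfolding z(2) by (simp add: mult.assoc[symmetric])
    qed
    also have "... \<le> 1 * \<tau>'" using k \<tau>' by (intro mult_right_mono power_le_one) auto
    finally show "(1 - sqrt \<kappa>)\<^sup>2 * coord_sum ((\<rho> / V) *\<^sub>R v) \<le> \<tau>'" unfolding rv(2) sk by simp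
  qed
  have eq: "\<kappa> *\<^sub>R ((\<rho> / V) *\<^sub>R v) = ((real k)\<^sup>2 * time_scale R j / coord_sum v) *\<^sub>R v"
    using z by (simp add: \<kappa>_def z(2) \<tau>'_def V_def power_divide)
  define b where "b = heat \<tau>' y (((real k)\<^sup>2 * time_scale R j / coord_sum v) *\<^sub>R v)"
  have "heat \<tau> y (\<sigma> *\<^sub>R v) \<le> exp 8 * (harnack_const * b)"
    using order_trans[OF 1 mult_left_mono[OF 2, of "exp 8"]] unfolding eq b_def by simp
  then have "ennreal (heat \<tau> y (\<sigma> *\<^sub>R v)) \<le> ennreal (exp 8 * harnack_const * b)"
    by (intro ennreal_leI) (simp add: mult.assoc)
  also have "... = ennreal (exp 8 * harnack_const) * ennreal b"
    using harnack_const_pos by (intro ennreal_mult') auto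
  also have "ennreal b \<le> (\<Sum>k\<in>radii R j. ray_term R y v j k)"
    unfolding b_def \<tau>'_def using k_in by (intro member_le_sum) (auto simp: radii_def)
  also have "... \<le> ray_kernel R y v"
    unfolding ray_kernel_def
    using sum_le_suminf[of "\<lambda>j. \<Sum>k\<in>radii R j. ray_term R y v j k" "{j}"]
    by (simp add: summableI)
  finally show ?thesis by (simp add: mult_left_mono)
qed

end

text \<open>Along a ray the superlevel set is a half-line, and the weight decays exactly as the level function
grows, so that its mass is governed by the weight at the endpoint.\<close>

lemma nn_integral_exp_superlevel:
  fixes \<Gamma> :: ennreal
  assumes \<rho>: "\<rho> > 0" and r: "r > 0"
  shows "(\<integral>\<^sup>+s. indicator {s. ennreal r < ennreal (exp (s * \<rho>)) * \<Gamma>} s * ennreal (exp (- (s * \<rho>))) \<partial>lborel)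
    \<le> \<Gamma> * ennreal (1 / (r * \<rho>))"
proof (cases \<Gamma>)
  case (real \<gamma>)
  show ?thesis
  proof (cases "\<gamma> = 0")
    case False
    with real have \<gamma>: "\<gamma> > 0" by simp
    define a where "a = ln (r / \<gamma>) / \<rho>"
    have "indicator {s. ennreal r < ennreal (exp (s * \<rho>)) * \<Gamma>} s * ennreal (exp (- (s * \<rho>)))
        \<le> ennreal (exp (- (s * \<rho>))) * indicator {a..} s" for s
    proof (cases "ennreal r < ennreal (exp (s * \<rho>)) * \<Gamma>")
      case True
      then have "r < exp (s * \<rho>) * \<gamma>"
        using real r by (simp add: ennreal_less_iff flip: ennreal_mult')
      then have "r / \<gamma> < exp (s * \<rho>)" using \<gamma> by (simp add: field_simps)
      then have "ln (r / \<gamma>) < s * \<rho>" using r \<gamma> by (metis divide_pos_pos exp_less_cancel_iff exp_ln)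
      then have "a \<le> s" using \<rho> by (simp add: a_def field_simps)
      then show ?thesis by (simp add: indicator_def)
    qed simp
    then have "(\<integral>\<^sup>+s. indicator {s. ennreal r < ennreal (exp (s * \<rho>)) * \<Gamma>} s * ennreal (exp (- (s * \<rho>))) \<partial>lborel)
        \<le> (\<integral>\<^sup>+s. ennreal (exp (- (s * \<rho>))) * indicator {a..} s \<partial>lborel)"
      by (intro nn_integral_mono)
    also have "... = ennreal (0 - (- exp (- (a * \<rho>)) / \<rho>))"
    proof (rule nn_integral_FTC_atLeast)
      show "((\<lambda>s. - exp (- (s * \<rho>)) / \<rho>) has_real_derivative exp (- (s * \<rho>))) (at s)" for s
        using \<rho> by (auto intro!: derivative_eq_intros)
      have "LIM s at_top. s * \<rho> :> at_top"
        using \<rho> by (intro filterlim_at_top_mult_tendsto_pos[OF tendsto_const] filterlim_ident)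
      then have "((\<lambda>s. exp (- (s * \<rho>))) \<longlongrightarrow> 0) at_top"
        by (intro filterlim_compose[OF exp_at_bot]) (simp add: filterlim_uminus_at_top[symmetric] filterlim_uminus_at_bot)
      from tendsto_divide[OF tendsto_minus[OF this] tendsto_const, of \<rho>] \<rho>
      show "((\<lambda>s. - exp (- (s * \<rho>)) / \<rho>) \<longlongrightarrow> 0) at_top" by simp
    qed auto
    also have "exp (- (a * \<rho>)) = \<gamma> / r"
      using \<rho> r \<gamma> by (simp add: a_def exp_minus)
    also have "ennreal (0 - (- (\<gamma> / r) / \<rho>)) = \<Gamma> * ennreal (1 / (r * \<rho>))"
      using real \<rho> r by (simp add: flip: ennreal_mult')
    finally show ?thesis .
  qed (use real in simp)
next
  case top
  then show ?thesis using assms by (simp add: ennreal_top_mult)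
qed

lemma one_minus_exp_ge:
  assumes "a > 0" "t \<ge> a" shows "1 - exp (- t) \<ge> 1 / (1 / a + 1 :: real)"
proof -
  have "exp (- t) \<le> exp (- a)" using assms by simp
  also have "... \<le> 1 / (1 + a)"
    using exp_ge_add_one_self[of a] assms by (simp add: exp_minus field_simps)
  finally have "1 - exp (- t) \<ge> 1 - 1 / (1 + a)" by simp
  also have "1 - 1 / (1 + a) = 1 / (1 / a + 1)" using assms by (simp add: field_simps)
  finally show ?thesis .
qed

context laguerre_type
begin

lemma nn_integral_power_measure_dilate:
  assumes \<phi> [measurable]: "\<phi> \<in> borel_measurable borel" and s: "s > 0"
  shows "(\<integral>\<^sup>+x. \<phi> x \<partial>\<nu>) = ennreal (s powr hom_dim) * (\<integral>\<^sup>+y. \<phi> (s *\<^sub>R y) \<partial>\<nu>)"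
proof -
  define w where "w = (\<lambda>x :: real ^ 'd. \<Prod>i\<in>UNIV. power_weight (\<alpha> $ i) (x $ i))"
  have [measurable]: "w \<in> borel_measurable borel" unfolding w_def by measurable
  have ws: "w (s *\<^sub>R y) = ennreal (s powr (\<Sum>i\<in>UNIV. \<alpha> $ i)) * w y" for y
  proof -
    have "power_weight (\<alpha> $ i) (s * y $ i)
        = ennreal (s powr (\<alpha> $ i)) * power_weight (\<alpha> $ i) (y $ i)" for i
      using s by (cases "y $ i > 0") (auto simp: indicator_def zero_less_mult_iff powr_mult simp flip: ennreal_mult')
    moreover have "(\<Prod>i\<in>UNIV. ennreal (s powr (\<alpha> $ i))) = ennreal (s powr (\<Sum>i\<in>UNIV. \<alpha> $ i))"
      using s by (simp add: prod_ennreal powr_sum)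
    ultimately show ?thesis by (simp add: w_def prod.distrib)
  qed
  have "(\<integral>\<^sup>+x. \<phi> x \<partial>\<nu>) = (\<integral>\<^sup>+x. w x * \<phi> x \<partial>lborel)"
    unfolding power_measure_def w_def[symmetric] by (rule nn_integral_density) auto
  also have "... = (\<integral>\<^sup>+x. w x * \<phi> x \<partial>density (distr lborel borel (\<lambda>x. 0 + s *\<^sub>R x)) (\<lambda>_. \<bar>s\<bar> ^ DIM(real ^ 'd)))"
    using lborel_affine[of s "0 :: real ^ 'd"] s by simp
  also have "... = (\<integral>\<^sup>+y. ennreal (\<bar>s\<bar> ^ DIM(real ^ 'd)) * (w (s *\<^sub>R y) * \<phi> (s *\<^sub>R y)) \<partial>lborel)"
    by (simp add: nn_integral_density nn_integral_distr)
  also have "... = (\<integral>\<^sup>+y. ennreal (s powr hom_dim) * (w y * \<phi> (s *\<^sub>R y)) \<partial>lborel)"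
  proof (intro nn_integral_cong)
    fix y
    have "\<bar>s\<bar> ^ DIM(real ^ 'd) * s powr (\<Sum>i\<in>UNIV. \<alpha> $ i) = s powr hom_dim"
      using s by (simp add: hom_dim_def sum.distrib powr_add powr_realpow)
    then have "ennreal (\<bar>s\<bar> ^ DIM(real ^ 'd)) * ennreal (s powr (\<Sum>i\<in>UNIV. \<alpha> $ i)) = ennreal (s powr hom_dim)"
      by (simp flip: ennreal_mult')
    then show "ennreal (\<bar>s\<bar> ^ DIM(real ^ 'd)) * (w (s *\<^sub>R y) * \<phi> (s *\<^sub>R y)) = ennreal (s powr hom_dim) * (w y * \<phi> (s *\<^sub>R y))"
      unfolding ws by (simp only: mult.assoc[symmetric])
  qed
  also have "... = ennreal (s powr hom_dim) * (\<integral>\<^sup>+y. w y * \<phi> (s *\<^sub>R y) \<partial>lborel)"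
    by (rule nn_integral_cmult) measurable
  also have "(\<integral>\<^sup>+y. w y * \<phi> (s *\<^sub>R y) \<partial>lborel) = (\<integral>\<^sup>+y. \<phi> (s *\<^sub>R y) \<partial>\<nu>)"
    unfolding power_measure_def w_def[symmetric] by (rule nn_integral_density[symmetric]) auto
  finally show ?thesis .
qed

text \<open>By homogeneity \<open>P\<^sub>\<tau>(s y, q v) = s powr (- hom_dim) * P\<^bsub>\<tau>/s\<^esub>(y, (q/s) v)\<close>, and \<open>(q/s) v\<close> is again on the ray
through \<open>v\<close>: up to the explicit exponential, the bound does not depend on \<open>s\<close>.\<close>

lemma ext_kernel_dilate_le_ray_kernel:
  assumes R: "R \<ge> 1" "R \<ge> real CARD('d)" and y: "y \<in> pos_orthant" and s: "1 \<le> s" "s \<le> 2"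
    and sy: "coord_sum (s *\<^sub>R y) \<le> 2 * R" and t: "t > 0" "t * (1 + coord_sum (s *\<^sub>R y)) \<ge> 1 / 100"
  shows "ext_kernel t (s *\<^sub>R y) v \<le> ennreal (exp (s * coord_sum y)) * (ennreal (exp 8 * harnack_const) * ray_kernel R y v)"
proof (cases "v \<in> pos_orthant")
  case v: True
  define q where "q = exp (- t)"
  have q: "q > 0" "q < 1" using t by (auto simp: q_def)
  have y0: "coord_sum y > 0" using coord_sum_pos[OF y] .
  \<comment> \<open>The point \<open>s y\<close> has size at most \<open>2R\<close>, so nonlocality gives \<open>t \<ge> 1/(300 R)\<close>.\<close>
  have "1 / (400 * R) \<le> 1 - q"
  proof -
    have "1 / 100 \<le> t * (1 + 2 * R)"
      using t sy by (auto intro: order_trans mult_left_mono)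
    also have "... \<le> t * (3 * R)" using t R by (intro mult_left_mono) auto
    finally have "1 / (300 * R) \<le> t" using R by (simp add: field_simps)
    then have "1 / (1 / (1 / (300 * R)) + 1) \<le> 1 - q"
      unfolding q_def using R by (intro one_minus_exp_ge) auto
    moreover have "1 / (400 * R) \<le> 1 / (1 / (1 / (300 * R)) + 1)"
      using R by (simp add: frac_le)
    ultimately show ?thesis by linarith
  qed
  then have "1 / (400 * R) / 2 \<le> (1 - q) / s"
    using s q by (intro frac_le) auto
  then have \<tau>: "1 / (800 * R) \<le> (1 - q) / s" by simp
  have \<tau>1: "(1 - q) / s \<le> 1" using s q by (simp add: field_simps)
  have "coord_sum y \<le> s * coord_sum y" using s y0 by simp
  then have yR: "coord_sum y \<le> 2 * R" using sy by (simp add: coord_sum_scaleR)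
  have nn: "heat ((1 - q) / s) y ((q / s) *\<^sub>R v) \<ge> 0"
    using s q y v by (intro bessel_heat_nonneg' pos_orthant_scaleR) auto
  have "heat (1 - q) (s *\<^sub>R y) (s *\<^sub>R ((q / s) *\<^sub>R v)) = s powr (- hom_dim) * heat ((1 - q) / s) y ((q / s) *\<^sub>R v)"
    using s q by (intro bessel_heat_scale) auto
  also have "... \<le> 1 * heat ((1 - q) / s) y ((q / s) *\<^sub>R v)"
    using s hom_dim_pos nn by (intro mult_right_mono) (auto simp: powr_minus intro!: inverse_le_1_iff[THEN iffD2] ge_one_powr_ge_zero)
  finally have "ennreal (heat (1 - q) (s *\<^sub>R y) (q *\<^sub>R v)) \<le> ennreal (heat ((1 - q) / s) y ((q / s) *\<^sub>R v))"
    using s by (intro ennreal_leI) simp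
  also have "... \<le> ennreal (exp 8 * harnack_const) * ray_kernel R y v"
    using s q by (intro bessel_heat_le_ray_kernel R y yR v \<tau> \<tau>1) auto
  finally have "ennreal (exp (s * coord_sum y)) * ennreal (heat (1 - q) (s *\<^sub>R y) (q *\<^sub>R v))
     \<le> ennreal (exp (s * coord_sum y)) * (ennreal (exp 8 * harnack_const) * ray_kernel R y v)"
    by (intro mult_left_mono) auto
  then show ?thesis
    using v y s by (simp add: ext_kernel_def pos_orthant_scaleR coord_sum_scaleR ennreal_mult' flip: q_def)
qed (simp add: ext_kernel_def)

text \<open>Integration along rays without polar coordinates: the measure of \<open>D\<close> is written as an integral of
dilates by \<open>s\<close> and averaged over \<open>1 \<le> s \<le> 2\<close>. For fixed \<open>y\<close> the integral over \<open>s\<close> is that of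
\<open>nn_integral_exp_superlevel\<close>, with \<open>|y|\<close> comparable to \<open>R\<close>. This gains \<open>1/R\<close> and compensates for the integral
\<open>O(R)\<close> of the ray kernel.\<close>

lemma nonlocal_shell_weak_type:
  assumes R: "R \<ge> 1" "R \<ge> real CARD('d)" and r: "r > 0"
    and g [measurable]: "g \<in> borel_measurable borel" and D [measurable]: "D \<in> sets borel"
    and Dpos: "D \<subseteq> pos_orthant" and shell: "\<And>x. x \<in> D \<Longrightarrow> R / 2 \<le> coord_sum x \<and> coord_sum x \<le> 2 * R"
    and large: "\<And>x. x \<in> D \<Longrightarrow> \<exists>t>0. t * (1 + coord_sum x) \<ge> 1 / 100 \<and> pos_semigroup g t x > ennreal r"
  shows "emeasure \<mu> D
    \<le> ennreal (240 * 2 powr hom_dim * (exp 8 * harnack_const) / r) * integral\<^sup>N \<mu> g"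
proof -
  interpret L: sigma_finite_measure \<mu> by (rule sigma_finite_borel_laguerre)
  interpret W: sigma_finite_measure \<nu> by (rule sigma_finite_power_measure)
  interpret P: pair_sigma_finite \<mu> \<nu> by unfold_locales
  interpret Q: pair_sigma_finite "lborel :: real measure" \<nu> by unfold_locales
  define K where "K = exp 8 * harnack_const"
  have K: "K > 0" using harnack_const_pos by (simp add: K_def)
  define G where "G = (\<lambda>y. \<integral>\<^sup>+v. ray_kernel R y v * g v \<partial>\<mu>)"
  have G_meas [measurable]: "G \<in> borel_measurable borel" unfolding G_def by measurable
  have G_int: "(\<integral>\<^sup>+y. G y \<partial>\<nu>) \<le> ennreal (60 * R) * (\<integral>\<^sup>+v. g v \<partial>\<mu>)"
  proof -
    have "(\<integral>\<^sup>+y. G y \<partial>\<nu>) = (\<integral>\<^sup>+v. \<integral>\<^sup>+y. ray_kernel R y v * g v \<partial>\<nu> \<partial>\<mu>)"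
      unfolding G_def by (rule P.Fubini') measurable
    also have "... = (\<integral>\<^sup>+v. (\<integral>\<^sup>+y. ray_kernel R y v \<partial>\<nu>) * g v \<partial>\<mu>)"
      by (intro nn_integral_cong nn_integral_multc) measurable
    also have "... \<le> (\<integral>\<^sup>+v. ennreal (60 * R) * g v \<partial>\<mu>)"
    proof (rule nn_integral_mono_AE, rule AE_mp[OF AE_borel_laguerre_measure], intro AE_I2 impI)
      fix v :: "real ^ 'd" assume "v \<in> pos_orthant"
      then show "(\<integral>\<^sup>+y. ray_kernel R y v \<partial>\<nu>) * g v \<le> ennreal (60 * R) * g v"
        using R by (intro mult_right_mono nn_integral_ray_kernel_le) auto
    qed
    also have "... = ennreal (60 * R) * (\<integral>\<^sup>+v. g v \<partial>\<mu>)"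
      by (rule nn_integral_cmult) measurable
    finally show ?thesis .
  qed
  define \<phi> where "\<phi> = (\<lambda>x. ennreal (exp (- coord_sum x)) * indicator D x)"
  have [measurable]: "\<phi> \<in> borel_measurable borel" unfolding \<phi>_def by measurable
  have level: "ennreal r < ennreal (exp (s * coord_sum y)) * (ennreal K * G y)"
    if y: "y \<in> pos_orthant" and s: "1 \<le> s" "s \<le> 2" and sy: "s *\<^sub>R y \<in> D" for s y
  proof -
    obtain t where t: "t > 0" "t * (1 + coord_sum (s *\<^sub>R y)) \<ge> 1 / 100" "pos_semigroup g t (s *\<^sub>R y) > ennreal r"
      using large[OF sy] by blast
    note t(3)
    also have "pos_semigroup g t (s *\<^sub>R y) \<le> (\<integral>\<^sup>+v. ennreal (exp (s * coord_sum y)) * (ennreal K * (ray_kernel R y v * g v)) \<partial>\<mu>)"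
      unfolding pos_semigroup_def
    proof (intro nn_integral_mono)
      fix v
      have "ext_kernel t (s *\<^sub>R y) v \<le> ennreal (exp (s * coord_sum y)) * (ennreal K * ray_kernel R y v)"
        unfolding K_def using shell[OF sy] by (intro ext_kernel_dilate_le_ray_kernel R y s t(1,2)) auto
      from mult_right_mono[OF this, of "g v"]
      show "ext_kernel t (s *\<^sub>R y) v * g v \<le> ennreal (exp (s * coord_sum y)) * (ennreal K * (ray_kernel R y v * g v))"
        by (simp add: mult.assoc)
    qed
    also have "... = ennreal (exp (s * coord_sum y)) * (ennreal K * G y)"
      unfolding G_def by (simp add: nn_integral_cmult)
    finally show ?thesis .
  qed
  have inner: "(\<integral>\<^sup>+s. indicator {1..2} s * \<phi> (s *\<^sub>R y) \<partial>lborel) \<le> ennreal K * G y * ennreal (4 / (r * R))"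
    if y: "y \<in> pos_orthant" for y
  proof (cases "coord_sum y < R / 4")
    case True
    have eq0: "indicator {1..2} s * \<phi> (s *\<^sub>R y) = 0" for s
    proof (cases "s \<in> {1..2} \<and> s *\<^sub>R y \<in> D")
      case True
      have "s * coord_sum y \<le> 2 * coord_sum y"
        using True coord_sum_pos[OF y] by (intro mult_right_mono) auto
      then show ?thesis using shell[of "s *\<^sub>R y"] True \<open>coord_sum y < R / 4\<close> by (simp add: coord_sum_scaleR)
    qed (auto simp: \<phi>_def)
    show ?thesis unfolding eq0 by simp
  next
    case False
    have "indicator {1..2} s * \<phi> (s *\<^sub>R y) \<le> indicator {s. ennreal r < ennreal (exp (s * coord_sum y)) * (ennreal K * G y)} s * ennreal (exp (- (s * coord_sum y)))" for s
      using level[OF y, of s] by (auto simp: \<phi>_def indicator_def coord_sum_scaleR)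
    then have "(\<integral>\<^sup>+s. indicator {1..2} s * \<phi> (s *\<^sub>R y) \<partial>lborel)
      \<le> (\<integral>\<^sup>+s. indicator {s. ennreal r < ennreal (exp (s * coord_sum y)) * (ennreal K * G y)} s * ennreal (exp (- (s * coord_sum y))) \<partial>lborel)"
      by (intro nn_integral_mono)
    also have "... \<le> ennreal K * G y * ennreal (1 / (r * coord_sum y))"
      by (rule nn_integral_exp_superlevel[OF coord_sum_pos[OF y] r])
    also have "... \<le> ennreal K * G y * ennreal (4 / (r * R))"
    proof (intro mult_left_mono ennreal_leI)
      have "1 / (r * coord_sum y) \<le> 1 / (r * (R / 4))"
        using False R r coord_sum_pos[OF y] by (intro divide_left_mono mult_left_mono) auto
      then show "1 / (r * coord_sum y) \<le> 4 / (r * R)" by simp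
    qed auto
    finally show ?thesis .
  qed
  have "emeasure \<mu> D = (\<integral>\<^sup>+x. indicator D x \<partial>\<mu>)"
    by simp
  also have "... = (\<integral>\<^sup>+x. \<phi> x \<partial>\<nu>)"
    unfolding \<phi>_def by (rule nn_integral_borel_laguerre) measurable
  also have "... = (\<integral>\<^sup>+s. indicator {1..2} s * (\<integral>\<^sup>+x. \<phi> x \<partial>\<nu>) \<partial>(lborel :: real measure))"
    by (subst nn_integral_multc) auto
  also have "... \<le> (\<integral>\<^sup>+s. ennreal (2 powr hom_dim) * (\<integral>\<^sup>+y. indicator {1..2} s * \<phi> (s *\<^sub>R y) \<partial>\<nu>) \<partial>(lborel :: real measure))"
  proof (intro nn_integral_mono)
    fix s :: real
    show "indicator {1..2} s * (\<integral>\<^sup>+x. \<phi> x \<partial>\<nu>)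
      \<le> ennreal (2 powr hom_dim) * (\<integral>\<^sup>+y. indicator {1..2} s * \<phi> (s *\<^sub>R y) \<partial>\<nu>)"
    proof (cases "s \<in> {1..2}")
      case True
      then have "(\<integral>\<^sup>+x. \<phi> x \<partial>\<nu>) = ennreal (s powr hom_dim) * (\<integral>\<^sup>+y. \<phi> (s *\<^sub>R y) \<partial>\<nu>)"
        by (intro nn_integral_power_measure_dilate) auto
      also have "... \<le> ennreal (2 powr hom_dim) * (\<integral>\<^sup>+y. \<phi> (s *\<^sub>R y) \<partial>\<nu>)"
        using True hom_dim_pos by (intro mult_right_mono ennreal_leI powr_mono2) auto
      finally show ?thesis using True by simp
    qed simp
  qed
  also have "... = ennreal (2 powr hom_dim) * (\<integral>\<^sup>+s. (\<integral>\<^sup>+y. indicator {1..2} s * \<phi> (s *\<^sub>R y) \<partial>\<nu>) \<partial>(lborel :: real measure))"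
    by (rule nn_integral_cmult) measurable
  also have "(\<integral>\<^sup>+s. (\<integral>\<^sup>+y. indicator {1..2} s * \<phi> (s *\<^sub>R y) \<partial>\<nu>) \<partial>(lborel :: real measure))
    = (\<integral>\<^sup>+y. (\<integral>\<^sup>+s. indicator {1..2} s * \<phi> (s *\<^sub>R y) \<partial>(lborel :: real measure)) \<partial>\<nu>)"
    by (rule Q.Fubini'[symmetric]) measurable
  also have "... \<le> (\<integral>\<^sup>+y. ennreal K * G y * ennreal (4 / (r * R)) \<partial>\<nu>)"
    by (rule nn_integral_mono_AE, rule AE_mp[OF AE_power_measure], intro AE_I2 impI inner)
  also have "... = ennreal K * (\<integral>\<^sup>+y. G y \<partial>\<nu>) * ennreal (4 / (r * R))"
    by (simp add: nn_integral_multc nn_integral_cmult)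
  also have "... \<le> ennreal K * (ennreal (60 * R) * (\<integral>\<^sup>+v. g v \<partial>\<mu>)) * ennreal (4 / (r * R))"
    by (intro mult_right_mono mult_left_mono G_int) auto
  also have "ennreal (2 powr hom_dim) * ... = (ennreal (2 powr hom_dim) * ennreal K * ennreal (60 * R) * ennreal (4 / (r * R))) * (\<integral>\<^sup>+v. g v \<partial>\<mu>)"
    by (simp only: mult_ac)
  also have "ennreal (2 powr hom_dim) * ennreal K * ennreal (60 * R) * ennreal (4 / (r * R)) = ennreal (2 powr hom_dim * K * (60 * R) * (4 / (r * R)))"
  proof -
    have "ennreal a * ennreal b * ennreal c * ennreal d = ennreal (a * b * c * d)"
      if "0 \<le> a" "0 \<le> b" "0 \<le> c" "0 \<le> d" for a b c d
      using that by (simp add: ennreal_mult)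
    then show ?thesis using K R r by simp
  qed
  also have "2 powr hom_dim * K * (60 * R) * (4 / (r * R)) = 240 * 2 powr hom_dim * K / r"
    using R by (simp add: field_simps)
  finally show ?thesis unfolding K_def by (simp add: mult_left_mono)
qed

text \<open>Nonlocal times satisfy \<open>1/\<tau> = O(1 + |x|)\<close>, so the squared Bessel kernel is bounded by a power of
\<open>1 + |x|\<close>. Half a factor \<open>exp |x|\<close> absorbs that power, and what results is \<open>O(exp (3R/4))\<close> when
\<open>|x| < R/2\<close>.\<close>

lemma ext_kernel_nonlocal_bound:
  obtains C where "C > 0"
    and "\<And>t x v. t > 0 \<Longrightarrow> x \<in> pos_orthant \<Longrightarrow> t * (1 + coord_sum x) \<ge> 1 / 100 \<Longrightarrow> ext_kernel t x v \<le> ennreal (C * exp (3 / 2 * coord_sum x))"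
proof -
  define M where "M = (\<Sum>i\<in>UNIV. \<alpha> $ i + 3)"
  have M: "M \<ge> 1"
  proof -
    have "real CARD('d) = (\<Sum>i\<in>(UNIV :: 'd set). 1)" by simp
    also have "... \<le> M" unfolding M_def using type_gt by (intro sum_mono) (smt (verit))
    finally have "real CARD('d) \<le> M" .
    moreover have "real CARD('d) \<ge> 1" by simp
    ultimately show ?thesis by linarith
  qed
  define c where "c = (\<Prod>i\<in>UNIV. crude_const (\<alpha> $ i))"
  have B1: "crude_const (\<alpha> $ i) > 0" for i by (intro crude_const_pos type_gt)
  have c: "c > 0" unfolding c_def using B1 by (intro prod_pos) auto
  show ?thesis
  proof (rule that[of "c * (101 * (2 * M)) powr M"])
    show "c * (101 * (2 * M)) powr M > 0" using c M by simp
    fix t :: real and x v :: "real ^ 'd" assume t: "t > 0" "t * (1 + coord_sum x) \<ge> 1 / 100" and x: "x \<in> pos_orthant"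
    show "ext_kernel t x v \<le> ennreal (c * (101 * (2 * M)) powr M * exp (3 / 2 * coord_sum x))"
    proof (cases "v \<in> pos_orthant")
      case v: True
      define X where "X = coord_sum x"
      have X: "X > 0" using coord_sum_pos[OF x] by (simp add: X_def)
      have xX: "x $ i \<le> X" "x $ i > 0" for i
        unfolding X_def coord_sum_def using x by (auto simp: pos_orthant_def less_imp_le intro!: member_le_sum)
      have vi: "v $ i > 0" for i using v by (simp add: pos_orthant_def)
      define \<tau> where "\<tau> = 1 - exp (- t)"
      define Z where "Z = 101 * (1 + X)"
      have Z: "Z \<ge> 1" "1 + X \<le> Z" using X by (auto simp: Z_def)
      have "1 / (100 * (1 + X)) \<le> t" using t X by (simp add: X_def field_simps)
      then have "1 / (1 / (1 / (100 * (1 + X))) + 1) \<le> \<tau>"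
        unfolding \<tau>_def using X by (intro one_minus_exp_ge) auto
      moreover have "1 / Z \<le> 1 / (1 / (1 / (100 * (1 + X))) + 1)"
        using X by (simp add: Z_def frac_le)
      ultimately have \<tau>Z: "1 / Z \<le> \<tau>" by linarith
      have \<tau>: "\<tau> > 0" using t by (simp add: \<tau>_def)
      have inv: "1 / \<tau> \<le> Z" using \<tau>Z \<tau> Z by (simp add: field_simps)
      have "heat \<tau> x (exp (- t) *\<^sub>R v) \<le> (\<Prod>i\<in>UNIV. crude_const (\<alpha> $ i) * Z powr (\<alpha> $ i + 3))"
        unfolding bessel_heat_def
      proof (intro prod_mono conjI)
        fix i
        show "sq_bessel_kernel (\<alpha> $ i) \<tau> (x $ i) ((exp (- t) *\<^sub>R v) $ i) \<ge> 0"
          using xX vi by (intro sq_bessel_kernel_nonneg type_gt) (auto simp: less_imp_le)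
        have "sq_bessel_kernel (\<alpha> $ i) \<tau> (x $ i) ((exp (- t) *\<^sub>R v) $ i)
          \<le> crude_const (\<alpha> $ i) * \<tau> powr (- (\<alpha> $ i + 1)) * (1 + x $ i / \<tau>)"
          using xX vi by (intro sq_bessel_kernel_le_linear type_gt \<tau>) (auto simp: less_imp_le)
        also have "... \<le> crude_const (\<alpha> $ i) * Z powr (\<alpha> $ i + 1) * Z\<^sup>2"
        proof (intro mult_mono)
          have "\<tau> powr (- (\<alpha> $ i + 1)) = (1 / \<tau>) powr (\<alpha> $ i + 1)"
            using \<tau> powr_minus_divide[of \<tau> "\<alpha> $ i + 1"] by (simp add: powr_divide)
          also have "... \<le> Z powr (\<alpha> $ i + 1)"
            using inv \<tau> type_gt[of i] by (intro powr_mono2) auto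
          finally show "\<tau> powr (- (\<alpha> $ i + 1)) \<le> Z powr (\<alpha> $ i + 1)" .
          have "x $ i * (1 / \<tau>) \<le> X * Z" using xX inv \<tau> X by (intro mult_mono) (auto simp: less_imp_le)
          then have "1 + x $ i / \<tau> \<le> Z + X * Z" using Z by simp
          also have "... = Z * (1 + X)" by (simp add: algebra_simps)
          also have "... \<le> Z * Z" using Z by (intro mult_left_mono) auto
          finally show "1 + x $ i / \<tau> \<le> Z\<^sup>2" by (simp add: power2_eq_square)
        qed (use B1[of i] xX[of i] \<tau> in \<open>auto simp: less_imp_le\<close>)
        also have "... = crude_const (\<alpha> $ i) * Z powr (\<alpha> $ i + 3)"
        proof -
          have "Z powr (\<alpha> $ i + 3) = Z powr (\<alpha> $ i + 1) * Z powr 2" by (simp add: add.commute flip: powr_add)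
          also have "Z powr 2 = Z\<^sup>2" using Z by simp
          finally show ?thesis by simp
        qed
        finally show "sq_bessel_kernel (\<alpha> $ i) \<tau> (x $ i) ((exp (- t) *\<^sub>R v) $ i) \<le> crude_const (\<alpha> $ i) * Z powr (\<alpha> $ i + 3)" .
      qed
      also have "... = c * Z powr M"
        using Z by (simp add: prod.distrib c_def M_def powr_sum)
      also have "... \<le> c * ((101 * (2 * M)) powr M * exp (X / 2))"
      proof (intro mult_left_mono)
        have "1 + X \<le> (2 * M) * (1 + X / (2 * M))" using M by (simp add: field_simps)
        also have "... \<le> (2 * M) * exp (X / (2 * M))" using M by (intro mult_left_mono exp_ge_add_one_self) auto
        finally have "Z \<le> 101 * (2 * M) * exp (X / (2 * M))" by (simp add: Z_def)
        then have "Z powr M \<le> (101 * (2 * M) * exp (X / (2 * M))) powr M" using Z M by (intro powr_mono2) auto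
        also have "... = (101 * (2 * M)) powr M * exp (X / (2 * M)) powr M" by (rule powr_mult)
        also have "exp (X / (2 * M)) powr M = exp (X / 2)" using M by (simp add: powr_def)
        finally show "Z powr M \<le> (101 * (2 * M)) powr M * exp (X / 2)" .
      qed (use c in auto)
      finally have "exp X * heat \<tau> x (exp (- t) *\<^sub>R v) \<le> exp X * (c * ((101 * (2 * M)) powr M * exp (X / 2)))"
        by (intro mult_left_mono) auto
      also have "... = c * (101 * (2 * M)) powr M * (exp X * exp (X / 2))" by (simp only: mult_ac)
      also have "exp X * exp (X / 2) = exp (3 / 2 * X)" by (simp flip: exp_add)
      finally show ?thesis using x v unfolding X_def \<tau>_def by (simp add: ext_kernel_def ennreal_leI)
    qed (simp add: ext_kernel_def)
  qed
qed

section \<open>The weak type estimate\<close>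

lemma pos_semigroup_le_of_ext_kernel_le:
  assumes g [measurable]: "g \<in> borel_measurable borel" and le: "\<And>v. ext_kernel t x v \<le> c"
  shows "pos_semigroup g t x \<le> c * (\<integral>\<^sup>+v. g v \<partial>\<mu>)"
proof -
  have "pos_semigroup g t x \<le> (\<integral>\<^sup>+v. c * g v \<partial>\<mu>)"
    unfolding pos_semigroup_def by (intro nn_integral_mono mult_right_mono le) auto
  also have "... = c * (\<integral>\<^sup>+v. g v \<partial>\<mu>)" by (rule nn_integral_cmult) measurable
  finally show ?thesis .
qed

lemma laguerre_maximal_gt_iff:
  "ennreal r < laguerre_maximal \<alpha> f x \<longleftrightarrow> (\<exists>t>0. ennreal r < ennreal (norm (laguerre_semigroup \<alpha> t f x)))"
  unfolding laguerre_maximal_def by (simp add: less_SUP_iff Bex_def)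

lemma open_laguerre_maximal_superlevel:
  assumes r: "r > 0" and f: "integrable (laguerre_measure \<alpha>) f"
  shows "open {x \<in> pos_orthant. laguerre_maximal \<alpha> f x > ennreal r}"
proof -
  have "{x \<in> pos_orthant. laguerre_maximal \<alpha> f x > ennreal r}
    = (\<Union>t\<in>{0<..}. {x \<in> pos_orthant. norm (laguerre_semigroup \<alpha> t f x) > r})"
    using r by (auto simp: laguerre_maximal_gt_iff ennreal_less_iff)
  also have "open ..." by (intro open_UN ballI open_laguerre_semigroup_superlevel f) auto
  finally show ?thesis .
qed

text \<open>The bound for times at least \<open>1/(n + 1)\<close> is independent of \<open>n\<close>, and the sets \<open>F n\<close> are open and
increase to \<open>E\<close>.\<close>

lemma laguerre_local_maximal_weak_type:
  assumes r: "r > 0" and f: "integrable (laguerre_measure \<alpha>) f"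
    and g [measurable]: "g \<in> borel_measurable borel" and fg: "AE y in laguerre_measure \<alpha>. ennreal (norm (f y)) = g y"
    and fin: "integral\<^sup>N \<mu> g < \<infinity>"
  defines "E \<equiv> {x \<in> pos_orthant. \<exists>t>0. t * (1 + coord_sum x) < 1 / 100 \<and> norm (laguerre_semigroup \<alpha> t f x) > r}"
  shows "E \<in> sets borel"
    and "emeasure \<mu> E \<le> ennreal (16 * harnack_const / r) * integral\<^sup>N \<mu> g"
proof -
  let ?B = "ennreal (16 * harnack_const / r) * integral\<^sup>N \<mu> g"
  define F where "F = (\<lambda>n :: nat. {x \<in> pos_orthant. \<exists>t\<ge>1 / real (Suc n). t * (1 + coord_sum x) < 1 / 100 \<and> norm (laguerre_semigroup \<alpha> t f x) > r})"
  have F_open: "open (F n)" for n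
  proof -
    have "F n = (\<Union>t\<in>{1 / real (Suc n)..}. {x. t * (1 + coord_sum x) < 1 / 100} \<inter> {x \<in> pos_orthant. norm (laguerre_semigroup \<alpha> t f x) > r})"
      by (auto simp: F_def)
    also have "open ..."
    proof (intro open_UN ballI open_Int)
      fix t assume t: "t \<in> {1 / real (Suc n)..}"
      show "open {x :: real ^ 'd. t * (1 + coord_sum x) < 1 / 100}"
        unfolding coord_sum_def by (intro open_Collect_less continuous_intros)
      have "0 < 1 / real (Suc n)" by simp
      also have "... \<le> t" using t by simp
      finally have "t > 0" .
      then show "open {x \<in> pos_orthant. norm (laguerre_semigroup \<alpha> t f x) > r}"
        by (rule open_laguerre_semigroup_superlevel[OF _ f])
    qed
    finally show ?thesis .
  qed
  have F_sets [measurable]: "F n \<in> sets borel" for n using F_open by (rule borel_open)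
  have F_inc: "incseq F"
  proof (rule incseq_SucI)
    fix n
    have "1 / real (Suc (Suc n)) \<le> 1 / real (Suc n)" by (simp add: frac_le)
    then show "F n \<subseteq> F (Suc n)" unfolding F_def by (blast intro: order_trans)
  qed
  have E_eq: "E = (\<Union>n. F n)"
  proof
    show "E \<subseteq> (\<Union>n. F n)"
    proof
      fix x assume "x \<in> E"
      then obtain t where t: "x \<in> pos_orthant" "t > 0" "t * (1 + coord_sum x) < 1 / 100" "norm (laguerre_semigroup \<alpha> t f x) > r"
        by (auto simp: E_def)
      obtain n where "1 / real (Suc n) < t" using nat_approx_posE[OF t(2)] .
      with t have "x \<in> F n" unfolding F_def by (auto intro!: exI[of _ t])
      then show "x \<in> (\<Union>n. F n)" by blast
    qed
    have "t > 0" if "1 / real (Suc n) \<le> t" for t n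
      using that by (rule less_le_trans[rotated]) simp
    then show "(\<Union>n. F n) \<subseteq> E" unfolding E_def F_def by blast
  qed
  show "E \<in> sets borel" unfolding E_eq by measurable
  have F_le: "emeasure \<mu> (F n) \<le> ?B" for n
  proof -
    have n: "1 / real (Suc n) > 0" by simp
    obtain S where S: "S \<in> sets borel"
      "\<And>x t. x \<in> pos_orthant \<Longrightarrow> t \<ge> 1 / real (Suc n) \<Longrightarrow> t * (1 + coord_sum x) \<le> 1 / 100 \<Longrightarrow> pos_semigroup g t x > ennreal r \<Longrightarrow> x \<in> S"
      "emeasure \<mu> S \<le> ?B"
      using local_maximal_weak_type[OF g fin n r] by blast
    have "F n \<subseteq> S"
    proof
      fix x assume "x \<in> F n"
      then obtain t where t: "x \<in> pos_orthant" "t \<ge> 1 / real (Suc n)" "t * (1 + coord_sum x) < 1 / 100" "norm (laguerre_semigroup \<alpha> t f x) > r"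
        by (auto simp: F_def)
      have "t > 0" using n t(2) by (rule less_le_trans)
      have "ennreal r < ennreal (norm (laguerre_semigroup \<alpha> t f x))" using t(4) r by (simp add: ennreal_less_iff)
      also have "... \<le> pos_semigroup g t x" using f by (intro norm_laguerre_semigroup_le \<open>t > 0\<close> t(1) g fg) auto
      finally show "x \<in> S" using t by (intro S(2)) auto
    qed
    then have "emeasure \<mu> (F n) \<le> emeasure \<mu> S"
      using S(1) by (intro emeasure_mono) auto
    with S(3) show ?thesis by order
  qed
  have "emeasure \<mu> E = (SUP n. emeasure \<mu> (F n))"
    unfolding E_eq by (rule SUP_emeasure_incseq[symmetric]) (use F_inc in auto)
  also have "... \<le> ?B"
    by (intro SUP_least F_le)
  finally show "emeasure \<mu> E \<le> ?B" .
qed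

end

theorem theorem2p1:
  fixes \<alpha> :: "real ^ 'd"
  assumes "\<And>i. \<alpha> $ i > - 1"
  shows "\<exists>C::real. C > 0 \<and>
    (\<forall>(f :: real ^ 'd \<Rightarrow> complex) (r :: real).
       integrable (laguerre_measure \<alpha>) f \<longrightarrow> r > 0 \<longrightarrow>
         {x \<in> pos_orthant. laguerre_maximal \<alpha> f x > ennreal r} \<in> sets (laguerre_measure \<alpha>) \<and>
         emeasure (laguerre_measure \<alpha>) {x \<in> pos_orthant. laguerre_maximal \<alpha> f x > ennreal r}
           \<le> ennreal (C / r * (LINT x|laguerre_measure \<alpha>. norm (f x))))"
proof -
  interpret laguerre_type \<alpha> by unfold_locales (rule assms)
  obtain c where c: "c > 0"
    "\<And>t x v. t > 0 \<Longrightarrow> x \<in> pos_orthant \<Longrightarrow> t * (1 + coord_sum x) \<ge> 1 / 100 \<Longrightarrow> ext_kernel t x v \<le> ennreal (c * exp (3 / 2 * coord_sum x))"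
    using ext_kernel_nonlocal_bound by blast
  \<comment> \<open>For \<open>R \<ge> 4 ln c\<close> the crude bound stays below the level; the other conditions are those of the shell estimate.\<close>
  define R0 where "R0 = max (max 1 (real CARD('d))) (4 * ln c)"
  obtain m0 where m0: "m0 \<ge> 0" "emeasure \<mu> UNIV = ennreal m0"
    using emeasure_laguerre_finite by (cases "emeasure \<mu> UNIV") auto
  obtain c0 where c0: "c0 \<ge> 0" "half_mass = ennreal c0"
    using half_mass_finite by (cases "\<integral>\<^sup>+x. ennreal (exp (- (coord_sum x / 2))) \<partial>\<nu>") auto
  define C1 where "C1 = 16 * harnack_const"
  define C2 where "C2 = 240 * 2 powr hom_dim * (exp 8 * harnack_const)"
  have C12: "C1 > 0" "C2 > 0" using harnack_const_pos by (auto simp: C1_def C2_def)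
  define C where "C = C1 + c0 + C2 + m0 * exp R0"
  have C: "C > 0" unfolding C_def using C12 c0(1) m0(1) by (intro add_pos_nonneg add_pos_pos) auto
  show ?thesis
  proof (intro exI[of _ C] conjI C allI impI)
    fix f :: "real ^ 'd \<Rightarrow> complex" and r :: real
    assume f: "integrable (laguerre_measure \<alpha>) f" and r: "r > 0"
    define E where "E = {x \<in> pos_orthant. laguerre_maximal \<alpha> f x > ennreal r}"
    have E_borel [measurable]: "E \<in> sets borel"
      unfolding E_def by (rule borel_open[OF open_laguerre_maximal_superlevel[OF r f]])
    have E_pos: "E \<subseteq> pos_orthant" by (auto simp: E_def)
    show "{x \<in> pos_orthant. laguerre_maximal \<alpha> f x > ennreal r} \<in> sets (laguerre_measure \<alpha>)"
      using borel_in_sets_laguerre_measure[OF E_borel E_pos] by (simp add: E_def)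
    define N where "N = (LINT x|laguerre_measure \<alpha>. norm (f x))"
    have N0: "N \<ge> 0" by (simp add: N_def)
    have f_meas: "f \<in> borel_measurable (laguerre_measure \<alpha>)" using f by simp
    then have "(\<lambda>x. ennreal (norm (f x))) \<in> borel_measurable (laguerre_measure \<alpha>)" by measurable
    then obtain g where g [measurable]: "g \<in> borel_measurable borel" and fg: "AE y in laguerre_measure \<alpha>. ennreal (norm (f y)) = g y"
      using laguerre_measurable_ex_borel by blast
    have gN: "integral\<^sup>N \<mu> g = ennreal N"
    proof -
      have "integral\<^sup>N \<mu> g = (\<integral>\<^sup>+x. g x \<partial>laguerre_measure \<alpha>)" by (rule nn_integral_laguerre_measure[symmetric]) measurable
      also have "... = (\<integral>\<^sup>+x. ennreal (norm (f x)) \<partial>laguerre_measure \<alpha>)"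
        using fg by (intro nn_integral_cong_AE) (auto elim!: eventually_mono)
      also have "... = ennreal N" unfolding N_def using f by (intro nn_integral_eq_integral) auto
      finally show ?thesis .
    qed
    have E_large: "\<exists>t>0. norm (laguerre_semigroup \<alpha> t f x) > r \<and> pos_semigroup g t x > ennreal r" if x: "x \<in> E" for x
    proof -
      obtain t where t: "t > 0" "ennreal r < ennreal (norm (laguerre_semigroup \<alpha> t f x))"
        using x by (auto simp: E_def laguerre_maximal_gt_iff)
      have "x \<in> pos_orthant" using x E_pos by blast
      from less_le_trans[OF t(2) norm_laguerre_semigroup_le[OF t(1) this f_meas g fg]]
      show ?thesis using t r by (auto simp: ennreal_less_iff)
    qed
    \<comment> \<open>Below the level \<open>exp R0 * N\<close> the finiteness of the measure suffices.\<close>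
    have "emeasure \<mu> E \<le> ennreal (C / r * N)"
    proof (cases "r \<le> exp R0 * N")
      case True
      have "emeasure \<mu> E \<le> emeasure \<mu> UNIV" by (intro emeasure_mono) auto
      also have "... = ennreal m0" by (rule m0)
      also have "... \<le> ennreal (C / r * N)"
      proof (intro ennreal_leI)
        have "m0 * r \<le> m0 * (exp R0 * N)" using True m0(1) by (intro mult_left_mono)
        also have "... \<le> C * N" unfolding C_def using C12 c0(1) N0 by (simp add: mult.assoc[symmetric] mult_right_mono)
        finally show "m0 \<le> C / r * N" using r by (simp add: field_simps)
      qed
      finally show ?thesis .
    next
      case large: False
      show ?thesis
      proof (cases "N = 0")
        case True
        have "pos_semigroup g t x = 0" for t x
          using pos_semigroup_le_of_ext_kernel_le[OF g, of t x top] gN True by simp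
        then have "E = {}" using E_large r by auto
        then show ?thesis by simp
      next
        case False
        then have N: "N > 0" using N0 by simp
        \<comment> \<open>The level relative to the norm of \<open>f\<close> is \<open>exp R\<close>.\<close>
        define R where "R = ln (r / N)"
        have eR: "exp R = r / N" using r N by (simp add: R_def)
        have "exp R0 < r / N" using large N by (simp add: field_simps)
        then have "R0 < R" unfolding eR[symmetric] by simp
        then have R: "R \<ge> 1" "R \<ge> real CARD('d)" "R \<ge> 4 * ln c"
          unfolding R0_def max_less_iff_conj by linarith+
        define E1 where "E1 = {x \<in> pos_orthant. \<exists>t>0. t * (1 + coord_sum x) < 1 / 100 \<and> norm (laguerre_semigroup \<alpha> t f x) > r}"
        have fin: "integral\<^sup>N \<mu> g < \<infinity>" by (simp add: gN)
        have E1 [measurable]: "E1 \<in> sets borel" and E1_le: "emeasure \<mu> E1 \<le> ennreal (C1 / r) * ennreal N"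
          using laguerre_local_maximal_weak_type[OF r f g fg fin] unfolding E1_def C1_def gN by auto
        define E2 :: "(real ^ 'd) set" where "E2 = {x \<in> pos_orthant. coord_sum x > 2 * R}"
        have [measurable]: "E2 \<in> sets borel" unfolding E2_def by measurable
        have E2_le: "emeasure \<mu> E2 \<le> ennreal (exp (- R)) * ennreal c0"
          using emeasure_laguerre_tail[of R] unfolding E2_def c0(2) .
        define E3 where "E3 = (E - E1) - E2"
        have E3_meas [measurable]: "E3 \<in> sets borel" unfolding E3_def by measurable
        have E3_large: "\<exists>t>0. t * (1 + coord_sum x) \<ge> 1 / 100 \<and> pos_semigroup g t x > ennreal r" if x: "x \<in> E3" for x
        proof -
          obtain t where t: "t > 0" "norm (laguerre_semigroup \<alpha> t f x) > r" "pos_semigroup g t x > ennreal r"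
            using E_large[of x] x by (auto simp: E3_def)
          then have "\<not> t * (1 + coord_sum x) < 1 / 100" using x E_pos by (auto simp: E3_def E1_def)
          with t show ?thesis by (intro exI[of _ t]) auto
        qed
        have E3_shell: "R / 2 \<le> coord_sum x \<and> coord_sum x \<le> 2 * R" if x: "x \<in> E3" for x
        proof
          have xp: "x \<in> pos_orthant" using x E_pos by (auto simp: E3_def)
          show "coord_sum x \<le> 2 * R" using x xp by (auto simp: E3_def E2_def)
          show "R / 2 \<le> coord_sum x"
          proof (rule ccontr)
            assume small: "\<not> R / 2 \<le> coord_sum x"
            obtain t where t: "t > 0" "t * (1 + coord_sum x) \<ge> 1 / 100" "pos_semigroup g t x > ennreal r"
              using E3_large[OF x] by blast
            have "c * exp (3 / 2 * coord_sum x) \<le> exp (R / 4) * exp (3 / 2 * (R / 2))"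
            proof (intro mult_mono)
              have "exp (ln c) \<le> exp (R / 4)" using R(3) by (subst exp_le_cancel_iff) simp
              then show "c \<le> exp (R / 4)" using c(1) by simp
            qed (use small c(1) in auto)
            also have "... = r / N" unfolding eR[symmetric] by (simp flip: exp_add)
            finally have "ext_kernel t x v \<le> ennreal (r / N)" for v
              using c(2)[OF t(1) xp t(2), of v] by (meson ennreal_leI order_trans)
            then have "pos_semigroup g t x \<le> ennreal (r / N) * ennreal N"
              using pos_semigroup_le_of_ext_kernel_le[OF g, of t x "ennreal (r / N)"] gN by simp
            also have "... = ennreal r" using r N by (simp flip: ennreal_mult')
            finally show False using t(3) by order
          qed
        qed
        have "E3 \<subseteq> pos_orthant" using E_pos by (auto simp: E3_def)
        then have E3_le: "emeasure \<mu> E3 \<le> ennreal (C2 / r) * ennreal N"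
          using nonlocal_shell_weak_type[OF R(1,2) r g E3_meas _ E3_shell E3_large] unfolding C2_def gN by simp
        have "emeasure \<mu> E \<le> emeasure \<mu> (E1 \<union> (E2 \<union> E3))" by (intro emeasure_mono) (auto simp: E3_def)
        also have "... \<le> emeasure \<mu> E1 + emeasure \<mu> (E2 \<union> E3)" by (intro emeasure_subadditive) auto
        also have "... \<le> emeasure \<mu> E1 + (emeasure \<mu> E2 + emeasure \<mu> E3)"
          by (intro add_left_mono emeasure_subadditive) auto
        also have "... \<le> ennreal (C1 / r) * ennreal N + (ennreal (exp (- R)) * ennreal c0 + ennreal (C2 / r) * ennreal N)"
          by (intro add_mono E1_le E2_le E3_le)
        also have "... = ennreal (C1 / r * N + (exp (- R) * c0 + C2 / r * N))"
        proof -
          have "ennreal a * ennreal b + (ennreal c * ennreal d + ennreal e * ennreal b) = ennreal (a * b + (c * d + e * b))"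
            if "0 \<le> a" "0 \<le> b" "0 \<le> c" "0 \<le> d" "0 \<le> e" for a b c d e
            using that by (simp add: ennreal_mult)
          then show ?thesis using C12 r N c0(1) by simp
        qed
        also have "... \<le> ennreal (C / r * N)"
        proof (intro ennreal_leI)
          have "exp (- R) = N / r" using eR by (simp add: exp_minus)
          then have "C1 / r * N + (exp (- R) * c0 + C2 / r * N) = (C1 + c0 + C2) / r * N"
            by (simp add: add_divide_distrib distrib_right)
          also have "... \<le> C / r * N"
            unfolding C_def using r N m0(1) by (intro mult_right_mono divide_right_mono) auto
          finally show "C1 / r * N + (exp (- R) * c0 + C2 / r * N) \<le> C / r * N" .
        qed
        finally show ?thesis .
      qed
    qed
    then show "emeasure (laguerre_measure \<alpha>) {x \<in> pos_orthant. laguerre_maximal \<alpha> f x > ennreal r}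
        \<le> ennreal (C / r * (LINT x|laguerre_measure \<alpha>. norm (f x)))"
      using emeasure_laguerre_measure[OF E_borel E_pos, of \<alpha>] by (simp add: E_def N_def)
  qed
qed

end
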